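(* Let $k\ge 2$, $d\ge1$, let $X=(\mathbb{R}^d)^k$, let $T$ be a smooth manifold of dimension $p$, and let $\Phi\in C^\infty(X,T)$ be a submersion. Let $E\subset\mathbb{R}^d$ be compact, let $K\subset T$ be a compact set containing $\Delta_\Phi(E)$, and let $\beta\ge 0$. Suppose that for every $\mathbf{t}_0\in K$ and every point $x\in Z_{\mathbf{t}_0}$ there exist a neighborhood $U$ of $x$ in $X$, a neighborhood $V$ of $\mathbf{t}_0$ in $T$, and a partition $\sigma\in\mathcal{P}_k$ such that, for $\mathbf{t}\in V$, the generalized Radon transforms $\mathcal{R}^\sigma_{\mathbf{t}}$ localized to $U$ satisfy the double fibration condition and satisfy the $L^2$-Sobolev estimates with a loss of at most $\beta$ derivatives, uniformly in $\mathbf{t}\in V$ (both conditions as defined in the context). If $$\dim_{\mathcal H}(E)>\frac1k\left(\max(d_L,d_R)+p+2\beta\right),$$ where $\max(d_L,d_R)$ denotes the largest value of $\max(d_L^\sigma,d_R^\sigma)$ over the partitions $\sigma$ used in the hypothesis, then $\Delta_\Phi(E)$ has nonempty interior in $T$.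
   Context: $\dim_{\mathcal H}$ is Hausdorff dimension. Points of $X=(\mathbb{R}^d)^k$ are written $(x^1,\dots,x^k)$, $x^i\in\mathbb{R}^d$. Configuration set: $\Delta_\Phi(E)=\{\Phi(x^1,\dots,x^k): x^i\in E,\ 1\le i\le k\}\subset T$. Incidence relation: for $\mathbf{t}\in T$, $Z_{\mathbf{t}}=\Phi^{-1}(\mathbf{t})$, a smooth codimension $p$ submanifold of $X$. It carries the smooth density $\lambda_{\mathbf{t}}=\delta(\Phi(x^1,\dots,x^k)-\mathbf{t})$ (in local coordinates on $T$), i.e. the density determined by the disintegration $\int_X f\,dx=\int_T\big(\int_{Z_{\mathbf{t}}} f\,d\lambda_{\mathbf{t}}\big)d\mathbf{t}$ for $f\in C_c(X)$ supported over the coordinate patch. Partitions: $\mathcal{P}_k$ is the set of the $2^k-2$ partitions $\sigma=(\sigma_L\,|\,\sigma_R)$ of $\{1,\dots,k\}$ into two nonempty sets. Write $x=(x_L;x_R)$ with $x_L=(x^i)_{i\in\sigma_L}\in X_L=(\mathbb{R}^d)^{|\sigma_L|}$ and $x_R=(x^j)_{j\in\sigma_R}\in X_R=(\mathbb{R}^d)^{|\sigma_R|}$. Set $d_L^\sigma=\dim X_L=d|\sigma_L|$, $d_R^\sigma=\dim X_R=d|\sigma_R|$, and $m_{\mathrm{eff}}^\sigma=\frac12\big(p-\min(d_L^\sigma,d_R^\sigma)\big)$. Generalized Radon transform: $\mathcal{R}^\sigma_{\mathbf{t}}$ is the operator from functions on $X_R$ to functions on $X_L$ with Schwartz kernel $\lambda_{\mathbf{t}}$,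 that is, $\mathcal{R}^\sigma_{\mathbf{t}}f(x_L)=\int_{\{x_R:\,\Phi(x_L,x_R)=\mathbf{t}\}}f(x_R)$ with respect to the measure induced by $\lambda_{\mathbf{t}}$. Its localizations to an open set $U\subset X$ are the operators $\mathcal{R}^{\sigma,\chi}_{\mathbf{t}}$ with Schwartz kernel $\chi\lambda_{\mathbf{t}}$, $\chi\in C_c^\infty(U)$. Double fibration condition, localized to $U$: the restrictions to $Z_{\mathbf{t}}\cap U$ of the projections $Z_{\mathbf{t}}\to X_L$ and $Z_{\mathbf{t}}\to X_R$ are submersions. $L^2$-Sobolev estimates with a loss of at most $\beta$ derivatives, localized to $U$ and uniform for $\mathbf{t}\in V$: for every $r\in\mathbb{R}$ and every $\chi\in C_c^\infty(U)$, the operators $\mathcal{R}^{\sigma,\chi}_{\mathbf{t}}:L^2_r(X_R)\to L^2_{r-m_{\mathrm{eff}}^\sigma-\beta}(X_L)$ are bounded, with operator norms bounded independently of $\mathbf{t}\in V$. Here $L^2_r$ is the $L^2$-based Sobolev space of order $r$. *)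

theory Defs
  imports "HOL-Analysis.Analysis"
begin

section \<open>Smooth maps, smooth manifolds, submersions\<close>

text \<open>Only meant for open \<open>S\<close>: the derivatives are taken in the whole space, and \<open>C\<^sup>n\<close> regularity of
  the derivative is expressed through all directional derivatives.\<close>

fun Ck_on :: "nat \<Rightarrow> 'a::euclidean_space set \<Rightarrow> ('a \<Rightarrow> 'b::euclidean_space) \<Rightarrow> bool" where
  "Ck_on 0 S f \<longleftrightarrow> continuous_on S f"
| "Ck_on (Suc n) S f \<longleftrightarrow>
     (\<forall>x\<in>S. f differentiable (at x)) \<and> (\<forall>v. Ck_on n S (\<lambda>x. frechet_derivative f (at x) v))"

definition smooth_on :: "'a::euclidean_space set \<Rightarrow> ('a \<Rightarrow> 'b::euclidean_space) \<Rightarrow> bool" where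
  "smooth_on S f \<longleftrightarrow> (\<forall>n. Ck_on n S f)"

type_synonym ('t, 'p) chart = "'t set \<times> ('t \<Rightarrow> real ^ 'p)"

text \<open>The manifold is the whole type \<open>'t\<close>, its dimension is \<open>CARD('p)\<close>; the Hausdorff and second
  countability axioms are carried by the type classes. The atlas need not be maximal.\<close>

definition smooth_atlas ::
  "('t::{t2_space,second_countable_topology}, 'p::finite) chart set \<Rightarrow> bool" where
  "smooth_atlas \<A> \<longleftrightarrow>
     (\<Union>(D, \<phi>)\<in>\<A>. D) = UNIV \<and>
     (\<forall>(D, \<phi>)\<in>\<A>. open D \<and> open (\<phi> ` D) \<and> homeomorphism D (\<phi> ` D) \<phi> (inv_into D \<phi>)) \<and>
     (\<forall>(D, \<phi>)\<in>\<A>. \<forall>(D', \<phi>')\<in>\<A>. smooth_on (\<phi> ` (D \<inter> D')) (\<phi>' \<circ> inv_into D \<phi>))"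

definition smooth_map_into ::
  "('t::{t2_space,second_countable_topology}, 'p::finite) chart set
     \<Rightarrow> ('a::euclidean_space \<Rightarrow> 't) \<Rightarrow> bool" where
  "smooth_map_into \<A> \<Phi> \<longleftrightarrow>
     (\<forall>(D, \<phi>)\<in>\<A>. open (\<Phi> -` D) \<and> smooth_on (\<Phi> -` D) (\<phi> \<circ> \<Phi>))"

definition submersion_into ::
  "('t::{t2_space,second_countable_topology}, 'p::finite) chart set
     \<Rightarrow> ('a::euclidean_space \<Rightarrow> 't) \<Rightarrow> bool" where
  "submersion_into \<A> \<Phi> \<longleftrightarrow> smooth_map_into \<A> \<Phi> \<and>
     (\<forall>(D, \<phi>)\<in>\<A>. \<forall>x\<in>\<Phi> -` D. surj (frechet_derivative (\<phi> \<circ> \<Phi>) (at x)))"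

text \<open>The tangent space at \<open>x\<close> of the level set \<open>\<Phi> -` {\<Phi> x}\<close> of a submersion, i.e. the kernel of
  the differential of \<open>\<Phi>\<close>, read in charts (the kernel does not depend on the chart).\<close>

definition level_tangent_space ::
  "('t::{t2_space,second_countable_topology}, 'p::finite) chart set
     \<Rightarrow> ('a::euclidean_space \<Rightarrow> 't) \<Rightarrow> 'a \<Rightarrow> 'a set" where
  "level_tangent_space \<A> \<Phi> x =
     {v. \<forall>(D, \<phi>)\<in>\<A>. \<Phi> x \<in> D \<longrightarrow> frechet_derivative (\<phi> \<circ> \<Phi>) (at x) v = 0}"

definition Cc_infinity :: "'a::euclidean_space set \<Rightarrow> ('a \<Rightarrow> complex) set" where
  "Cc_infinity U = {\<eta>. smooth_on UNIV \<eta> \<and> compact (closure {x. \<eta> x \<noteq> 0}) \<and> closure {x. \<eta> x \<noteq> 0} \<subseteq> U}"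


section \<open>Hausdorff dimension\<close>

definition hausdorff_premeasure :: "real \<Rightarrow> real \<Rightarrow> 'a::metric_space set \<Rightarrow> ennreal" where
  "hausdorff_premeasure \<delta> s E =
     Inf {\<Sum>i. ennreal (diameter (C i) powr s) |C :: nat \<Rightarrow> 'a set.
            E \<subseteq> (\<Union>i. C i) \<and> (\<forall>i. bounded (C i) \<and> diameter (C i) \<le> \<delta>)}"

definition hausdorff_measure :: "real \<Rightarrow> 'a::metric_space set \<Rightarrow> ennreal" where
  "hausdorff_measure s E = (SUP \<delta>\<in>{0<..}. hausdorff_premeasure \<delta> s E)"

text \<open>Only \<open>s > 0\<close> is used, since \<open>0 powr 0 = 0\<close> would falsify the measure for \<open>s = 0\<close>; this does
  not change the infimum.\<close>

definition hausdorff_dim :: "'a::metric_space set \<Rightarrow> ereal" where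
  "hausdorff_dim E = Inf {ereal s |s. 0 < s \<and> hausdorff_measure s E = 0}"


section \<open>Configuration sets and blocks of variables\<close>

text \<open>\<open>X\<close> is \<open>real ^ 'd ^ 'k\<close>, with \<open>x $ i\<close> the \<open>i\<close>-th point of the configuration.\<close>

definition configuration_set :: "(real ^ 'd ^ 'k \<Rightarrow> 't) \<Rightarrow> (real ^ 'd) set \<Rightarrow> 't set" where
  "configuration_set \<Phi> E = {\<Phi> x |x. \<forall>i. x $ i \<in> E}"

text \<open>A partition \<open>(\<sigma>\<^sub>L | \<sigma>\<^sub>R)\<close> is given by its left block \<open>L\<close>; the right block is \<open>- L\<close>.\<close>

definition partitions :: "'k::finite set set" where
  "partitions = {L. L \<noteq> {} \<and> - L \<noteq> {}}"

text \<open>For a set \<open>S\<close> of indices, the points of the block space \<open>X\<^sub>S\<close> are the extensional functions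
  \<open>S \<rightarrow>\<^sub>E UNIV\<close>, with product Lebesgue measure. (A type cannot depend on \<open>S\<close>.)\<close>

abbreviation block_space :: "'k::finite set \<Rightarrow> ('k \<Rightarrow> real ^ 'd) set" where
  "block_space S \<equiv> (S \<rightarrow>\<^sub>E UNIV)"

abbreviation block_lborel :: "'k::finite set \<Rightarrow> ('k \<Rightarrow> real ^ 'd::finite) measure" where
  "block_lborel S \<equiv> Pi\<^sub>M S (\<lambda>_. lborel)"

definition block :: "'k::finite set \<Rightarrow> real ^ 'd ^ 'k \<Rightarrow> 'k \<Rightarrow> real ^ 'd" where
  "block S x = (\<lambda>i\<in>S. x $ i)"

text \<open>Smoothness of a function on \<open>X\<^sub>S\<close> is that of its pullback to \<open>X\<close> under the projection.\<close>

definition block_Cc_infinity :: "'k::finite set \<Rightarrow> (('k \<Rightarrow> real ^ 'd::finite) \<Rightarrow> complex) set" where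
  "block_Cc_infinity S =
     {f. smooth_on UNIV (f \<circ> (block S :: real ^ 'd ^ 'k \<Rightarrow> _)) \<and>
         (\<exists>B. \<forall>w\<in>block_space S. f w \<noteq> 0 \<longrightarrow> (\<forall>i\<in>S. norm (w i) \<le> B))}"


section \<open>Sobolev norms\<close>

text \<open>A distribution on \<open>X\<^sub>S\<close> is represented by its pairing \<open>g \<mapsto> \<langle>u, g\<rangle>\<close>. All distributions
  occurring here have compact support, so that the pairing is also defined on exponentials and the
  Fourier transform is \<open>\<xi> \<mapsto> \<langle>u, exp (- \<i> \<xi> \<bullet> w)\<rangle>\<close>.\<close>

type_synonym ('k, 'd) block_distr = "(('k \<Rightarrow> real ^ 'd) \<Rightarrow> complex) \<Rightarrow> complex"

definition distr_of_fun ::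
  "'k::finite set \<Rightarrow> (('k \<Rightarrow> real ^ 'd::finite) \<Rightarrow> complex) \<Rightarrow> ('k, 'd) block_distr" where
  "distr_of_fun S f = (\<lambda>g. \<integral>w. f w * g w \<partial>block_lborel S)"

definition fourier ::
  "'k::finite set \<Rightarrow> ('k, 'd::finite) block_distr \<Rightarrow> ('k \<Rightarrow> real ^ 'd) \<Rightarrow> complex" where
  "fourier S u \<xi> = u (\<lambda>w. cis (- (\<Sum>i\<in>S. \<xi> i \<bullet> w i)))"

definition sobolev_integral ::
  "'k::finite set \<Rightarrow> real \<Rightarrow> ('k, 'd::finite) block_distr \<Rightarrow> ennreal" where
  "sobolev_integral S r u =
     (\<integral>\<^sup>+\<xi>. ennreal ((1 + (\<Sum>i\<in>S. (norm (\<xi> i))\<^sup>2)) powr r * (norm (fourier S u \<xi>))\<^sup>2) \<partial>block_lborel S)"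

definition in_sobolev ::
  "'k::finite set \<Rightarrow> real \<Rightarrow> ('k, 'd::finite) block_distr \<Rightarrow> bool" where
  "in_sobolev S r u \<longleftrightarrow> fourier S u \<in> borel_measurable (block_lborel S) \<and> sobolev_integral S r u < \<infinity>"

definition sobolev_norm ::
  "'k::finite set \<Rightarrow> real \<Rightarrow> ('k, 'd::finite) block_distr \<Rightarrow> real" where
  "sobolev_norm S r u = sqrt (enn2real (sobolev_integral S r u))"

text \<open>An operator from \<open>C\<^sub>c\<^sup>\<infinity>(X\<^sub>R)\<close> to distributions on \<open>X\<^sub>L\<close> is bounded from \<open>L\<^sup>2\<^sub>r(X\<^sub>R)\<close> to
  \<open>L\<^sup>2\<^sub>s(X\<^sub>L)\<close> with norm at most \<open>C\<close> if it satisfies the estimate on the dense subspace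
  \<open>C\<^sub>c\<^sup>\<infinity>(X\<^sub>R)\<close>. The order \<open>r\<close> may be negative, so elements of \<open>L\<^sup>2\<^sub>r\<close> are not functions in general and
  the operator acts on all of \<open>L\<^sup>2\<^sub>r\<close> by continuous extension.\<close>

definition sobolev_bounded ::
  "'k::finite set \<Rightarrow> 'k set \<Rightarrow> real \<Rightarrow> real \<Rightarrow> real
     \<Rightarrow> ((('k \<Rightarrow> real ^ 'd::finite) \<Rightarrow> complex) \<Rightarrow> ('k, 'd) block_distr) \<Rightarrow> bool" where
  "sobolev_bounded R L r s C A \<longleftrightarrow>
     (\<forall>f\<in>block_Cc_infinity R.
        in_sobolev L s (A f) \<and> sobolev_norm L s (A f) \<le> C * sobolev_norm R r (distr_of_fun R f))"


section \<open>Densities on level sets and generalized Radon transforms\<close>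

text \<open>\<open>\<mu> t\<close> is the density \<open>\<delta>(\<Phi> - t)\<close> on \<open>\<Phi> -` {t}\<close> in the coordinates \<open>\<phi>\<close>, viewed as a measure
  on \<open>X\<close> concentrated on the level set. The disintegration formula alone determines \<open>\<mu> t\<close> for almost
  every \<open>t\<close> only; the continuous dependence on \<open>t\<close> (automatic for \<open>\<delta>(\<Phi> - t)\<close>) makes it unique for
  every \<open>t\<close> in \<open>D\<close>.\<close>

definition level_density ::
  "('t::{t2_space,second_countable_topology}, 'p::finite) chart
     \<Rightarrow> ('a::euclidean_space \<Rightarrow> 't) \<Rightarrow> ('t \<Rightarrow> 'a measure) \<Rightarrow> bool" where
  "level_density c \<Phi> \<mu> \<longleftrightarrow> (case c of (D, \<phi>) \<Rightarrow>
     (\<forall>t\<in>D. sets (\<mu> t) = sets borel \<and> emeasure (\<mu> t) (- (\<Phi> -` {t})) = 0 \<and>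
            (\<forall>C. compact C \<longrightarrow> emeasure (\<mu> t) C < \<infinity>)) \<and>
     (\<forall>f :: 'a \<Rightarrow> real.
        continuous_on UNIV f \<and> compact (closure {x. f x \<noteq> 0}) \<and> closure {x. f x \<noteq> 0} \<subseteq> \<Phi> -` D \<longrightarrow>
          continuous_on D (\<lambda>t. \<integral>x. f x \<partial>\<mu> t) \<and>
          (\<integral>x. f x \<partial>lborel) = (LINT s:\<phi> ` D|lborel. (\<integral>x. f x \<partial>\<mu> (inv_into D \<phi> s)))))"

text \<open>The operator with Schwartz kernel \<open>\<eta> \<mu>\<close>: it maps \<open>f\<close> to the distribution
  \<open>g \<mapsto> \<langle>\<eta> \<mu>, g \<otimes> f\<rangle>\<close> on \<open>X\<^sub>L\<close>.\<close>

definition radon ::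
  "'k::finite set \<Rightarrow> (real ^ 'd::finite ^ 'k \<Rightarrow> complex) \<Rightarrow> (real ^ 'd ^ 'k) measure
     \<Rightarrow> (('k \<Rightarrow> real ^ 'd) \<Rightarrow> complex) \<Rightarrow> ('k, 'd) block_distr" where
  "radon L \<eta> \<mu> f = (\<lambda>g. \<integral>x. \<eta> x * f (block (- L) x) * g (block L x) \<partial>\<mu>)"

definition double_fibration ::
  "('t::{t2_space,second_countable_topology}, 'p::finite) chart set
     \<Rightarrow> (real ^ 'd::finite ^ 'k::finite \<Rightarrow> 't) \<Rightarrow> 'k set \<Rightarrow> (real ^ 'd ^ 'k) set \<Rightarrow> 't \<Rightarrow> bool" where
  "double_fibration \<A> \<Phi> L U t \<longleftrightarrow>
     (\<forall>x\<in>\<Phi> -` {t} \<inter> U.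
        block L ` level_tangent_space \<A> \<Phi> x = block_space L \<and>
        block (- L) ` level_tangent_space \<A> \<Phi> x = block_space (- L))"

definition m_eff :: "nat \<Rightarrow> nat \<Rightarrow> nat \<Rightarrow> real" where
  "m_eff p dL dR = (real p - real (min dL dR)) / 2"

definition sobolev_estimates ::
  "('t::{t2_space,second_countable_topology} \<Rightarrow> (real ^ 'd::finite ^ 'k::finite) measure)
     \<Rightarrow> nat \<Rightarrow> real \<Rightarrow> 'k set \<Rightarrow> (real ^ 'd ^ 'k) set \<Rightarrow> 't set \<Rightarrow> bool" where
  "sobolev_estimates \<mu> p \<beta> L U V \<longleftrightarrow>
     (\<forall>r. \<forall>\<eta>\<in>Cc_infinity U. \<exists>C. \<forall>t\<in>V.
        sobolev_bounded (- L) L r (r - m_eff p (CARD('d) * card L) (CARD('d) * card (- L)) - \<beta>) C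
          (radon L \<eta> (\<mu> t)))"

end

theory Submission
  imports Defs "HOL-Probability.Probability"
begin

text \<open>A Frostman measure \<open>\<mu>\<close> on \<open>E\<close> of exponent \<open>s\<close> above the threshold has finite energy of some
  order \<open>a > (d - s) / 2\<close>, so that tensor powers of \<open>\<mu>\<close> lie in Sobolev spaces of order \<open>- a\<close> per factor.
  Let \<open>\<mu>\<^sub>L\<close> and \<open>\<mu>\<^sub>R\<close> be the tensor powers of \<open>\<mu>\<close> over the two blocks of the partition given near a
  diagonal point of the support of \<open>\<mu>\<close>. The threshold is what makes the pairing of
  the Radon transform of \<open>\<mu>\<^sub>R\<close> with \<open>\<mu>\<^sub>L\<close> bounded uniformly in \<open>t\<close>, hence a uniform limit on \<open>V\<close> of the
  continuous functions \<open>I m t\<close> obtained by mollifying \<open>\<mu>\<close>. At a point outside the configuration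
  set \<open>I m t\<close> tends to \<open>0\<close>, because there the level set is at positive distance from the product of the
  copies of \<open>E\<close>. If the configuration set had empty interior, such points would be dense and \<open>I m\<close> would tend
  to \<open>0\<close> uniformly; but by disintegration its integral is the mass of the mollified product measure near
  the diagonal point, which stays bounded below.

  The right block is mollified by a compactly supported bump, as the Sobolev estimate requires, and the left
  block by the heat kernel, whose Fourier inversion is explicit.\<close>

section \<open>Smooth functions\<close>

text \<open>The threshold comes from balancing orders. With order \<open>a\<close> per factor, the
  estimate at \<open>r = - (a * card (- L))\<close> gives order \<open>r - m_eff - \<beta>\<close>
  on the left, and pairing with the left block requires this to be \<open>a * card L\<close>. Since
  the two block dimensions add up to \<open>d * k\<close>, this means
  \<open>a = (d - b') / 2\<close> with \<open>b' = (max dL dR + p + 2 * \<beta>) / k\<close>. The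
  energy of that order is finite as soon as \<open>b' < s\<close>, so both demands can be met
  exactly above the threshold.

  The boundedness hypothesis speaks only of inputs in \<open>block_Cc_infinity\<close>, whereas
  tensor powers of the measure are singular. The operator is therefore never applied to them: all
  that is used is a Cauchy estimate between mollified tensors, and no limit density on the target
  manifold is constructed.

  The heat kernel has a cost: its mollification does not vanish off \<open>E\<close>. Its Gaussian
  tail decays faster than every power of \<open>m\<close>, which outweighs the polynomial growth in
  \<open>m\<close> of the remaining factors.\<close>

lemma Ck_on_Suc_UNIV:
  "Ck_on (Suc n) UNIV f \<longleftrightarrow> (\<forall>x. f differentiable (at x)) \<and> (\<forall>v. Ck_on n UNIV (\<lambda>x. frechet_derivative f (at x) v))"
  by simp

lemma Ck_on_SucI:
  fixes f :: "'a::euclidean_space \<Rightarrow> 'b::euclidean_space"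
  assumes "\<And>x. (f has_derivative f' x) (at x)" "\<And>v. Ck_on n UNIV (\<lambda>x. f' x v)"
  shows "Ck_on (Suc n) UNIV f"
proof -
  have "frechet_derivative f (at x) = f' x" for x
    using frechet_derivative_at[OF assms(1)[of x]] by simp
  then show ?thesis using assms by (auto simp: differentiable_def)
qed

lemma Ck_on_Suc_imp:
  fixes f :: "'a::euclidean_space \<Rightarrow> 'b::euclidean_space"
  shows "Ck_on (Suc n) UNIV f \<Longrightarrow> Ck_on n UNIV f"
proof (induction n arbitrary: f)
  case 0
  then show ?case by (simp add: continuous_at_imp_continuous_on differentiable_imp_continuous_within)
next
  case (Suc n)
  have "\<forall>x. f differentiable (at x)" and "\<forall>v. Ck_on (Suc n) UNIV (\<lambda>x. frechet_derivative f (at x) v)"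
    using Suc.prems unfolding Ck_on_Suc_UNIV[of "Suc n"] by blast+
  with Suc.IH show ?case unfolding Ck_on_Suc_UNIV[of n f] by blast
qed

lemma Ck_on_Suc_derivative:
  fixes f :: "'a::euclidean_space \<Rightarrow> 'b::euclidean_space"
  assumes "Ck_on (Suc n) UNIV f"
  shows "(f has_derivative frechet_derivative f (at x)) (at x)"
    "Ck_on n UNIV (\<lambda>x. frechet_derivative f (at x) v)"
  using assms by (auto simp: frechet_derivative_works[symmetric])

lemma Ck_on_const: "Ck_on n UNIV (\<lambda>x::'a::euclidean_space. c::'b::euclidean_space)"
proof (induction n arbitrary: c)
  case (Suc n)
  show ?case by (rule Ck_on_SucI[where f' = "\<lambda>_ _. 0"]) (auto intro: Suc)
qed simp

lemma Ck_on_bounded_linear: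
  fixes l :: "'a::euclidean_space \<Rightarrow> 'b::euclidean_space"
  assumes l: "bounded_linear l"
  shows "Ck_on n UNIV l"
proof (cases n)
  case 0
  then show ?thesis using linear_continuous_on[OF l] by simp
next
  case (Suc m)
  show ?thesis unfolding Suc
    by (rule Ck_on_SucI[where f' = "\<lambda>_. l"]) (auto intro: bounded_linear_imp_has_derivative l Ck_on_const)
qed

lemma Ck_on_compose_bounded_linear:
  fixes f :: "'b::euclidean_space \<Rightarrow> 'c::euclidean_space" and l :: "'a::euclidean_space \<Rightarrow> 'b"
  assumes l: "bounded_linear l"
  shows "Ck_on n UNIV f \<Longrightarrow> Ck_on n UNIV (\<lambda>x. f (l x))"
proof (induction n arbitrary: f)
  case 0
  then show ?case using continuous_on_compose2[of UNIV f UNIV l] linear_continuous_on[OF l, of UNIV] by simp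
next
  case (Suc n)
  note D = Ck_on_Suc_derivative[OF Suc.prems]
  show ?case
  proof (rule Ck_on_SucI)
    show "((\<lambda>x. f (l x)) has_derivative (\<lambda>v. frechet_derivative f (at (l x)) (l v))) (at x)" for x
      using has_derivative_compose[OF bounded_linear_imp_has_derivative[OF l] D(1)] .
    show "Ck_on n UNIV (\<lambda>x. frechet_derivative f (at (l x)) (l v))" for v
      by (rule Suc.IH[OF D(2)])
  qed
qed

lemma Ck_on_bounded_linear_compose:
  fixes f :: "'a::euclidean_space \<Rightarrow> 'b::euclidean_space" and l :: "'b \<Rightarrow> 'c::euclidean_space"
  assumes l: "bounded_linear l"
  shows "Ck_on n UNIV f \<Longrightarrow> Ck_on n UNIV (\<lambda>x. l (f x))"
proof (induction n arbitrary: f)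
  case 0
  then show ?case using continuous_on_compose2[of UNIV l UNIV f] linear_continuous_on[OF l, of UNIV] by simp
next
  case (Suc n)
  note D = Ck_on_Suc_derivative[OF Suc.prems]
  show ?case
  proof (rule Ck_on_SucI)
    show "((\<lambda>x. l (f x)) has_derivative (\<lambda>v. l (frechet_derivative f (at x) v))) (at x)" for x
      by (rule bounded_linear.has_derivative[OF l D(1)])
    show "Ck_on n UNIV (\<lambda>x. l (frechet_derivative f (at x) v))" for v
      by (rule Suc.IH[OF D(2)])
  qed
qed

lemma Ck_on_add:
  fixes f g :: "'a::euclidean_space \<Rightarrow> 'b::euclidean_space"
  shows "Ck_on n UNIV f \<Longrightarrow> Ck_on n UNIV g \<Longrightarrow> Ck_on n UNIV (\<lambda>x. f x + g x)"
proof (induction n arbitrary: f g)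
  case 0
  then show ?case by (auto intro: continuous_intros)
next
  case (Suc n)
  note D = Ck_on_Suc_derivative[OF Suc.prems(1)] Ck_on_Suc_derivative[OF Suc.prems(2)]
  show ?case
    by (rule Ck_on_SucI[OF has_derivative_add[OF D(1) D(3)]]) (intro Suc.IH D)
qed

lemma Ck_on_minus:
  fixes f :: "'a::euclidean_space \<Rightarrow> 'b::euclidean_space"
  shows "Ck_on n UNIV f \<Longrightarrow> Ck_on n UNIV (\<lambda>x. - f x)"
  by (rule Ck_on_bounded_linear_compose[where f = f, OF bounded_linear_minus[OF bounded_linear_ident]])

lemma Ck_on_mult:
  fixes f g :: "'a::euclidean_space \<Rightarrow> 'b::{euclidean_space, real_normed_algebra}"
  shows "Ck_on n UNIV f \<Longrightarrow> Ck_on n UNIV g \<Longrightarrow> Ck_on n UNIV (\<lambda>x. f x * g x)"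
proof (induction n arbitrary: f g)
  case 0
  then show ?case by (auto intro: continuous_intros)
next
  case (Suc n)
  note D = Ck_on_Suc_derivative[OF Suc.prems(1)] Ck_on_Suc_derivative[OF Suc.prems(2)]
  show ?case
    by (rule Ck_on_SucI[OF has_derivative_mult[OF D(1) D(3)]])
       (intro Ck_on_add Suc.IH D Suc.prems[THEN Ck_on_Suc_imp])
qed

lemma Ck_on_prod:
  fixes f :: "'i \<Rightarrow> 'a::euclidean_space \<Rightarrow> 'b::{euclidean_space, real_normed_field}"
  assumes "\<And>i. i \<in> I \<Longrightarrow> Ck_on n UNIV (f i)"
  shows "Ck_on n UNIV (\<lambda>x. \<Prod>i\<in>I. f i x)"
  using assms
proof (induction I rule: infinite_finite_induct)
  case (insert i I)
  then show ?case by (simp add: Ck_on_mult)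
qed (simp_all add: Ck_on_const)

text \<open>The family \<open>t\<^sup>-\<^sup>m exp (- 1 / t)\<close> is closed under differentiation up to linear combinations.\<close>

definition exp_flat :: "nat \<Rightarrow> real \<Rightarrow> real" where
  "exp_flat m t = (if t > 0 then exp (- (1 / t)) / t ^ m else 0)"

lemma exp_flat_nonneg: "exp_flat m t \<ge> 0"
  by (simp add: exp_flat_def)

text \<open>Under \<open>u = 1 / t\<close> the limit from the right is the decay of
  \<open>u ^ m / exp u\<close> at infinity; on the left the function is identically 0.\<close>

lemma exp_flat_tendsto_0: "(exp_flat m \<longlongrightarrow> 0) (at 0)"
proof -
  have "((\<lambda>t::real. exp (- (1 / t)) / t ^ m) \<longlongrightarrow> 0) (at_right 0)"
  proof -
    have "((\<lambda>u::real. u ^ m / exp u) \<longlongrightarrow> 0) at_top" by (rule tendsto_power_div_exp_0)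
    then have "((\<lambda>t::real. (inverse t) ^ m / exp (inverse t)) \<longlongrightarrow> 0) (at_right 0)"
      using filterlim_inverse_at_top_right by (rule filterlim_compose)
    then show ?thesis by (simp add: exp_minus field_simps)
  qed
  then have "(exp_flat m \<longlongrightarrow> 0) (at_right 0)"
    by (rule Lim_transform_eventually) (auto simp: exp_flat_def eventually_at_filter)
  moreover have "(exp_flat m \<longlongrightarrow> 0) (at_left 0)"
    by (rule tendsto_eventually) (auto simp: exp_flat_def eventually_at_filter)
  ultimately show ?thesis by (simp add: filterlim_split_at)
qed

lemma DERIV_exp_flat: "(exp_flat m has_real_derivative (exp_flat (m + 2) t - m * exp_flat (m + 1) t)) (at t)"
proof -
  consider "t > 0" | "t < 0" | "t = 0" by linarith
  then show ?thesis
  proof cases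
    case 1
    have d1: "((\<lambda>t. - (1 / t)) has_real_derivative 1 / t ^ 2) (at t)"
      using 1 by (auto intro!: derivative_eq_intros simp: power2_eq_square)
    have d2: "((\<lambda>t. t ^ m) has_real_derivative m * t ^ (m - 1)) (at t)"
      by (auto intro!: derivative_eq_intros)
    have "((\<lambda>t. exp (- (1 / t)) / t ^ m) has_real_derivative
        (exp (- (1 / t)) * (1 / t ^ 2) * t ^ m - exp (- (1 / t)) * (m * t ^ (m - 1))) / (t ^ m * t ^ m)) (at t)"
      using 1 by (intro DERIV_divide DERIV_fun_exp d1 d2) simp
    also have "(exp (- (1 / t)) * (1 / t ^ 2) * t ^ m - exp (- (1 / t)) * (m * t ^ (m - 1))) / (t ^ m * t ^ m)
        = exp_flat (m + 2) t - m * exp_flat (m + 1) t"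
      using 1 by (cases m) (simp_all add: exp_flat_def field_simps power2_eq_square)
    finally have "((\<lambda>t. exp (- (1 / t)) / t ^ m) has_real_derivative
        (exp_flat (m + 2) t - m * exp_flat (m + 1) t)) (at t)" .
    then show ?thesis
      by (rule has_field_derivative_transform_within_open[where S = "{0<..}"])
         (use 1 in \<open>auto simp: exp_flat_def\<close>)
  next
    case 2
    have "((\<lambda>t. 0) has_real_derivative (exp_flat (m + 2) t - m * exp_flat (m + 1) t)) (at t)"
      using 2 by (simp add: exp_flat_def)
    then show ?thesis
      by (rule has_field_derivative_transform_within_open[where S = "{..<0}"])
         (use 2 in \<open>auto simp: exp_flat_def\<close>)
  next
    case 3
    \<comment> \<open>Off 0, the difference quotient of \<open>exp_flat m\<close> at 0 is
      \<open>exp_flat (m + 1)\<close>, so the previous limit applies with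
      \<open>m + 1\<close>.\<close>
    have "((\<lambda>h. (exp_flat m (0 + h) - exp_flat m 0) / h) \<longlongrightarrow> 0) (at 0)"
      using exp_flat_tendsto_0[of "m + 1"]
      by (rule Lim_transform_eventually) (auto simp: exp_flat_def eventually_at_filter)
    then show ?thesis using 3 by (simp add: DERIV_def exp_flat_def)
  qed
qed

text \<open>The induction has to treat all \<open>m\<close> at once, because a derivative moves
  \<open>m\<close> to \<open>m + 1\<close> and \<open>m + 2\<close>. Using
  \<open>x \<bullet> x\<close> instead of the norm keeps the inner function smooth at the
  origin.\<close>

lemma Ck_on_exp_flat_sphere:
  fixes c :: real
  shows "Ck_on n UNIV (\<lambda>x::'a::euclidean_space. exp_flat m (1 - c * (x \<bullet> x)))"
proof (induction n arbitrary: m)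
  case 0
  have "continuous_on UNIV (exp_flat m)"
    by (rule DERIV_continuous_on[OF has_field_derivative_at_within[OF DERIV_exp_flat]])
  then have "continuous_on UNIV (\<lambda>x::'a. exp_flat m (1 - c * (x \<bullet> x)))"
    by (rule continuous_on_compose2[where f = "\<lambda>x::'a. 1 - c * (x \<bullet> x)"]) (auto intro!: continuous_intros)
  then show ?case by simp
next
  case (Suc n)
  let ?q = "\<lambda>x::'a. 1 - c * (x \<bullet> x)"
  have d: "(?q has_derivative (\<lambda>v. (- 2 * c) * (x \<bullet> v))) (at x)" for x
    by (auto intro!: derivative_eq_intros simp: inner_commute)
  show ?case
  proof (rule Ck_on_SucI)
    show "((\<lambda>x. exp_flat m (?q x)) has_derivative
        (\<lambda>v. ((- 2 * c) * (x \<bullet> v)) * (exp_flat (m + 2) (?q x) + - (m * exp_flat (m + 1) (?q x))))) (at x)" for x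
      using DERIV_compose_FDERIV[OF DERIV_exp_flat d] by simp
    show "Ck_on n UNIV (\<lambda>x. ((- 2 * c) * (x \<bullet> v)) * (exp_flat (m + 2) (?q x) + - (m * exp_flat (m + 1) (?q x))))" for v
      by (intro Ck_on_mult Ck_on_add Ck_on_minus Suc.IH Ck_on_const
          Ck_on_bounded_linear bounded_linear_inner_left)
  qed
qed

text \<open>Differentiation under the integral sign is justified by the uniform continuity of the derivatives
  of \<open>k\<close>, whose supports are compact.\<close>

lemma Ck_on_convolution:
  fixes k :: "'a::euclidean_space \<Rightarrow> 'b::euclidean_space" and \<mu> :: "'a measure"
  assumes \<mu>: "finite_measure \<mu>" "sets \<mu> = sets borel"
  shows "Ck_on n UNIV k \<Longrightarrow> (\<And>x. norm x > R \<Longrightarrow> k x = 0) \<Longrightarrow> Ck_on n UNIV (\<lambda>w. \<integral>y. k (w - y) \<partial>\<mu>)"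
proof (induction n arbitrary: k)
  interpret finite_measure \<mu> by (rule \<mu>(1))
  have int: "integrable \<mu> (\<lambda>y. k (w - y))"
    if "continuous_on UNIV k" "bounded (range k)" for k :: "'a \<Rightarrow> 'b" and w
  proof -
    obtain B where "\<And>x. norm (k x) \<le> B" using \<open>bounded (range k)\<close> by (auto simp: bounded_iff)
    moreover have "(\<lambda>y. k (w - y)) \<in> borel_measurable borel"
      by (intro borel_measurable_continuous_onI continuous_on_compose2[OF that(1)] continuous_intros) auto
    ultimately show ?thesis
      by (intro integrable_const_bound[where B = B]) (simp_all add: measurable_cong_sets[OF \<mu>(2) refl])
  qed
  have bdd: "bounded (range k)" if "continuous_on UNIV k" "\<And>x. norm x > R \<Longrightarrow> k x = 0" for k :: "'a \<Rightarrow> 'b"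
  proof -
    have "compact (k ` cball 0 R)"
      by (intro compact_continuous_image continuous_on_subset[OF that(1)]) auto
    then have "bounded (insert 0 (k ` cball 0 R))" by (simp add: compact_imp_bounded)
    then show ?thesis
    proof (rule bounded_subset)
      show "range k \<subseteq> insert 0 (k ` cball 0 R)" using that(2) by (force simp: not_less)
    qed
  qed
  {
    case 0
    then have k: "continuous_on UNIV k" by simp
    obtain B where B: "\<And>x. norm (k x) \<le> B" using bdd[OF k 0(2)] by (auto simp: bounded_iff)
    have "continuous_on UNIV (\<lambda>w. \<integral>y. k (w - y) \<partial>\<mu>)"
    proof (rule continuous_on_sequentiallyI)
      fix u :: "nat \<Rightarrow> 'a" and a assume u: "u \<longlonglongrightarrow> a"
      show "(\<lambda>n. \<integral>y. k (u n - y) \<partial>\<mu>) \<longlonglongrightarrow> (\<integral>y. k (a - y) \<partial>\<mu>)"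
      proof (rule integral_dominated_convergence[where w = "\<lambda>_. B"])
        show "AE y in \<mu>. (\<lambda>n. k (u n - y)) \<longlonglongrightarrow> k (a - y)"
          using k u by (intro AE_I2) (auto intro!: continuous_on_tendsto_compose[OF k] tendsto_intros)
        show "(\<lambda>y. k (w - y)) \<in> borel_measurable \<mu>" for w
          by (rule borel_measurable_integrable[OF int[OF k bdd[OF k 0(2)]]])
        then show "(\<lambda>y. k (u n - y)) \<in> borel_measurable \<mu>" for n .
        show "AE y in \<mu>. norm (k (u n - y)) \<le> B" for n by (intro AE_I2 B)
      qed simp
    qed
    then show ?case by simp
  next
    case (Suc n)
    define k' where "k' = (\<lambda>x. frechet_derivative k (at x))"
    have D: "(k has_derivative k' x) (at x)" "Ck_on n UNIV (\<lambda>x. k' x v)" for x v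
      unfolding k'_def by (rule Ck_on_Suc_derivative[OF Suc.prems(1)])+
    have kc: "continuous_on UNIV k"
      by (intro continuous_at_imp_continuous_on ballI has_derivative_continuous[OF D(1)])
    have Ck_cont: "continuous_on UNIV f" if "Ck_on n UNIV f" for f :: "'a \<Rightarrow> 'b"
      using that by (cases n) (auto simp: continuous_at_imp_continuous_on differentiable_imp_continuous_within)
    have k'c: "continuous_on UNIV (\<lambda>x. k' x v)" for v by (rule Ck_cont[OF D(2)])
    have k'0: "k' x v = 0" if "norm x > R" for x v
    proof -
      have "open {x::'a. norm x > R}" by (intro open_Collect_less continuous_intros)
      then have "(k has_derivative (\<lambda>_. 0)) (at x)"
        using that Suc.prems(2)
        by (intro has_derivative_transform_within_open[OF has_derivative_const[of 0]]) auto
      from has_derivative_unique[OF D(1) this] show ?thesis by simp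
    qed
    have lin: "linear (k' x)" for x by (rule has_derivative_linear[OF D(1)])
    define F' where "F' = (\<lambda>w v. \<integral>y. k' (w - y) v \<partial>\<mu>)"
    have int': "integrable \<mu> (\<lambda>y. k' (w - y) v)" for w v
      by (rule int[OF k'c bdd[OF k'c k'0]])
    have linF: "linear (F' w)" for w
      unfolding F'_def
      by (rule linearI) (simp_all add: linear_add[OF lin] linear_scale[OF lin] int')
    show ?case
    proof (rule Ck_on_SucI)
      show "Ck_on n UNIV (\<lambda>w. F' w v)" for v
        unfolding F'_def by (rule Suc.IH[OF D(2) k'0])
      fix w
      show "((\<lambda>w. \<integral>y. k (w - y) \<partial>\<mu>) has_derivative F' w) (at w)"
        unfolding has_derivative_at_alt
      proof (intro conjI allI impI)
        show "bounded_linear (F' w)" by (rule linear_conv_bounded_linear[THEN iffD1, OF linF])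
        fix e :: real assume e: "e > 0"
        \<comment> \<open>The added 1 keeps \<open>M\<close> positive even for the zero measure. The
          factor \<open>DIM('a)\<close> in \<open>e'\<close> pays for the sum over basis directions
          in \<open>op\<close>.\<close>
        define M where "M = measure \<mu> (space \<mu>) + 1"
        have M: "M > 0" by (simp add: M_def add_nonneg_pos)
        define e' where "e' = e / (M * DIM('a))"
        have e': "e' > 0" using e M by (simp add: e'_def)
        have ex: "\<exists>d>0. \<forall>x y. dist y x < d \<longrightarrow> dist (k' y b) (k' x b) < e'" for b
        proof -
          have "uniformly_continuous_on (cball 0 (R + 1)) (\<lambda>x. k' x b)"
            by (rule compact_uniformly_continuous[OF continuous_on_subset[OF k'c]]) auto
          then obtain d where d: "d > 0"
            "\<And>x y. x \<in> cball 0 (R + 1) \<Longrightarrow> y \<in> cball 0 (R + 1) \<Longrightarrow> dist y x < d \<Longrightarrow> dist (k' y b) (k' x b) < e'"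
            using e' unfolding uniformly_continuous_on_def by blast
          \<comment> \<open>Two points at distance below 1 either both lie in the ball of radius
            \<open>R + 1\<close>, where uniform continuity applies, or both have norm above
            \<open>R\<close>, where the derivative vanishes.\<close>
          have "dist (k' y b) (k' x b) < e'" if "dist y x < min d 1" for x y
          proof (cases "x \<in> cball 0 (R + 1) \<and> y \<in> cball 0 (R + 1)")
            case True
            then show ?thesis using d(2) that by simp
          next
            case False
            have "norm x > R" "norm y > R"
              using False that norm_triangle_ineq2[of x y] norm_triangle_ineq2[of y x]
              by (auto simp: dist_norm norm_minus_commute)
            then show ?thesis using k'0 e' by simp
          qed
          then show ?thesis using d(1) by (intro exI[of _ "min d 1"]) auto
        qed
        obtain dd where dd: "\<And>b. dd b > 0" "\<And>b x y. dist y x < dd b \<Longrightarrow> dist (k' y b) (k' x b) < e'"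
        proof
          define dd where "dd = (\<lambda>b. SOME d. d > 0 \<and> (\<forall>x y. dist y x < d \<longrightarrow> dist (k' y b) (k' x b) < e'))"
          have "dd b > 0 \<and> (\<forall>x y. dist y x < dd b \<longrightarrow> dist (k' y b) (k' x b) < e')" for b
            unfolding dd_def by (rule someI_ex[OF ex])
          then show "\<And>b. dd b > 0" "\<And>b x y. dist y x < dd b \<Longrightarrow> dist (k' y b) (k' x b) < e'"
            by simp_all
        qed
        define d where "d = Min (dd ` (Basis :: 'a set))"
        have d: "d > 0" "\<And>b. b \<in> Basis \<Longrightarrow> d \<le> dd b" using dd(1) by (auto simp: d_def)
        have op: "norm (k' y v - k' x v) \<le> e' * DIM('a) * norm v" if "dist y x < d" for x y v
        proof -
          have "k' z v = (\<Sum>b\<in>Basis. (v \<bullet> b) *\<^sub>R k' z b)" for z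
            using linear_sum[OF lin, of z "\<lambda>b. (v \<bullet> b) *\<^sub>R b" Basis]
            by (simp add: linear_scale[OF lin] euclidean_representation)
          then have "k' y v - k' x v = (\<Sum>b\<in>Basis. (v \<bullet> b) *\<^sub>R (k' y b - k' x b))"
            by (simp add: sum_subtractf scaleR_diff_right)
          also have "norm \<dots> \<le> (\<Sum>b\<in>(Basis::'a set). norm v * e')"
          proof (rule sum_norm_le)
            fix b :: 'a assume b: "b \<in> Basis"
            have "norm (k' y b - k' x b) \<le> e'"
              using dd(2)[of y x b] d(2)[OF b] that by (simp add: dist_norm)
            then show "norm ((v \<bullet> b) *\<^sub>R (k' y b - k' x b)) \<le> norm v * e'"
              using Basis_le_norm[OF b, of v] e' by (auto intro: mult_mono)
          qed
          finally show ?thesis by (simp add: mult_ac)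
        qed
        \<comment> \<open>The linearization error along a segment is at most its length times the
          oscillation of the derivative, and this bound does not depend on \<open>y\<close>; so it
          can be integrated.\<close>
        have lip: "norm (k (w' - y) - k (w - y) - k' (w - y) (w' - w)) \<le> e' * DIM('a) * norm (w' - w)"
          if w': "norm (w' - w) < d" for w' y
        proof -
          let ?S = "closed_segment (w - y) (w' - y)"
          have "norm (k (w' - y) - k (w - y) - k' (w - y) ((w' - y) - (w - y))) \<le> norm ((w' - y) - (w - y)) * (e' * DIM('a))"
          proof (rule differentiable_bound_linearization[where S = ?S and f' = k'])
            show "(w - y) + t *\<^sub>R ((w' - y) - (w - y)) \<in> ?S" if "t \<in> {0..1}" for t
            proof -
              have "(w - y) + t *\<^sub>R ((w' - y) - (w - y)) = (1 - t) *\<^sub>R (w - y) + t *\<^sub>R (w' - y)"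
                by (simp add: algebra_simps)
              with that show ?thesis unfolding closed_segment_def by fastforce
            qed
            show "(k has_derivative k' x) (at x within ?S)" for x by (rule has_derivative_at_withinI[OF D(1)])
            show "onorm (k' x - k' (w - y)) \<le> e' * DIM('a)" if x: "x \<in> ?S" for x
            proof (rule onorm_bound)
              have "dist x (w - y) \<le> norm (w' - w)"
                using segment_bound1[of x "w - y" "w' - y"] x by (simp add: dist_norm)
              then have "dist x (w - y) < d" using w' by simp
              then show "norm ((k' x - k' (w - y)) v) \<le> e' * DIM('a) * norm v" for v using op by simp
            qed (use e' in simp)
          qed simp
          then show ?thesis by (simp add: mult_ac)
        qed
        show "\<exists>d>0. \<forall>w'. norm (w' - w) < d \<longrightarrow>
            norm ((\<integral>y. k (w' - y) \<partial>\<mu>) - (\<integral>y. k (w - y) \<partial>\<mu>) - F' w (w' - w)) \<le> e * norm (w' - w)"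
        proof (intro exI[of _ d] conjI allI impI d(1))
          fix w' assume w': "norm (w' - w) < d"
          note ik = int[OF kc bdd[OF kc Suc.prems(2)]]
          have "norm ((\<integral>y. k (w' - y) \<partial>\<mu>) - (\<integral>y. k (w - y) \<partial>\<mu>) - F' w (w' - w))
              = norm (\<integral>y. k (w' - y) - k (w - y) - k' (w - y) (w' - w) \<partial>\<mu>)"
            unfolding F'_def by (simp add: ik int')
          also have "\<dots> \<le> (\<integral>y. e' * DIM('a) * norm (w' - w) \<partial>\<mu>)"
          proof -
            have i: "integrable \<mu> (\<lambda>y. k (w' - y) - k (w - y) - k' (w - y) (w' - w))"
              by (intro Bochner_Integration.integrable_diff ik int')
            show ?thesis
              by (rule order_trans[OF integral_norm_bound integral_mono[OF integrable_norm[OF i]]])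
                (use lip[OF w'] in simp_all)
          qed
          also have "\<dots> = measure \<mu> (space \<mu>) * (e' * DIM('a)) * norm (w' - w)" by simp
          also have "\<dots> \<le> M * (e' * DIM('a)) * norm (w' - w)"
            using e' by (intro mult_right_mono) (auto simp: M_def)
          also have "M * (e' * DIM('a)) = e" using M by (simp add: e'_def)
          finally show "norm ((\<integral>y. k (w' - y) \<partial>\<mu>) - (\<integral>y. k (w - y) \<partial>\<mu>) - F' w (w' - w)) \<le> e * norm (w' - w)" .
        qed
      qed
    qed
  }
qed

section \<open>Frostman measures\<close>

text \<open>The Hausdorff premeasure without a restriction on the size of the covering sets. For
  \<open>s > 0\<close> it vanishes on the same sets as the Hausdorff measure, but it is finite on
  bounded sets and can serve as a weight for distributing mass.\<close>

definition hausdorff_content :: "real \<Rightarrow> 'a::metric_space set \<Rightarrow> ennreal" where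
  "hausdorff_content s A =
     Inf {\<Sum>i. ennreal (diameter (C i) powr s) |C :: nat \<Rightarrow> 'a set. A \<subseteq> (\<Union>i. C i) \<and> (\<forall>i. bounded (C i))}"

lemma hausdorff_content_le:
  assumes "A \<subseteq> (\<Union>i. C i)" "\<And>i. bounded (C i)"
  shows "hausdorff_content s A \<le> (\<Sum>i. ennreal (diameter (C i) powr s))"
  unfolding hausdorff_content_def using assms by (intro Inf_lower) blast

lemma hausdorff_content_less_cover:
  assumes "hausdorff_content s A < e"
  obtains C where "A \<subseteq> (\<Union>i. C i)" "\<And>i. bounded (C i)"
    "(\<Sum>i. ennreal (diameter (C i) powr s)) < e"
  using assms unfolding hausdorff_content_def Inf_less_iff by blast

lemma hausdorff_content_mono: "A \<subseteq> B \<Longrightarrow> hausdorff_content s A \<le> hausdorff_content s B"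
  unfolding hausdorff_content_def by (intro Inf_superset_mono) blast

lemma hausdorff_content_le_diameter:
  assumes "bounded A"
  shows "hausdorff_content s A \<le> ennreal (diameter A powr s)"
proof -
  let ?C = "\<lambda>i::nat. if i = 0 then A else {}"
  have "hausdorff_content s A \<le> (\<Sum>i. ennreal (diameter (?C i) powr s))"
    using assms by (intro hausdorff_content_le) (auto split: if_splits)
  also have "\<dots> = (\<Sum>i\<in>{0}. ennreal (diameter (?C i) powr s))"
    by (intro suminf_finite) auto
  finally show ?thesis by simp
qed

lemma hausdorff_content_empty [simp]: "hausdorff_content s {} = 0"
  using hausdorff_content_le_diameter[of "{}" s] by simp

lemma hausdorff_content_countable_subadditive:
  "hausdorff_content s (\<Union>n. A n) \<le> (\<Sum>n::nat. hausdorff_content s (A n))"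
proof (cases "(\<Sum>n. hausdorff_content s (A n)) = \<infinity>")
  case False
  show ?thesis
  proof (rule ennreal_le_epsilon)
    fix e :: real assume e: "0 < e"
    have fin: "hausdorff_content s (A n) < \<infinity>" for n
    proof -
      have "hausdorff_content s (A n) \<le> (\<Sum>n. hausdorff_content s (A n))"
        using sum_le_suminf[of "\<lambda>n. hausdorff_content s (A n)" "{n}"] by simp
      then show ?thesis using False by (simp add: less_top top.not_eq_extremum le_less_trans)
    qed
    have "\<exists>C. A n \<subseteq> (\<Union>i. C i) \<and> (\<forall>i. bounded (C i)) \<and>
        (\<Sum>i. ennreal (diameter (C i) powr s)) \<le> hausdorff_content s (A n) + ennreal (e * (1/2)^Suc n)" for n
    proof -
      have "hausdorff_content s (A n) < hausdorff_content s (A n) + ennreal (e * (1/2)^Suc n)"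
        using fin[of n] e
        by (cases "hausdorff_content s (A n)") (auto simp: ennreal_plus[symmetric] ennreal_less_iff simp del: ennreal_plus)
      then show ?thesis by (elim hausdorff_content_less_cover) (auto intro: less_imp_le)
    qed
    then obtain C where C: "\<And>n. A n \<subseteq> (\<Union>i. C n i)" "\<And>n i. bounded (C n i)"
      "\<And>n. (\<Sum>i. ennreal (diameter (C n i) powr s)) \<le> hausdorff_content s (A n) + ennreal (e * (1/2)^Suc n)"
      by metis
    let ?D = "\<lambda>k. case prod_decode k of (n, i) \<Rightarrow> C n i"
    have "hausdorff_content s (\<Union>n. A n) \<le> (\<Sum>k. ennreal (diameter (?D k) powr s))"
    proof (intro hausdorff_content_le)
      show "(\<Union>n. A n) \<subseteq> (\<Union>k. ?D k)"
      proof safe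
        fix n x assume "x \<in> A n"
        then obtain i where "x \<in> C n i" using C(1) by blast
        then have "x \<in> ?D (prod_encode (n, i))" by simp
        then show "x \<in> (\<Union>k. ?D k)" by (rule UN_I[OF UNIV_I])
      qed
      show "bounded (?D k)" for k using C(2) by (simp split: prod.split)
    qed
    also have "\<dots> = (\<Sum>k. (\<lambda>(n, i). ennreal (diameter (C n i) powr s)) (prod_decode k))"
      by (intro suminf_cong) (auto split: prod.split)
    also have "\<dots> = (\<Sum>n. \<Sum>i. ennreal (diameter (C n i) powr s))"
      by (rule suminf_ennreal_2dimen) auto
    also have "\<dots> \<le> (\<Sum>n. hausdorff_content s (A n) + ennreal (e * (1/2)^Suc n))"
      by (intro suminf_le C) auto
    also have "\<dots> = (\<Sum>n. hausdorff_content s (A n)) + (\<Sum>n. ennreal (e * (1/2)^Suc n))"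
      by (intro suminf_add[symmetric]) auto
    also have "(\<Sum>n. ennreal (e * (1/2)^Suc n)) = ennreal e"
    proof -
      have "(\<lambda>n. e * (1/2)^Suc n) sums (e * 1)"
        by (intro sums_mult power_half_series)
      then show ?thesis using e by (subst suminf_ennreal2) (auto simp: sums_iff)
    qed
    finally show "hausdorff_content s (\<Union>n. A n) \<le> (\<Sum>n. hausdorff_content s (A n)) + ennreal e" .
  qed
qed simp

lemma hausdorff_content_Un: "hausdorff_content s (A \<union> B) \<le> hausdorff_content s A + hausdorff_content s B"
proof -
  let ?A = "\<lambda>n::nat. if n = 0 then A else if n = 1 then B else {}"
  have "A \<union> B = (\<Union>n. ?A n)" by (auto split: if_splits)
  then have "hausdorff_content s (A \<union> B) \<le> (\<Sum>n. hausdorff_content s (?A n))"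
    using hausdorff_content_countable_subadditive[of s ?A] by simp
  also have "\<dots> = (\<Sum>n\<in>{0,1}. hausdorff_content s (?A n))"
    by (intro suminf_finite) auto
  finally show ?thesis by simp
qed

lemma hausdorff_content_UN_finite:
  "finite F \<Longrightarrow> hausdorff_content s (\<Union>c\<in>F. A c) \<le> (\<Sum>c\<in>F. hausdorff_content s (A c))"
proof (induction F rule: finite_induct)
  case (insert x F)
  have "hausdorff_content s (\<Union>c\<in>insert x F. A c) \<le> hausdorff_content s (A x) + hausdorff_content s (\<Union>c\<in>F. A c)"
    using hausdorff_content_Un by simp
  also have "\<dots> \<le> hausdorff_content s (A x) + (\<Sum>c\<in>F. hausdorff_content s (A c))"
    by (intro add_left_mono insert)
  finally show ?case using insert by simp
qed simp

text \<open>A cover whose sum is below \<open>\<delta> powr s\<close> automatically consists of sets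
  of diameter at most \<open>\<delta>\<close>. Hence zero content would make every premeasure
  zero.\<close>

lemma hausdorff_content_pos:
  assumes "0 < s" "hausdorff_measure s E \<noteq> 0"
  shows "0 < hausdorff_content s E"
proof (rule ccontr)
  assume "\<not> ?thesis"
  then have 0: "hausdorff_content s E = 0" by simp
  have "hausdorff_premeasure \<delta> s E = 0" if \<delta>: "\<delta> > 0" for \<delta>
  proof -
    have "hausdorff_premeasure \<delta> s E \<le> 0 + ennreal e" if e: "e > 0" for e
    proof -
      define e' where "e' = min e (\<delta> powr s)"
      have e': "e' > 0" "e' \<le> e" "e' \<le> \<delta> powr s" using e \<delta> by (auto simp: e'_def)
      then have "hausdorff_content s E < ennreal e'" by (simp add: 0)
      then obtain C where C: "E \<subseteq> (\<Union>i. C i)" "\<And>i. bounded (C i)"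
        "(\<Sum>i. ennreal (diameter (C i) powr s)) < ennreal e'"
        by (elim hausdorff_content_less_cover) auto
      have "diameter (C i) \<le> \<delta>" for i
      proof -
        have "ennreal (diameter (C i) powr s) < ennreal e'" using C(3) by (rule ennreal_suminf_lessD)
        then have "diameter (C i) powr s < \<delta> powr s" using e' by (simp add: ennreal_less_iff)
        then show ?thesis
          using powr_mono2[of s \<delta> "diameter (C i)"] \<open>0 < s\<close> \<delta> by linarith
      qed
      then have "hausdorff_premeasure \<delta> s E \<le> (\<Sum>i. ennreal (diameter (C i) powr s))"
        unfolding hausdorff_premeasure_def using C by (intro Inf_lower) blast
      also have "\<dots> \<le> ennreal e'" using C(3) by (rule less_imp_le)
      also have "\<dots> \<le> 0 + ennreal e" using e'(2) by (simp add: ennreal_leI)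
      finally show ?thesis .
    qed
    then have "hausdorff_premeasure \<delta> s E \<le> 0" by (rule ennreal_le_epsilon)
    then show ?thesis by (simp only: le_zero_eq)
  qed
  then have "hausdorff_measure s E = 0"
    unfolding hausdorff_measure_def by (intro antisym SUP_least) auto
  with assms show False by simp
qed

text \<open>Names the half-open dyadic cube of side \<open>1 / 2 ^ n\<close> that contains
  \<open>x\<close>. The value 0 off \<open>Basis\<close> makes equality of functions the same as
  equality of cubes.\<close>

definition dyadic_code :: "nat \<Rightarrow> 'a::euclidean_space \<Rightarrow> 'a \<Rightarrow> int" where
  "dyadic_code n x = (\<lambda>b. if b \<in> Basis then \<lfloor>2 ^ n * (x \<bullet> b)\<rfloor> else 0)"

text \<open>Dyadic cubes are nested because \<open>\<lfloor>t\<rfloor>\<close> is determined by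
  \<open>\<lfloor>2 * t\<rfloor>\<close>, through integer division by 2.\<close>

lemma dyadic_code_eqD:
  assumes "dyadic_code (Suc n) x = dyadic_code (Suc n) y"
  shows "dyadic_code n x = dyadic_code n y"
proof
  fix b :: 'a
  have *: "\<lfloor>t\<rfloor> = \<lfloor>u\<rfloor>" if "\<lfloor>2 * t\<rfloor> = \<lfloor>2 * u\<rfloor>" for t u :: real
  proof -
    have half: "\<lfloor>t\<rfloor> = \<lfloor>2 * t\<rfloor> div 2" for t :: real
      using floor_divide_real_eq_div[of 2 "2 * t"] by simp
    show ?thesis by (simp only: half[of t] half[of u] that)
  qed
  show "dyadic_code n x b = dyadic_code n y b"
    using fun_cong[OF assms, of b] *[of "2 ^ n * (x \<bullet> b)" "2 ^ n * (y \<bullet> b)"]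
    by (cases "b \<in> Basis") (simp_all add: dyadic_code_def mult.assoc)
qed

lemma dist_le_of_dyadic_code_eq:
  fixes x y :: "'a::euclidean_space"
  assumes "dyadic_code n x = dyadic_code n y"
  shows "dist x y \<le> real DIM('a) / 2 ^ n"
proof -
  have "\<bar>(x - y) \<bullet> b\<bar> \<le> 1 / 2 ^ n" if "b \<in> Basis" for b
  proof -
    have "\<lfloor>2 ^ n * (x \<bullet> b)\<rfloor> = \<lfloor>2 ^ n * (y \<bullet> b)\<rfloor>"
      using fun_cong[OF assms, of b] that by (simp add: dyadic_code_def)
    then have "\<bar>2 ^ n * (x \<bullet> b) - 2 ^ n * (y \<bullet> b)\<bar> \<le> 1" by linarith
    then have "2 ^ n * \<bar>(x - y) \<bullet> b\<bar> \<le> 1"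
      by (simp add: inner_diff_left abs_mult flip: right_diff_distrib)
    then show ?thesis by (simp add: field_simps)
  qed
  then have "(\<Sum>b\<in>Basis. \<bar>(x - y) \<bullet> b\<bar>) \<le> (\<Sum>b\<in>(Basis::'a set). 1 / 2 ^ n)"
    by (rule sum_mono)
  then show ?thesis unfolding dist_norm using norm_le_l1[of "x - y"] by simp
qed

text \<open>The count depends neither on \<open>n\<close> nor on \<open>x\<close>, which is what
  turns a mass bound for cubes into one for balls. In each coordinate the integer part moves by at
  most \<open>R + 1\<close>, leaving \<open>2 * R + 3\<close> values.\<close>

lemma dyadic_code_ball_cover:
  fixes x :: "'a::euclidean_space" and R :: nat
  obtains S where "finite S" "card S \<le> (2 * R + 3) ^ DIM('a)"
    "dyadic_code n ` ball x (real R / 2 ^ n) \<subseteq> S"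
proof
  define S where "S = {f. \<forall>b. (b \<in> Basis \<longrightarrow> f b \<in> {dyadic_code n x b - int R - 1 .. dyadic_code n x b + int R + 1})
        \<and> (b \<notin> Basis \<longrightarrow> f b = (0::int))}"
  define T where "T = PiE Basis (\<lambda>b. {dyadic_code n x b - int R - 1 .. dyadic_code n x b + int R + 1})"
  have sub: "S \<subseteq> (\<lambda>f b. if b \<in> Basis then f b else 0) ` T"
  proof
    fix f assume f: "f \<in> S"
    then have "f = (\<lambda>b. if b \<in> Basis then (restrict f Basis) b else 0)"
      by (auto simp: S_def)
    moreover have "restrict f Basis \<in> T" using f by (auto simp: S_def T_def)
    ultimately show "f \<in> (\<lambda>f b. if b \<in> Basis then f b else 0) ` T" by (rule image_eqI)
  qed
  have T: "finite T" "card T = (2 * R + 3) ^ DIM('a)"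
  proof -
    show "finite T" unfolding T_def by (intro finite_PiE) auto
    have "card T = (\<Prod>b\<in>(Basis::'a set). nat (3 + 2 * int R))"
    proof -
      have "card {a - int R - 1..a + int R + 1} = nat (3 + 2 * int R)" for a by simp
      then show ?thesis unfolding T_def by (subst card_PiE) (simp_all only: finite_Basis)
    qed
    also have "\<dots> = nat (3 + 2 * int R) ^ DIM('a)" by (rule prod_constant)
    also have "nat (3 + 2 * int R) = 2 * R + 3" by simp
    finally show "card T = (2 * R + 3) ^ DIM('a)" .
  qed
  show "finite S" using sub T by (meson finite_imageI finite_subset)
  show "card S \<le> (2 * R + 3) ^ DIM('a)"
    using order_trans[OF card_mono[OF finite_imageI[OF T(1)] sub] card_image_le[OF T(1)]] T(2) by simp
  show "dyadic_code n ` ball x (real R / 2 ^ n) \<subseteq> S"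
  proof safe
    fix y assume y: "y \<in> ball x (real R / 2 ^ n)"
    have "\<lfloor>2 ^ n * (y \<bullet> b)\<rfloor> \<in> {\<lfloor>2 ^ n * (x \<bullet> b)\<rfloor> - int R - 1..\<lfloor>2 ^ n * (x \<bullet> b)\<rfloor> + int R + 1}" if "b \<in> Basis" for b
    proof -
      have "\<bar>(x - y) \<bullet> b\<bar> \<le> real R / 2 ^ n"
        using y Basis_le_norm[OF that, of "x - y"] by (simp add: dist_norm)
      then have "2 ^ n * \<bar>(x - y) \<bullet> b\<bar> \<le> real R" by (simp add: field_simps)
      then have "\<bar>2 ^ n * (x \<bullet> b) - 2 ^ n * (y \<bullet> b)\<bar> \<le> real R"
        by (simp add: inner_diff_left abs_mult flip: right_diff_distrib)
      then show ?thesis unfolding atLeastAtMost_iff by linarith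
    qed
    then show "dyadic_code n y \<in> S" by (auto simp: S_def dyadic_code_def)
  qed
qed

lemma finite_dyadic_code_image:
  fixes E :: "'a::euclidean_space set"
  assumes "bounded E" shows "finite (dyadic_code n ` E)"
proof -
  obtain r where r: "E \<subseteq> ball 0 r" "r > 0" using assms bounded_subset_ballD by blast
  obtain R :: nat where "2 ^ n * r \<le> real R" using real_arch_simple by blast
  then have "ball 0 r \<subseteq> ball (0::'a) (real R / 2 ^ n)" by (intro subset_ball) (simp add: field_simps)
  with r obtain S where "finite S" "dyadic_code n ` E \<subseteq> S"
    using dyadic_code_ball_cover[where x = "0::'a" and R = R and n = n] by (metis image_mono order_trans)
  then show ?thesis by (rule finite_subset[rotated])
qed

text \<open>The Ionescu-Tulcea theorem with the discrete sigma-algebra on the state space, so that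
  every transition kernel is measurable. Only the initial law and the laws of consecutive pairs are
  exported, since the mass estimates proceed one step at a time.\<close>

lemma markov_chain_exists:
  fixes p :: "'a pmf" and K :: "nat \<Rightarrow> 'a \<Rightarrow> 'a pmf"
  obtains M :: "(nat \<Rightarrow> 'a) measure" where "prob_space M"
    "sets M = sets (PiM UNIV (\<lambda>_. count_space UNIV))"
    "\<forall>A. emeasure M {\<omega>. \<omega> 0 \<in> A} = emeasure (measure_pmf p) A"
    "\<forall>n A B. emeasure M {\<omega>. \<omega> n \<in> A \<and> \<omega> (Suc n) \<in> B} =
       (\<integral>\<^sup>+\<omega>. indicator A (\<omega> n) * emeasure (measure_pmf (K n (\<omega> n))) B \<partial>M)"
proof -
  let ?M = "\<lambda>_::nat. count_space (UNIV :: 'a set)"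
  \<comment> \<open>Coordinate 0 carries the initial law, so the kernel for coordinate
    \<open>Suc m\<close> reads only the state at time \<open>m\<close> out of the history.\<close>
  define P where "P = (\<lambda>i (\<omega>::nat \<Rightarrow> 'a). case i of 0 \<Rightarrow> measure_pmf p | Suc m \<Rightarrow> measure_pmf (K m (\<omega> m)))"
  have P_meas: "P i \<in> measurable (PiM {0..<i} ?M) (subprob_algebra (count_space UNIV))" for i
  proof (cases i)
    case 0
    then show ?thesis by (simp add: P_def measure_pmf_in_subprob_algebra)
  next
    case (Suc m)
    have 1: "(\<lambda>\<omega>. \<omega> m) \<in> measurable (PiM {0..<i} ?M) (count_space UNIV)"
      using Suc measurable_component_singleton[of m "{0..<i}" ?M] by simp
    have 2: "(\<lambda>x. measure_pmf (K m x)) \<in> measurable (count_space UNIV) (subprob_algebra (count_space UNIV))"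
      by (simp add: measure_pmf_in_subprob_algebra)
    show ?thesis using measurable_compose[OF 1 2] by (simp add: P_def Suc)
  qed
  have ps: "prob_space (P i x)" for i x
    by (cases i) (auto simp: P_def measure_pmf.prob_space_axioms)
  interpret IT: Ionescu_Tulcea P ?M
    by (rule Ionescu_Tulcea.intro[OF P_meas ps])
  define M where "M = IT.PF.lim"
  define L where "L = (\<lambda>n. IT.C 0 n (\<lambda>_. undefined))"
  have u: "(\<lambda>_. undefined) \<in> space (PiM {0..<0} ?M)" by (simp add: space_PiM)
  have sets_L: "sets (L n) = sets (PiM {0..<n} ?M)" for n
    unfolding L_def using IT.sets_C[OF u, of n] by simp
  have space_L: "space (L n) = space (PiM {0..<n} ?M)" for n
    by (rule sets_eq_imp_space_eq[OF sets_L])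
  have sets_M: "sets M = sets (PiM UNIV ?M)"
    unfolding M_def by simp
  have CI: "IT.CI {0..<n} = L n" for n
  proof (rule measure_eqI)
    show "sets (IT.CI {0..<n}) = sets (L n)" by (simp add: IT.CI_def sets_L)
    fix X assume "X \<in> sets (IT.CI {0..<n})"
    then have X: "X \<in> sets (PiM {0..<n} ?M)" by (simp add: IT.CI_def)
    show "emeasure (IT.CI {0..<n}) X = emeasure (L n) X"
      using IT.emeasure_CI[OF order_refl X] prod_emb_id[OF sets.sets_into_space[OF X, unfolded space_PiM]]
      by (simp add: L_def)
  qed
  \<comment> \<open>Integrals of functions of the first \<open>n\<close> coordinates reduce to the
    finite-dimensional law \<open>L n\<close>; the condition on \<open>restrict\<close> expresses
    this dependence.\<close>
  have fin: "(\<integral>\<^sup>+\<omega>. f \<omega> \<partial>M) = (\<integral>\<^sup>+\<omega>. f \<omega> \<partial>L n)"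
    if f: "f \<in> borel_measurable (PiM {0..<n} ?M)" and fr: "\<And>\<omega>. f (restrict \<omega> {0..<n}) = f \<omega>"
    for n and f :: "_ \<Rightarrow> ennreal"
  proof -
    have r: "(\<lambda>x. restrict x {0..<n}) \<in> measurable M (PiM {0..<n} ?M)"
      unfolding measurable_cong_sets[OF sets_M refl] by (rule measurable_restrict_subset) simp
    have "(\<integral>\<^sup>+\<omega>. f \<omega> \<partial>L n) = (\<integral>\<^sup>+\<omega>. f \<omega> \<partial>distr M (PiM {0..<n} ?M) (\<lambda>x. restrict x {0..<n}))"
      using IT.distr_lim[of "{0..<n}"] by (simp add: CI M_def)
    also have "\<dots> = (\<integral>\<^sup>+\<omega>. f (restrict \<omega> {0..<n}) \<partial>M)"
      using r f by (intro nn_integral_distr) simp_all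
    finally show ?thesis by (simp only: fr)
  qed
  have step: "(\<integral>\<^sup>+\<omega>. f \<omega> \<partial>L (Suc n)) = (\<integral>\<^sup>+\<omega>. (\<integral>\<^sup>+x. f (fun_upd \<omega> n x) \<partial>P n \<omega>) \<partial>L n)"
    if f: "f \<in> borel_measurable (PiM {0..<Suc n} ?M)" for n f
  proof -
    have "(\<integral>\<^sup>+\<omega>. f \<omega> \<partial>L (Suc n)) = (\<integral>\<^sup>+\<omega>. (\<integral>\<^sup>+x. f x \<partial>IT.eP n \<omega>) \<partial>L n)"
      unfolding L_def IT.C.simps add_0
      by (rule nn_integral_bind[OF f])
         (subst measurable_cong_sets[OF sets_L[unfolded L_def] refl], rule IT.measurable_eP)
    also have "\<dots> = (\<integral>\<^sup>+\<omega>. (\<integral>\<^sup>+x. f (fun_upd \<omega> n x) \<partial>P n \<omega>) \<partial>L n)"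
      by (intro nn_integral_cong IT.nn_integral_eP f) (simp add: space_L)
    finally show ?thesis .
  qed
  have comp: "(\<lambda>\<omega>. g (\<omega> m)) \<in> borel_measurable (PiM {0..<n} ?M)" if "m < n" for m n and g :: "'a \<Rightarrow> ennreal"
    by (rule measurable_compose[OF measurable_component_singleton]) (use that in auto)
  have compM: "(\<lambda>\<omega>. \<omega> m) \<in> measurable M (count_space UNIV)" for m
    unfolding measurable_cong_sets[OF sets_M refl] by (rule measurable_component_singleton) simp
  show thesis
  proof
    show "prob_space M"
    proof
      have "emeasure M (space M) = (\<integral>\<^sup>+\<omega>. 1 \<partial>M)" by simp
      also have "\<dots> = (\<integral>\<^sup>+\<omega>. 1 \<partial>L 0)" by (rule fin) auto
      also have "\<dots> = 1"
        using prob_space.emeasure_space_1[OF IT.prob_space_C[OF u, of 0]] by (simp add: L_def)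
      finally show "emeasure M (space M) = 1" .
    qed
    show "sets M = sets (PiM UNIV ?M)" by (rule sets_M)
    have space_M: "space M = UNIV" using sets_eq_imp_space_eq[OF sets_M] by (simp add: space_PiM)
    have setM: "{\<omega>. \<omega> m \<in> A} \<in> sets M" for m A
      using measurable_sets[OF compM, of A m] by (simp add: vimage_def space_M)
    show "\<forall>A. emeasure M {\<omega>. \<omega> 0 \<in> A} = emeasure (measure_pmf p) A"
    proof
      fix A
      have "emeasure M {\<omega>. \<omega> 0 \<in> A} = (\<integral>\<^sup>+\<omega>. indicator A (\<omega> 0) \<partial>M)"
        using setM[of 0 A] by (simp flip: nn_integral_indicator add: indicator_def)
      also have "\<dots> = (\<integral>\<^sup>+\<omega>. indicator A (\<omega> 0) \<partial>L (Suc 0))"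
        by (rule fin[OF comp]) auto
      also have "\<dots> = (\<integral>\<^sup>+\<omega>. (\<integral>\<^sup>+x. indicator A x \<partial>measure_pmf p) \<partial>L 0)"
        by (subst step[OF comp]) (auto simp: P_def)
      also have "\<dots> = emeasure (measure_pmf p) A"
        using prob_space.emeasure_space_1[OF IT.prob_space_C[OF u, of 0]] by (simp add: L_def)
      finally show "emeasure M {\<omega>. \<omega> 0 \<in> A} = emeasure (measure_pmf p) A" .
    qed
    show "\<forall>n A B. emeasure M {\<omega>. \<omega> n \<in> A \<and> \<omega> (Suc n) \<in> B} =
       (\<integral>\<^sup>+\<omega>. indicator A (\<omega> n) * emeasure (measure_pmf (K n (\<omega> n))) B \<partial>M)"
    proof (intro allI)
      fix n A B
      have m1: "(\<lambda>\<omega>. indicator A (\<omega> n) * indicator B (\<omega> (Suc n)) :: ennreal) \<in> borel_measurable (PiM {0..<Suc (Suc n)} ?M)"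
        by (intro borel_measurable_times_ennreal comp) auto
      have m2: "(\<lambda>\<omega>. indicator A (\<omega> n) * emeasure (measure_pmf (K n (\<omega> n))) B) \<in> borel_measurable (PiM {0..<Suc n} ?M)"
        using comp[of n "Suc n" "\<lambda>x. indicator A x * emeasure (measure_pmf (K n x)) B"] by simp
      have "{\<omega>. \<omega> n \<in> A \<and> \<omega> (Suc n) \<in> B} = {\<omega>. \<omega> n \<in> A} \<inter> {\<omega>. \<omega> (Suc n) \<in> B}" by auto
      then have "{\<omega>. \<omega> n \<in> A \<and> \<omega> (Suc n) \<in> B} \<in> sets M" using setM by auto
      then have "emeasure M {\<omega>. \<omega> n \<in> A \<and> \<omega> (Suc n) \<in> B}
          = (\<integral>\<^sup>+\<omega>. indicator {\<omega>. \<omega> n \<in> A \<and> \<omega> (Suc n) \<in> B} \<omega> \<partial>M)"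
        by (rule nn_integral_indicator[symmetric])
      also have "\<dots> = (\<integral>\<^sup>+\<omega>. indicator A (\<omega> n) * indicator B (\<omega> (Suc n)) \<partial>M)"
        by (intro nn_integral_cong) (auto split: split_indicator)
      also have "\<dots> = (\<integral>\<^sup>+\<omega>. indicator A (\<omega> n) * indicator B (\<omega> (Suc n)) \<partial>L (Suc (Suc n)))"
        by (rule fin[OF m1]) auto
      also have "\<dots> = (\<integral>\<^sup>+\<omega>. (\<integral>\<^sup>+x. indicator A (\<omega> n) * indicator B x \<partial>measure_pmf (K n (\<omega> n))) \<partial>L (Suc n))"
        by (subst step[OF m1]) (simp add: P_def)
      also have "\<dots> = (\<integral>\<^sup>+\<omega>. indicator A (\<omega> n) * emeasure (measure_pmf (K n (\<omega> n))) B \<partial>L (Suc n))"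
        by (intro nn_integral_cong) (simp add: nn_integral_cmult)
      also have "\<dots> = (\<integral>\<^sup>+\<omega>. indicator A (\<omega> n) * emeasure (measure_pmf (K n (\<omega> n))) B \<partial>M)"
        by (rule fin[OF m2, symmetric]) auto
      finally show "emeasure M {\<omega>. \<omega> n \<in> A \<and> \<omega> (Suc n) \<in> B} =
       (\<integral>\<^sup>+\<omega>. indicator A (\<omega> n) * emeasure (measure_pmf (K n (\<omega> n))) B \<partial>M)" .
    qed
  qed
qed

text \<open>Only the masses of the fibres matter, so one representative of each fibre, chosen by
  \<open>inv_into\<close>, is enough to carry them.\<close>

lemma pmf_with_fibre_weights:
  fixes f :: "'a \<Rightarrow> 'b" and w :: "'b \<Rightarrow> real"
  assumes fin: "finite (f ` A)" and w: "\<And>c. w c \<ge> 0" and S: "sum w (f ` A) > 0"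
  obtains q where "set_pmf q \<subseteq> A"
    "\<And>c. emeasure (measure_pmf q) {y. f y = c} \<le> ennreal (w c / sum w (f ` A))"
proof -
  let ?S = "sum w (f ` A)"
  let ?u = "\<lambda>c. if c \<in> f ` A then w c / ?S else 0"
  have nn: "\<And>c. 0 \<le> ?u c" using w S by simp
  have "(\<integral>\<^sup>+c. ennreal (?u c) \<partial>count_space UNIV) = (\<Sum>c\<in>f ` A. ennreal (?u c))"
    using fin by (intro nn_integral_count_space'[where A = "f ` A"]) auto
  also have "\<dots> = ennreal (\<Sum>c\<in>f ` A. w c / ?S)"
    using w S by (subst sum_ennreal[symmetric]) auto
  also have "(\<Sum>c\<in>f ` A. w c / ?S) = 1"
    using S by (simp flip: sum_divide_distrib)
  finally have one: "(\<integral>\<^sup>+c. ennreal (?u c) \<partial>count_space UNIV) = 1" by simp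
  define q0 where "q0 = embed_pmf ?u"
  have pmf_q0: "pmf q0 c = ?u c" for c unfolding q0_def by (rule pmf_embed_pmf[OF nn one])
  have set_q0: "set_pmf q0 \<subseteq> f ` A" by (auto simp: set_pmf_eq pmf_q0 split: if_splits)
  define g where "g = inv_into A f"
  have g: "g c \<in> A" "f (g c) = c" if "c \<in> f ` A" for c
    using that by (auto simp: g_def inv_into_into f_inv_into_f)
  show thesis
  proof
    show "set_pmf (map_pmf g q0) \<subseteq> A" using set_q0 g by auto
    fix c
    have "emeasure (measure_pmf (map_pmf g q0)) {y. f y = c} = emeasure (measure_pmf q0) {b. f (g b) = c}"
      by (simp add: vimage_def)
    also have "\<dots> \<le> emeasure (measure_pmf q0) {c}"
    proof (rule emeasure_mono_AE)
      show "AE b in measure_pmf q0. b \<in> {b. f (g b) = c} \<longrightarrow> b \<in> {c}"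
        using set_q0 g(2) by (auto simp: AE_measure_pmf_iff)
    qed simp
    also have "\<dots> = ennreal (?u c)" by (simp add: emeasure_pmf_single pmf_q0)
    also have "\<dots> \<le> ennreal (w c / ?S)" using w S by (intro ennreal_leI) auto
    finally show "emeasure (measure_pmf (map_pmf g q0)) {y. f y = c} \<le> ennreal (w c / ?S)" .
  qed
qed

text \<open>The mass of a dyadic cube is distributed among its children in proportion to the Hausdorff
  content of their traces on \<open>E\<close>. Subadditivity of the content then bounds the mass of each cube by
  the content of its trace. The measure is the law of the limit of the corresponding Markov chain.\<close>

theorem frostman:
  fixes E :: "'a::euclidean_space set"
  assumes E: "compact E" and s: "0 < s" and H: "hausdorff_measure s E \<noteq> 0"
  obtains \<mu> C where "prob_space \<mu>" "sets \<mu> = sets borel" "emeasure \<mu> (- E) = 0" "C > 0"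
    "\<And>x r. 0 < r \<Longrightarrow> measure \<mu> (ball x r) \<le> C * r powr s"
proof -
  have bE: "bounded E" using E by (rule compact_imp_bounded)
  have finE: "finite (dyadic_code n ` B)" if "B \<subseteq> E" for n B
    by (rule finite_dyadic_code_image[OF bounded_subset[OF bE that]])
  define Q where "Q = (\<lambda>n c. {x\<in>E. dyadic_code n x = c})"
  have QE: "Q n c \<subseteq> E" for n c by (auto simp: Q_def)
  define h where "h = (\<lambda>n c. enn2real (hausdorff_content s (Q n c)))"
  have h_nn: "h n c \<ge> 0" for n c by (simp add: h_def)
  have fin_content: "hausdorff_content s B < \<infinity>" if "B \<subseteq> E" for B
    using hausdorff_content_le_diameter[OF bounded_subset[OF bE that]] by (rule le_less_trans) simp
  have ennreal_h: "ennreal (h n c) = hausdorff_content s (Q n c)" for n c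
    unfolding h_def using fin_content[OF QE, of n c] by (intro ennreal_enn2real) simp
  have diam: "diameter (Q n c) \<le> DIM('a) / 2 ^ n" for n c
  proof (rule diameter_le)
    fix x y assume "x \<in> Q n c" "y \<in> Q n c"
    then show "norm (x - y) \<le> real DIM('a) / 2 ^ n"
      using dist_le_of_dyadic_code_eq[of n x y] by (simp add: Q_def dist_norm)
  qed simp
  have h_le: "h n c \<le> (DIM('a) / 2 ^ n) powr s" for n c
  proof -
    have "ennreal (h n c) \<le> ennreal (diameter (Q n c) powr s)"
      unfolding ennreal_h by (rule hausdorff_content_le_diameter[OF bounded_subset[OF bE QE]])
    also have "\<dots> \<le> ennreal ((DIM('a) / 2 ^ n) powr s)"
      using s diam diameter_ge_0[OF bounded_subset[OF bE QE]] by (intro ennreal_leI powr_mono2) auto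
    finally show ?thesis by (simp add: ennreal_le_iff)
  qed
  have content_le_sum: "hausdorff_content s B \<le> ennreal (\<Sum>c\<in>dyadic_code n ` B. h n c)" if B: "B \<subseteq> E" for n B
  proof -
    have "hausdorff_content s B \<le> hausdorff_content s (\<Union>c\<in>dyadic_code n ` B. Q n c)"
      using B by (intro hausdorff_content_mono) (auto simp: Q_def)
    also have "\<dots> \<le> (\<Sum>c\<in>dyadic_code n ` B. hausdorff_content s (Q n c))"
      by (rule hausdorff_content_UN_finite[OF finE[OF B]])
    also have "\<dots> = ennreal (\<Sum>c\<in>dyadic_code n ` B. h n c)"
      by (simp add: ennreal_h[symmetric] h_nn del: ennreal_h)
    finally show ?thesis .
  qed
  \<comment> \<open>The total content of the children. It may exceed the content of the parent, and
    the transition probabilities are normalised by it; the inequality \<open>h_le_S\<close> is the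
    direction that the mass bound needs.\<close>
  define S where "S = (\<lambda>n c. \<Sum>c'\<in>dyadic_code (Suc n) ` Q n c. h (Suc n) c')"
  have S_nn: "S n c \<ge> 0" for n c unfolding S_def by (intro sum_nonneg h_nn)
  have h_le_S: "h n c \<le> S n c" for n c
    using content_le_sum[OF QE, of n c "Suc n"] S_nn[of n c] unfolding ennreal_h[symmetric] S_def
    by (simp add: ennreal_le_iff)
  define S0 where "S0 = (\<Sum>c\<in>dyadic_code 0 ` E. h 0 c)"
  have S0: "S0 > 0"
  proof -
    have "0 < ennreal S0"
      using hausdorff_content_pos[OF s H] content_le_sum[OF order_refl, of 0] unfolding S0_def
      by (rule less_le_trans)
    then show ?thesis by simp
  qed
  obtain p where p: "set_pmf p \<subseteq> E"
    "\<And>c. emeasure (measure_pmf p) {y. dyadic_code 0 y = c} \<le> ennreal (h 0 c / S0)"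
    using pmf_with_fibre_weights[where f = "dyadic_code 0" and A = E and w = "h 0"] finE[OF order_refl] h_nn S0
    unfolding S0_def by metis
  have Kex: "\<exists>q. set_pmf q \<subseteq> Q n (dyadic_code n e) \<and> (S n (dyadic_code n e) > 0 \<longrightarrow>
      (\<forall>c. emeasure (measure_pmf q) {y. dyadic_code (Suc n) y = c} \<le> ennreal (h (Suc n) c / S n (dyadic_code n e))))"
    if e: "e \<in> E" for n e
  proof (cases "S n (dyadic_code n e) > 0")
    case True
    then show ?thesis
      using pmf_with_fibre_weights[where f = "dyadic_code (Suc n)" and A = "Q n (dyadic_code n e)" and w = "h (Suc n)"]
        finE[OF QE] h_nn unfolding S_def by metis
  next
    case False
    \<comment> \<open>If all children have zero content, the chain stays where it is. Such a cube
      has zero content itself, so by \<open>bound\<close> below it is reached with probability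
      0.\<close>
    then show ?thesis using e by (intro exI[of _ "return_pmf e"]) (auto simp: Q_def)
  qed
  define K where "K = (\<lambda>n e. SOME q. set_pmf q \<subseteq> Q n (dyadic_code n e) \<and> (S n (dyadic_code n e) > 0 \<longrightarrow>
      (\<forall>c. emeasure (measure_pmf q) {y. dyadic_code (Suc n) y = c} \<le> ennreal (h (Suc n) c / S n (dyadic_code n e)))))"
  have K_spec: "set_pmf (K n e) \<subseteq> Q n (dyadic_code n e) \<and> (S n (dyadic_code n e) > 0 \<longrightarrow>
      (\<forall>c. emeasure (measure_pmf (K n e)) {y. dyadic_code (Suc n) y = c} \<le> ennreal (h (Suc n) c / S n (dyadic_code n e))))"
    if "e \<in> E" for n e
    unfolding K_def by (rule someI_ex[OF Kex[OF that]])
  have K: "set_pmf (K n e) \<subseteq> Q n (dyadic_code n e)"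
    "S n (dyadic_code n e) > 0 \<Longrightarrow>
      emeasure (measure_pmf (K n e)) {y. dyadic_code (Suc n) y = c} \<le> ennreal (h (Suc n) c / S n (dyadic_code n e))"
    if "e \<in> E" for n e c
    using K_spec[OF that, of n] by simp_all
  obtain M where M: "prob_space M"
    "sets M = sets (PiM UNIV (\<lambda>_. count_space UNIV))"
    and M3: "\<forall>A. emeasure M {\<omega>. \<omega> 0 \<in> A} = emeasure (measure_pmf p) A"
    and M4: "\<forall>n A B. emeasure M {\<omega>. \<omega> n \<in> A \<and> \<omega> (Suc n) \<in> B} =
       (\<integral>\<^sup>+\<omega>. indicator A (\<omega> n) * emeasure (measure_pmf (K n (\<omega> n))) B \<partial>M)"
    by (rule markov_chain_exists[of p K])
  interpret M: prob_space M by (rule M(1))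
  have space_M: "space M = UNIV" using sets_eq_imp_space_eq[OF M(2)] by (simp add: space_PiM)
  have comp: "(\<lambda>\<omega>. \<omega> m) \<in> measurable M (count_space UNIV)" for m
  proof -
    have "(\<lambda>\<omega>. \<omega> m) \<in> measurable (PiM UNIV (\<lambda>_. count_space (UNIV :: 'a set))) (count_space UNIV)"
      using measurable_component_singleton[of m UNIV "\<lambda>_. count_space (UNIV :: 'a set)"] by simp
    moreover have "measurable M (count_space (UNIV :: 'a set)) =
        measurable (PiM UNIV (\<lambda>_::nat. count_space (UNIV :: 'a set))) (count_space UNIV)"
      by (rule measurable_cong_sets[OF M(2) refl])
    ultimately show ?thesis by (simp only:)
  qed
  have setM: "{\<omega>. \<omega> m \<in> A} \<in> sets M" for m A
    using measurable_sets[OF comp, of A m] by (simp add: vimage_def space_M)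
  have step: "emeasure M {\<omega>. \<omega> (Suc n) \<in> B} = (\<integral>\<^sup>+\<omega>. emeasure (measure_pmf (K n (\<omega> n))) B \<partial>M)" for n B
    using M4[rule_format, of n UNIV B] by simp
  have K_null: "emeasure (measure_pmf (K n e)) B = 0" if "e \<in> E" "Q n (dyadic_code n e) \<inter> B = {}" for n e B
  proof -
    have "set_pmf (K n e) \<inter> B = {}" using K(1)[OF that(1), of n] that(2) by blast
    then show ?thesis by (simp add: measure_pmf.emeasure_eq_measure measure_pmf_zero_iff)
  qed
  have AE_E: "AE \<omega> in M. \<omega> n \<in> E" for n
  proof (induction n)
    case 0
    have "emeasure M {\<omega>. \<omega> 0 \<in> - E} = 0"
      using p(1) unfolding M3[rule_format] by (simp add: measure_pmf.emeasure_eq_measure measure_pmf_zero_iff) blast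
    then show ?case
      by (intro AE_I[of _ _ "{\<omega>. \<omega> 0 \<in> - E}"]) (use setM[of 0 "- E"] in auto)
  next
    case (Suc n)
    have "emeasure M {\<omega>. \<omega> (Suc n) \<in> - E} = (\<integral>\<^sup>+\<omega>. 0 \<partial>M)"
      unfolding step using Suc
      by (intro nn_integral_cong_AE) (elim AE_mp, intro AE_I2 impI K_null, use QE in auto)
    then show ?case
      by (intro AE_I[of _ _ "{\<omega>. \<omega> (Suc n) \<in> - E}"]) (use setM[of "Suc n" "- E"] in auto)
  qed
  have AE_code: "AE \<omega> in M. dyadic_code n (\<omega> (Suc n)) = dyadic_code n (\<omega> n)" for n
  proof -
    \<comment> \<open>The argument goes cube by cube because the pair law is known on product
      events; only finitely many cubes meet \<open>E\<close>, so the exceptional sets may be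
      united.\<close>
    have "AE \<omega> in M. \<not> (\<omega> n \<in> Q n c \<and> \<omega> (Suc n) \<in> - Q n c)" if "c \<in> dyadic_code n ` E" for c
    proof -
      have "emeasure M {\<omega>. \<omega> n \<in> Q n c \<and> \<omega> (Suc n) \<in> - Q n c} = (\<integral>\<^sup>+\<omega>. 0 \<partial>M)"
        unfolding M4[rule_format]
      proof (intro nn_integral_cong)
        fix \<omega>
        show "indicator (Q n c) (\<omega> n) * emeasure (measure_pmf (K n (\<omega> n))) (- Q n c) = 0"
          using K_null[of "\<omega> n" n "- Q n c"] by (auto simp: Q_def split: split_indicator)
      qed
      moreover have "{\<omega>. \<omega> n \<in> Q n c \<and> \<omega> (Suc n) \<in> - Q n c} \<in> sets M"
        using sets.Int[OF setM[of n "Q n c"] setM[of "Suc n" "- Q n c"]] by (simp add: Collect_conj_eq)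
      ultimately show ?thesis
        by (intro AE_I[of _ _ "{\<omega>. \<omega> n \<in> Q n c \<and> \<omega> (Suc n) \<in> - Q n c}"]) auto
    qed
    then have "AE \<omega> in M. \<forall>c\<in>dyadic_code n ` E. \<not> (\<omega> n \<in> Q n c \<and> \<omega> (Suc n) \<in> - Q n c)"
      by (subst AE_finite_all[OF finE[OF order_refl]]) blast
    then show ?thesis using AE_E[of n] by eventually_elim (auto simp: Q_def)
  qed
  have bound: "emeasure M {\<omega>. dyadic_code n (\<omega> n) = c} \<le> ennreal (h n c / S0)" for n c
  proof (induction n arbitrary: c)
    case 0
    show ?case using M3[rule_format, of "{y. dyadic_code 0 y = c}"] p(2) by simp
  next
    case (Suc n)
    let ?B = "{y. dyadic_code (Suc n) y = c}"
    have eq: "emeasure M {\<omega>. dyadic_code (Suc n) (\<omega> (Suc n)) = c} = (\<integral>\<^sup>+\<omega>. emeasure (measure_pmf (K n (\<omega> n))) ?B \<partial>M)"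
      using step[of n ?B] by simp
    show ?case
    proof (cases "\<exists>e0\<in>E. dyadic_code (Suc n) e0 = c")
      case False
      have "(\<integral>\<^sup>+\<omega>. emeasure (measure_pmf (K n (\<omega> n))) ?B \<partial>M) = (\<integral>\<^sup>+\<omega>. 0 \<partial>M)"
        using AE_E[of n] False
        by (intro nn_integral_cong_AE) (elim AE_mp, intro AE_I2 impI K_null, auto simp: Q_def)
      then show ?thesis unfolding eq by simp
    next
      case True
      then obtain e0 where e0: "e0 \<in> E" "dyadic_code (Suc n) e0 = c" by blast
      define b where "b = dyadic_code n e0"
      \<comment> \<open>The conditional probability of entering the child \<open>c\<close> from its
        parent \<open>b\<close>. The fallback value 1 uses only that probabilities are at most 1,
        and it costs nothing because \<open>S n b = 0\<close> forces
        \<open>h n b = 0\<close>.\<close>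
      define \<rho> where "\<rho> = (if S n b > 0 then h (Suc n) c / S n b else 1)"
      have \<rho>: "\<rho> \<ge> 0" using h_nn S_nn by (simp add: \<rho>_def)
      have "(\<integral>\<^sup>+\<omega>. emeasure (measure_pmf (K n (\<omega> n))) ?B \<partial>M)
          \<le> (\<integral>\<^sup>+\<omega>. ennreal \<rho> * indicator {\<omega>. dyadic_code n (\<omega> n) = b} \<omega> \<partial>M)"
      proof (rule nn_integral_mono_AE)
        have "emeasure (measure_pmf (K n (\<omega> n))) ?B \<le> ennreal \<rho> * indicator {\<omega>. dyadic_code n (\<omega> n) = b} \<omega>"
          if "\<omega> n \<in> E" for \<omega>
        proof (cases "dyadic_code n (\<omega> n) = b")
          case T: True
          show ?thesis
          proof (cases "S n b > 0")
            case True
            then show ?thesis using K(2)[OF that, of n c] T by (simp add: \<rho>_def)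
          next
            case False
            then show ?thesis using T by (simp add: \<rho>_def measure_pmf.emeasure_le_1)
          qed
        next
          case False
          have "Q n (dyadic_code n (\<omega> n)) \<inter> ?B = {}"
          proof -
            have False if "y \<in> Q n (dyadic_code n (\<omega> n))" "dyadic_code (Suc n) y = c" for y
            proof -
              have "dyadic_code n y = b"
                unfolding b_def by (rule dyadic_code_eqD) (simp only: that e0)
              with False that(1) show False by (simp add: Q_def)
            qed
            then show ?thesis by blast
          qed
          then show ?thesis using K_null[OF that] by simp
        qed
        then show "AE \<omega> in M. emeasure (measure_pmf (K n (\<omega> n))) ?B
            \<le> ennreal \<rho> * indicator {\<omega>. dyadic_code n (\<omega> n) = b} \<omega>"
          using AE_E[of n] by auto
      qed
      also have "\<dots> = ennreal \<rho> * emeasure M {\<omega>. dyadic_code n (\<omega> n) = b}"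
        using setM[of n "{y. dyadic_code n y = b}"] by (subst nn_integral_cmult) auto
      also have "\<dots> \<le> ennreal \<rho> * ennreal (h n b / S0)"
        by (intro mult_left_mono Suc) simp
      also have "\<dots> = ennreal (\<rho> * (h n b / S0))"
        by (rule ennreal_mult'[OF \<rho>, symmetric])
      also have "\<dots> \<le> ennreal (h (Suc n) c / S0)"
      proof (rule ennreal_leI)
        show "\<rho> * (h n b / S0) \<le> h (Suc n) c / S0"
        proof (cases "S n b > 0")
          case True
          have "h (Suc n) c * h n b \<le> h (Suc n) c * S n b" by (intro mult_left_mono h_le_S h_nn)
          then have "h (Suc n) c / S n b * h n b \<le> h (Suc n) c" using True by (simp add: field_simps)
          then show ?thesis using divide_right_mono[OF _ less_imp_le[OF S0]] True by (fastforce simp: \<rho>_def)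
        next
          case False
          then have "h n b = 0" using h_le_S[of n b] h_nn[of n b] by linarith
          then show ?thesis using S0 h_nn by simp
        qed
      qed
      finally show ?thesis unfolding eq .
    qed
  qed
  \<comment> \<open>No transition leaves the current cube, so from time \<open>n\<close> on all
    states share one cube of level \<open>n\<close>. Paths are therefore almost surely Cauchy, with
    limit within \<open>DIM('a) / 2 ^ n\<close> of \<open>\<omega> n\<close>.\<close>
  define X where "X = (\<lambda>\<omega> :: nat \<Rightarrow> 'a. lim (\<lambda>n. \<omega> n))"
  have comp_borel: "(\<lambda>\<omega>. \<omega> m) \<in> borel_measurable M" for m
    by (rule measurable_compose[OF comp, of "\<lambda>x. x"]) simp
  have X_meas: "X \<in> borel_measurable M"
    unfolding X_def by (rule borel_measurable_lim_metric[OF comp_borel])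
  have AE_X: "AE \<omega> in M. X \<omega> \<in> E \<and> (\<forall>n. dist (\<omega> n) (X \<omega>) \<le> DIM('a) / 2 ^ n)"
  proof -
    have "AE \<omega> in M. \<forall>n. \<omega> n \<in> E \<and> dyadic_code n (\<omega> (Suc n)) = dyadic_code n (\<omega> n)"
      using AE_E AE_code by (simp add: AE_all_countable)
    then show ?thesis
    proof eventually_elim
      fix \<omega> assume \<omega>: "\<forall>n. \<omega> n \<in> E \<and> dyadic_code n (\<omega> (Suc n)) = dyadic_code n (\<omega> n)"
      have lower: "dyadic_code n x = dyadic_code n y" if "dyadic_code (n + k) x = dyadic_code (n + k) y" for n k and x y :: 'a
        using that by (induction k) (auto dest: dyadic_code_eqD)
      have "dyadic_code n (\<omega> (n + k)) = dyadic_code n (\<omega> n)" for n k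
      proof (induction k)
        case (Suc k)
        then show ?case using lower[of n k "\<omega> (Suc (n + k))" "\<omega> (n + k)"] \<omega> by simp
      qed simp
      then have d: "dist (\<omega> n) (\<omega> (n + k)) \<le> DIM('a) / 2 ^ n" for n k
        by (intro dist_le_of_dyadic_code_eq) simp
      have "Cauchy \<omega>"
      proof (rule metric_CauchyI)
        fix e :: real assume e: "e > 0"
        have "(\<lambda>n. 2 * DIM('a) * (1/2::real) ^ n) \<longlonglongrightarrow> 0"
          by (intro tendsto_mult_right_zero LIMSEQ_realpow_zero) auto
        then have "\<forall>\<^sub>F n in sequentially. 2 * DIM('a) * (1/2::real) ^ n < e"
          using e by (simp add: order_tendsto_iff)
        then obtain N where N: "2 * DIM('a) * (1/2::real) ^ N < e"
          by (auto simp: eventually_sequentially)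
        show "\<exists>N. \<forall>m\<ge>N. \<forall>n\<ge>N. dist (\<omega> m) (\<omega> n) < e"
        proof (intro exI[of _ N] allI impI)
          fix m n assume "N \<le> m" "N \<le> n"
          then have "dist (\<omega> N) (\<omega> m) \<le> DIM('a) / 2 ^ N" "dist (\<omega> N) (\<omega> n) \<le> DIM('a) / 2 ^ N"
            using d[of N "m - N"] d[of N "n - N"] by simp_all
          then have "dist (\<omega> m) (\<omega> n) \<le> 2 * (DIM('a) / 2 ^ N)"
            using dist_triangle3[of "\<omega> m" "\<omega> n" "\<omega> N"] by linarith
          then show "dist (\<omega> m) (\<omega> n) < e" using N by (simp add: power_divide)
        qed
      qed
      then have lim: "\<omega> \<longlonglongrightarrow> X \<omega>"
        unfolding X_def using Cauchy_convergent convergent_LIMSEQ_iff by blast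
      have "X \<omega> \<in> E"
        using compact_imp_closed[OF E] lim \<omega> by (meson closed_sequentially)
      moreover have "dist (\<omega> n) (X \<omega>) \<le> DIM('a) / 2 ^ n" for n
      proof (rule Lim_bounded)
        show "(\<lambda>m. dist (\<omega> n) (\<omega> m)) \<longlonglongrightarrow> dist (\<omega> n) (X \<omega>)"
          by (intro tendsto_intros lim)
        show "\<forall>m\<ge>n. dist (\<omega> n) (\<omega> m) \<le> DIM('a) / 2 ^ n"
        proof (intro allI impI)
          fix m assume "n \<le> m"
          then show "dist (\<omega> n) (\<omega> m) \<le> DIM('a) / 2 ^ n" using d[of n "m - n"] by simp
        qed
      qed
      ultimately show "X \<omega> \<in> E \<and> (\<forall>n. dist (\<omega> n) (X \<omega>) \<le> DIM('a) / 2 ^ n)" by blast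
    qed
  qed
  define \<mu> where "\<mu> = distr M borel X"
  \<comment> \<open>The radius parameter \<open>DIM('a) + 1\<close> adds two displacements in units
    of \<open>1 / 2 ^ m\<close>: 1 for the ball itself and \<open>DIM('a)\<close> for the distance
    from the state at time \<open>m\<close> to the limit.\<close>
  define N where "N = (2 * (DIM('a) + 1) + 3) ^ DIM('a)"
  \<comment> \<open>The entry 1 settles radii at least 1, where total mass 1 suffices; the other
    entry multiplies the number of cubes by the bound for each of them.\<close>
  define C where "C = max 1 (real N * (2 * DIM('a)) powr s / S0)"
  interpret \<mu>: prob_space \<mu> unfolding \<mu>_def by (rule M.prob_space_distr[OF X_meas])
  show thesis
  proof
    show "prob_space \<mu>" by (rule \<mu>.prob_space_axioms)
    show "sets \<mu> = sets borel" by (simp add: \<mu>_def)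
    show "C > 0" by (simp add: C_def)
    have "- E \<in> sets borel" using compact_imp_closed[OF E] by auto
    then have "emeasure \<mu> (- E) = emeasure M (X -` (- E) \<inter> space M)"
      unfolding \<mu>_def using X_meas by (rule emeasure_distr[rotated])
    also have "X -` (- E) \<inter> space M = {\<omega> \<in> space M. X \<omega> \<notin> E}" by auto
    also have "emeasure M {\<omega> \<in> space M. X \<omega> \<notin> E} = 0"
    proof (rule emeasure_eq_0_AE)
      show "AE \<omega> in M. \<not> X \<omega> \<notin> E" using AE_X by eventually_elim simp
    qed
    finally show "emeasure \<mu> (- E) = 0" .
    fix x :: 'a and r :: real assume r: "0 < r"
    show "measure \<mu> (ball x r) \<le> C * r powr s"
    proof (cases "r \<ge> 1")
      case True
      have "1 \<le> C * r powr s" using True s by (intro mult_ge1_I) (auto simp: C_def ge_one_powr_ge_zero)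
      then show ?thesis using \<mu>.prob_le_1[of "ball x r"] by linarith
    next
      case False
      have ex: "\<exists>n. (1/2::real) ^ n \<le> r" using real_arch_pow_inv[OF r, of "1/2"] by (auto intro: less_imp_le)
      \<comment> \<open>The least such \<open>n\<close> has a predecessor \<open>m\<close> with
        \<open>r < 1 / 2 ^ m \<le> 2 * r\<close>, the dyadic scale matched to the ball.\<close>
      define n where "n = (LEAST n. (1/2::real) ^ n \<le> r)"
      have n: "(1/2::real) ^ n \<le> r" unfolding n_def using ex by (rule LeastI_ex)
      with False obtain m where m: "n = Suc m" by (cases n) auto
      have "\<not> (1/2::real) ^ m \<le> r" using not_less_Least[of m "\<lambda>n. (1/2::real) ^ n \<le> r"] m unfolding n_def by simp
      then have r1: "r < 1 / 2 ^ m" by (simp add: power_divide)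
      have r2: "1 / 2 ^ m \<le> 2 * r" using n m by (simp add: power_divide field_simps)
      obtain T where T: "finite T" "card T \<le> N"
        "dyadic_code m ` ball x (real (DIM('a) + 1) / 2 ^ m) \<subseteq> T"
        unfolding N_def by (rule dyadic_code_ball_cover)
      have "emeasure \<mu> (ball x r) = emeasure M (X -` ball x r \<inter> space M)"
        unfolding \<mu>_def by (rule emeasure_distr[OF X_meas]) simp
      also have "\<dots> \<le> emeasure M (\<Union>c\<in>T. {\<omega>. dyadic_code m (\<omega> m) = c})"
      proof (rule emeasure_mono_AE)
        show "AE \<omega> in M. \<omega> \<in> X -` ball x r \<inter> space M \<longrightarrow> \<omega> \<in> (\<Union>c\<in>T. {\<omega>. dyadic_code m (\<omega> m) = c})"
          using AE_X
        proof eventually_elim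
          fix \<omega> assume \<omega>: "X \<omega> \<in> E \<and> (\<forall>n. dist (\<omega> n) (X \<omega>) \<le> DIM('a) / 2 ^ n)"
          show "\<omega> \<in> X -` ball x r \<inter> space M \<longrightarrow> \<omega> \<in> (\<Union>c\<in>T. {\<omega>. dyadic_code m (\<omega> m) = c})"
          proof
            assume "\<omega> \<in> X -` ball x r \<inter> space M"
            then have "dist x (X \<omega>) < 1 / 2 ^ m" using r1 by simp
            moreover have "dist (\<omega> m) (X \<omega>) \<le> DIM('a) / 2 ^ m" using \<omega> by blast
            ultimately have "dist x (\<omega> m) < 1 / 2 ^ m + DIM('a) / 2 ^ m"
              using dist_triangle2[of x "\<omega> m" "X \<omega>"] by linarith
            then have "\<omega> m \<in> ball x (real (DIM('a) + 1) / 2 ^ m)"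
              by (simp add: add_divide_distrib)
            then show "\<omega> \<in> (\<Union>c\<in>T. {\<omega>. dyadic_code m (\<omega> m) = c})" using T(3) by auto
          qed
        qed
        show "(\<Union>c\<in>T. {\<omega>. dyadic_code m (\<omega> m) = c}) \<in> sets M"
        proof -
          have "(\<Union>c\<in>T. {\<omega>. dyadic_code m (\<omega> m) = c}) = {\<omega>. \<omega> m \<in> {y. dyadic_code m y \<in> T}}" by auto
          then show ?thesis by (simp only: setM)
        qed
      qed
      also have "\<dots> \<le> (\<Sum>c\<in>T. emeasure M {\<omega>. dyadic_code m (\<omega> m) = c})"
      proof (rule emeasure_subadditive_finite[OF T(1)])
        show "(\<lambda>c. {\<omega>. dyadic_code m (\<omega> m) = c}) ` T \<subseteq> sets M"
          using setM[of m "{y. dyadic_code m y = c}" for c] by auto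
      qed
      also have "\<dots> \<le> (\<Sum>c\<in>T. ennreal ((2 * DIM('a)) powr s * r powr s / S0))"
      proof (rule sum_mono)
        fix c
        have "h m c \<le> (DIM('a) / 2 ^ m) powr s" by (rule h_le)
        also have "\<dots> \<le> (DIM('a) * (2 * r)) powr s"
          using s r2 mult_left_mono[OF r2, of "real DIM('a)"] by (intro powr_mono2) auto
        also have "\<dots> = (2 * DIM('a)) powr s * r powr s"
          using r by (simp add: powr_mult[symmetric] mult_ac)
        finally have "h m c / S0 \<le> (2 * DIM('a)) powr s * r powr s / S0"
          using S0 by (simp add: divide_right_mono)
        then show "emeasure M {\<omega>. dyadic_code m (\<omega> m) = c} \<le> ennreal ((2 * DIM('a)) powr s * r powr s / S0)"
          using bound[of m c] ennreal_leI order_trans by blast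
      qed
      also have "\<dots> = ennreal (real (card T) * ((2 * DIM('a)) powr s * r powr s / S0))"
        unfolding sum_constant ennreal_of_nat_eq_real_of_nat by (rule ennreal_mult'[symmetric]) simp
      also have "\<dots> \<le> ennreal (C * r powr s)"
      proof (rule ennreal_leI)
        have "real (card T) * ((2 * DIM('a)) powr s * r powr s / S0) \<le> real N * ((2 * DIM('a)) powr s * r powr s / S0)"
          using T(2) S0 by (intro mult_right_mono) auto
        also have "\<dots> = (real N * (2 * DIM('a)) powr s / S0) * r powr s" by simp
        also have "\<dots> \<le> C * r powr s" by (intro mult_right_mono) (auto simp: C_def)
        finally show "real (card T) * ((2 * DIM('a)) powr s * r powr s / S0) \<le> C * r powr s" .
      qed
      finally show ?thesis
        by (simp add: \<mu>.emeasure_eq_measure C_def)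
    qed
  qed
qed

section \<open>Gaussians and energies\<close>

lemma borel_measurable_cis [measurable]: "cis \<in> borel_measurable borel"
  by (intro borel_measurable_continuous_onI continuous_intros)

lemma cis_sum: "cis (\<Sum>i\<in>I. f i) = (\<Prod>i\<in>I. cis (f i))"
  by (induction I rule: infinite_finite_induct) (simp_all add: cis_mult[symmetric])

text \<open>Rescaling by \<open>c = sqrt (2 * t)\<close> reduces both claims to the characteristic
  function of the standard normal distribution.\<close>

lemma
  fixes t z :: real
  assumes t: "t > 0"
  shows integrable_gaussian_real: "integrable lborel (\<lambda>x. cis (x * z) * of_real (exp (- t * x\<^sup>2)))"
    and integral_gaussian_real:
      "(\<integral>x. cis (x * z) * of_real (exp (- t * x\<^sup>2)) \<partial>lborel) = of_real (sqrt (pi / t) * exp (- (z\<^sup>2 / (4 * t))))"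
proof -
  define c where "c = sqrt (2 * t)"
  have c: "c > 0" "c\<^sup>2 = 2 * t" using t by (simp_all add: c_def)
  define g where "g = (\<lambda>y. cis ((z / c) * y) * of_real (std_normal_density y))"
  have 1: "integrable lborel g"
    unfolding g_def
    by (rule Bochner_Integration.integrable_bound[where f = "\<lambda>y. std_normal_density y"])
       (auto simp: norm_mult integrable_normal_density)
  have "(\<integral>y. g y \<partial>lborel) = (\<integral>y. std_normal_density y *\<^sub>R iexp ((z / c) * y) \<partial>lborel)"
    unfolding g_def by (intro Bochner_Integration.integral_cong) (auto simp: cis_conv_exp scaleR_conv_of_real mult_ac)
  also have "\<dots> = char std_normal_distribution (z / c)"
    unfolding char_def by (subst integral_density) auto
  also have "\<dots> = of_real (exp (- (z / c)\<^sup>2 / 2))"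
    unfolding char_std_normal_distribution ..
  finally have 2: "(\<integral>y. g y \<partial>lborel) = of_real (exp (- (z / c)\<^sup>2 / 2))" .
  have g: "g (0 + c * x) = (1 / sqrt (2 * pi)) *\<^sub>R (cis (x * z) * of_real (exp (- t * x\<^sup>2)))" for x
    using c by (simp add: g_def std_normal_density_def power_mult_distrib scaleR_conv_of_real mult_ac)
  have "integrable lborel (\<lambda>x. (1 / sqrt (2 * pi)) *\<^sub>R (cis (x * z) * of_real (exp (- t * x\<^sup>2))))"
    using lborel_integrable_real_affine[OF 1, of c 0] c unfolding g by simp
  from integrable_scaleR_right[OF this, of "sqrt (2 * pi)"]
  show "integrable lborel (\<lambda>x. cis (x * z) * of_real (exp (- t * x\<^sup>2)))"
    by simp
  have "of_real (exp (- (z / c)\<^sup>2 / 2)) = c *\<^sub>R (\<integral>x. (1 / sqrt (2 * pi)) *\<^sub>R (cis (x * z) * of_real (exp (- t * x\<^sup>2))) \<partial>lborel)"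
    using lborel_integral_real_affine[of c g 0] c unfolding 2 g by simp
  also have "\<dots> = (c / sqrt (2 * pi)) *\<^sub>R (\<integral>x. cis (x * z) * of_real (exp (- t * x\<^sup>2)) \<partial>lborel)"
    by (simp add: field_simps)
  finally have 3: "of_real (exp (- (z / c)\<^sup>2 / 2)) = (c / sqrt (2 * pi)) *\<^sub>R (\<integral>x. cis (x * z) * of_real (exp (- t * x\<^sup>2)) \<partial>lborel)" .
  have "(\<integral>x. cis (x * z) * of_real (exp (- t * x\<^sup>2)) \<partial>lborel) = (sqrt (2 * pi) / c) *\<^sub>R of_real (exp (- (z / c)\<^sup>2 / 2))"
    unfolding 3 using c by simp
  also have "sqrt (2 * pi) / c = sqrt (pi / t)"
    unfolding c_def by (simp add: real_sqrt_divide[symmetric])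
  also have "- (z / c)\<^sup>2 / 2 = - (z\<^sup>2 / (4 * t))"
    using c by (simp add: power_divide)
  finally show "(\<integral>x. cis (x * z) * of_real (exp (- t * x\<^sup>2)) \<partial>lborel) = of_real (sqrt (pi / t) * exp (- (z\<^sup>2 / (4 * t))))"
    by (simp add: scaleR_conv_of_real)
qed

text \<open>The integrand factors over the coordinates, and \<open>lborel\<close> is the image of a
  product of real Lebesgue measures.\<close>

lemma
  fixes z :: "'a::euclidean_space"
  assumes t: "t > 0"
  shows integrable_gaussian_cis: "integrable lborel (\<lambda>x. cis (x \<bullet> z) * of_real (exp (- t * (x \<bullet> x))))"
    and integral_gaussian_cis:
      "(\<integral>x. cis (x \<bullet> z) * of_real (exp (- t * (x \<bullet> x))) \<partial>lborel)
        = of_real (sqrt (pi / t) ^ DIM('a) * exp (- ((z \<bullet> z) / (4 * t))))"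
proof -
  interpret product_sigma_finite "\<lambda>_::'a. lborel :: real measure" ..
  let ?P = "PiM Basis (\<lambda>_::'a. lborel :: real measure)"
  let ?T = "\<lambda>f. \<Sum>b\<in>(Basis :: 'a set). f b *\<^sub>R b"
  define h where "h = (\<lambda>(b::'a) (x::real). cis (x * (z \<bullet> b)) * of_real (exp (- t * x\<^sup>2)))"
  have T: "?T \<in> measurable ?P borel" by measurable
  have inner: "?T f \<bullet> z = (\<Sum>b\<in>Basis. f b * (z \<bullet> b))" "?T f \<bullet> ?T f = (\<Sum>b\<in>Basis. (f b)\<^sup>2)" for f :: "'a \<Rightarrow> real"
    by (subst euclidean_inner, auto intro!: sum.cong simp: power2_eq_square)+
  have F: "cis (?T f \<bullet> z) * of_real (exp (- t * (?T f \<bullet> ?T f))) = (\<Prod>b\<in>Basis. h b (f b))" for f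
    unfolding inner h_def cis_sum prod.distrib
    by (simp add: sum_distrib_left exp_sum flip: sum_negf)
  have meas: "(\<lambda>x::'a. cis (x \<bullet> z) * complex_of_real (exp (- t * (x \<bullet> x)))) \<in> borel_measurable borel"
    by measurable
  have i: "integrable lborel (h b)" for b
    unfolding h_def by (rule integrable_gaussian_real[OF t])
  have "integrable ?P (\<lambda>f. \<Prod>b\<in>Basis. h b (f b))"
    by (rule product_integrable_prod[OF finite_Basis i])
  then show "integrable lborel (\<lambda>x. cis (x \<bullet> z) * of_real (exp (- t * (x \<bullet> x))))"
    unfolding lborel_eq[where 'a = 'a] F[symmetric] by (subst integrable_distr_eq[OF T meas])
  have "(\<integral>x. cis (x \<bullet> z) * of_real (exp (- t * (x \<bullet> x))) \<partial>lborel) = (\<integral>f. (\<Prod>b\<in>Basis. h b (f b)) \<partial>?P)"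
    unfolding lborel_eq[where 'a = 'a] F[symmetric] by (rule integral_distr[OF T meas])
  also have "\<dots> = (\<Prod>b\<in>(Basis :: 'a set). (\<integral>x. h b x \<partial>lborel))"
    by (rule product_integral_prod[OF finite_Basis i])
  also have "\<dots> = (\<Prod>b\<in>(Basis :: 'a set). of_real (sqrt (pi / t) * exp (- ((z \<bullet> b)\<^sup>2 / (4 * t)))))"
    unfolding h_def integral_gaussian_real[OF t] ..
  also have "\<dots> = of_real (sqrt (pi / t) ^ DIM('a) * (\<Prod>b\<in>(Basis :: 'a set). exp (- ((z \<bullet> b)\<^sup>2 / (4 * t)))))"
    unfolding of_real_prod[symmetric] prod.distrib prod_constant ..
  also have "(\<Prod>b\<in>(Basis :: 'a set). exp (- ((z \<bullet> b)\<^sup>2 / (4 * t)))) = exp (- ((z \<bullet> z) / (4 * t)))"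
  proof -
    have "z \<bullet> z = (\<Sum>b\<in>(Basis :: 'a set). (z \<bullet> b)\<^sup>2)"
      by (subst euclidean_inner) (simp add: power2_eq_square)
    then show ?thesis
      unfolding exp_sum[OF finite_Basis, symmetric] by (simp add: sum_divide_distrib sum_negf)
  qed
  finally show "(\<integral>x. cis (x \<bullet> z) * of_real (exp (- t * (x \<bullet> x))) \<partial>lborel)
        = of_real (sqrt (pi / t) ^ DIM('a) * exp (- ((z \<bullet> z) / (4 * t))))" .
qed

lemma integrable_gaussian:
  "t > 0 \<Longrightarrow> integrable lborel (\<lambda>x::'a::euclidean_space. complex_of_real (exp (- t * (x \<bullet> x))))"
  using integrable_gaussian_cis[of t "0::'a"] by simp

text \<open>Since \<open>sqrt (pi / t) / (2 * pi)\<close> equals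
  \<open>1 / sqrt (4 * pi * t)\<close>, this is the usual heat kernel, left in the shape that the
  Gaussian integral produces.\<close>

definition heat_kernel :: "real \<Rightarrow> 'a::euclidean_space \<Rightarrow> real" where
  "heat_kernel t z = (sqrt (pi / t) / (2 * pi)) ^ DIM('a) * exp (- ((z \<bullet> z) / (4 * t)))"

lemma heat_kernel_pos: "t > 0 \<Longrightarrow> heat_kernel t z > 0"
  unfolding heat_kernel_def by simp

lemma heat_kernel_minus: "heat_kernel t (- z) = heat_kernel t z"
  by (simp add: heat_kernel_def)

lemma heat_kernel_le: "t > 0 \<Longrightarrow> heat_kernel t (z::'a::euclidean_space) \<le> (sqrt (pi / t) / (2 * pi)) ^ DIM('a)"
  unfolding heat_kernel_def by (intro mult_left_le) auto

lemma continuous_on_heat_kernel [continuous_intros]: "t > 0 \<Longrightarrow> continuous_on UNIV (heat_kernel t)"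
  unfolding heat_kernel_def by (intro continuous_intros) auto

lemma borel_measurable_heat_kernel [measurable]: "heat_kernel t \<in> borel_measurable borel"
  unfolding heat_kernel_def by measurable

lemma integral_cis_eq_heat_kernel:
  fixes z :: "'a::euclidean_space"
  assumes "t > 0"
  shows "(\<integral>x. cis (x \<bullet> z) * of_real (exp (- t * (x \<bullet> x))) \<partial>lborel) = of_real ((2 * pi) ^ DIM('a) * heat_kernel t z)"
  unfolding integral_gaussian_cis[OF assms] heat_kernel_def by (simp add: power_divide)

text \<open>The probabilistic sign convention, opposite to that of \<open>fourier\<close>. This is
  why the transforms of mollified measures contain
  \<open>cnj (char_fun \<mu> \<xi>)\<close>.\<close>

definition char_fun :: "'a::euclidean_space measure \<Rightarrow> 'a \<Rightarrow> complex" where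
  "char_fun \<mu> \<xi> = (\<integral>y. cis (\<xi> \<bullet> y) \<partial>\<mu>)"

text \<open>Fubini with majorant \<open>norm (G x) * norm (h y)\<close>, the kernel being bounded by
  1. The general spaces allow it to serve both for measures on the Euclidean space and for pairings
  of a block with a level set.\<close>

lemma integral_bounded_kernel_swap:
  fixes G :: "'x \<Rightarrow> complex" and h :: "'y \<Rightarrow> complex" and b :: "'x \<Rightarrow> 'y \<Rightarrow> complex"
  assumes N: "sigma_finite_measure N" and \<mu>: "sigma_finite_measure \<mu>"
    and G: "integrable N G" and h: "integrable \<mu> h"
    and b: "case_prod b \<in> borel_measurable (N \<Otimes>\<^sub>M \<mu>)" and b1: "\<And>x y. norm (b x y) \<le> 1"
  shows "(\<integral>x. G x * (\<integral>y. h y * b x y \<partial>\<mu>) \<partial>N) = (\<integral>y. h y * (\<integral>x. G x * b x y \<partial>N) \<partial>\<mu>)"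
proof -
  interpret N: sigma_finite_measure N by (rule N)
  interpret \<mu>: sigma_finite_measure \<mu> by (rule \<mu>)
  interpret P: pair_sigma_finite N \<mu> ..
  have [measurable]: "G \<in> borel_measurable N" "h \<in> borel_measurable \<mu>" using G h by auto
  note b[measurable]
  have hb: "integrable \<mu> (\<lambda>y. h y * b x y)" if "x \<in> space N" for x
  proof (rule Bochner_Integration.integrable_bound[OF h])
    show "(\<lambda>y. h y * b x y) \<in> borel_measurable \<mu>" using measurable_Pair2[OF b that] by simp
    show "AE y in \<mu>. norm (h y * b x y) \<le> norm (h y)"
      using b1[of x] by (intro AE_I2) (simp add: norm_mult mult_left_le)
  qed
  have "integrable (N \<Otimes>\<^sub>M \<mu>) (case_prod (\<lambda>x y. G x * (h y * b x y)))"
  proof (rule P.Fubini_integrable)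
    show "case_prod (\<lambda>x y. G x * (h y * b x y)) \<in> borel_measurable (N \<Otimes>\<^sub>M \<mu>)" by measurable
    show "AE x in N. integrable \<mu> (\<lambda>y. case (x, y) of (x, y) \<Rightarrow> G x * (h y * b x y))"
      using hb by (intro AE_I2) auto
    show "integrable N (\<lambda>x. \<integral>y. norm (case (x, y) of (x, y) \<Rightarrow> G x * (h y * b x y)) \<partial>\<mu>)"
    proof (rule Bochner_Integration.integrable_bound)
      show "integrable N (\<lambda>x. norm (G x) * (\<integral>y. norm (h y) \<partial>\<mu>))" using G by auto
      show "(\<lambda>x. \<integral>y. norm (case (x, y) of (x, y) \<Rightarrow> G x * (h y * b x y)) \<partial>\<mu>) \<in> borel_measurable N"
        by measurable
      show "AE x in N. norm (\<integral>y. norm (case (x, y) of (x, y) \<Rightarrow> G x * (h y * b x y)) \<partial>\<mu>)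
          \<le> norm (norm (G x) * (\<integral>y. norm (h y) \<partial>\<mu>))"
      proof (rule AE_I2)
        fix x assume x: "x \<in> space N"
        have "(\<integral>y. norm (G x * (h y * b x y)) \<partial>\<mu>) \<le> (\<integral>y. norm (G x) * norm (h y) \<partial>\<mu>)"
        proof (rule integral_mono)
          show "integrable \<mu> (\<lambda>y. norm (G x * (h y * b x y)))" using hb[OF x] by auto
          show "integrable \<mu> (\<lambda>y. norm (G x) * norm (h y))" using h by auto
          show "norm (G x * (h y * b x y)) \<le> norm (G x) * norm (h y)" for y
            using b1[of x y] by (simp add: norm_mult mult_left_le mult_left_mono)
        qed
        then show "norm (\<integral>y. norm (case (x, y) of (x, y) \<Rightarrow> G x * (h y * b x y)) \<partial>\<mu>)
          \<le> norm (norm (G x) * (\<integral>y. norm (h y) \<partial>\<mu>))"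
          by simp
      qed
    qed
  qed
  from P.Fubini_integral[OF this]
  have "(\<integral>y. (\<integral>x. G x * (h y * b x y) \<partial>N) \<partial>\<mu>) = (\<integral>x. (\<integral>y. G x * (h y * b x y) \<partial>\<mu>) \<partial>N)" .
  also have "\<dots> = (\<integral>x. G x * (\<integral>y. h y * b x y \<partial>\<mu>) \<partial>N)"
    by simp
  also have "(\<integral>y. (\<integral>x. G x * (h y * b x y) \<partial>N) \<partial>\<mu>) = (\<integral>y. (\<integral>x. h y * (G x * b x y) \<partial>N) \<partial>\<mu>)"
    by (simp only: mult.left_commute)
  also have "\<dots> = (\<integral>y. h y * (\<integral>x. G x * b x y \<partial>N) \<partial>\<mu>)"
    by simp
  finally show ?thesis ..
qed

locale borel_prob = prob_space \<mu> for \<mu> :: "'a::euclidean_space measure" +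
  assumes sets_eq_borel: "sets \<mu> = sets borel"
begin

lemma space_eq_UNIV: "space \<mu> = UNIV"
  using sets_eq_imp_space_eq[OF sets_eq_borel] by simp

lemma measurable_iff_borel: "measurable \<mu> N = measurable borel N"
  by (rule measurable_cong_sets[OF sets_eq_borel refl])

lemma measurable_pair_borel: "measurable (lborel \<Otimes>\<^sub>M \<mu>) N = measurable (borel \<Otimes>\<^sub>M borel) N"
  by (intro measurable_cong_sets sets_pair_measure_cong sets_eq_borel sets_lborel refl)

lemma borel_measurable_char_fun [measurable]: "char_fun \<mu> \<in> borel_measurable borel"
proof -
  have "(\<lambda>(\<xi>, y). cis (\<xi> \<bullet> y)) \<in> borel_measurable (borel \<Otimes>\<^sub>M \<mu>)"
    unfolding measurable_cong_sets[OF sets_pair_measure_cong[OF refl sets_eq_borel] refl] by measurable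
  then have "(\<lambda>\<xi>. \<integral>y. cis (\<xi> \<bullet> y) \<partial>\<mu>) \<in> borel_measurable borel"
    by (rule borel_measurable_lebesgue_integral)
  then show ?thesis unfolding char_fun_def .
qed

lemma norm_char_fun_le_1: "norm (char_fun \<mu> \<xi>) \<le> 1"
proof -
  have "norm (char_fun \<mu> \<xi>) \<le> (\<integral>y. norm (cis (\<xi> \<bullet> y)) \<partial>\<mu>)"
    unfolding char_fun_def by (rule integral_norm_bound)
  then show ?thesis by (simp add: prob_space)
qed

lemma bounded_kernel_swap:
  fixes G :: "'a \<Rightarrow> complex" and b :: "'a \<Rightarrow> 'a \<Rightarrow> complex"
  assumes "integrable lborel G" "case_prod b \<in> borel_measurable (borel \<Otimes>\<^sub>M borel)" "\<And>x y. norm (b x y) \<le> 1"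
  shows "(\<integral>x. G x * (\<integral>y. b x y \<partial>\<mu>) \<partial>lborel) = (\<integral>y. (\<integral>x. G x * b x y \<partial>lborel) \<partial>\<mu>)"
  using integral_bounded_kernel_swap[OF sigma_finite_lborel sigma_finite_measure_axioms assms(1), of "\<lambda>_. 1" b] assms(2,3)
  unfolding measurable_pair_borel by simp

lemma cnj_char_fun: "cnj (char_fun \<mu> \<xi>) = (\<integral>y. cis (- (\<xi> \<bullet> y)) \<partial>\<mu>)"
  unfolding char_fun_def by (simp add: cis_cnj flip: Bochner_Integration.integral_cnj)

lemma integrable_kernel:
  assumes "continuous_on UNIV k" "\<And>z. \<bar>k z\<bar> \<le> B"
  shows "integrable \<mu> (\<lambda>y. k (w - y) :: real)"
proof (rule integrable_const_bound[where B = B])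
  show "(\<lambda>y. k (w - y)) \<in> borel_measurable \<mu>"
    unfolding measurable_iff_borel
    by (intro borel_measurable_continuous_onI continuous_on_compose2[OF assms(1)] continuous_intros) auto
qed (use assms(2) in auto)

definition mollify :: "('a \<Rightarrow> real) \<Rightarrow> 'a \<Rightarrow> real" where
  "mollify k w = (\<integral>y. k (w - y) \<partial>\<mu>)"

text \<open>Fourier inversion with a Gaussian convergence factor: the factor justifies the exchange
  of integrals, and its own transform is the heat kernel.\<close>

lemma fourier_heat_mollify:
  assumes t: "t > 0"
  shows "(\<integral>\<xi>. char_fun \<mu> \<xi> * of_real (exp (- t * (\<xi> \<bullet> \<xi>))) * cis (- (\<xi> \<bullet> w)) \<partial>lborel)
    = of_real ((2 * pi) ^ DIM('a) * mollify (heat_kernel t) w)"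
proof -
  let ?G = "\<lambda>\<xi>. of_real (exp (- t * (\<xi> \<bullet> \<xi>))) * cis (- (\<xi> \<bullet> w))"
  have eq: "cis (\<xi> \<bullet> (y - w)) = cis (\<xi> \<bullet> y) * cis (- (\<xi> \<bullet> w))" for \<xi> y
    by (simp add: cis_mult inner_diff_right)
  have G: "integrable lborel ?G"
    using integrable_gaussian_cis[OF t, of "- w"] by (simp add: mult.commute)
  have "(\<integral>\<xi>. ?G \<xi> * (\<integral>y. cis (\<xi> \<bullet> y) \<partial>\<mu>) \<partial>lborel) = (\<integral>y. (\<integral>\<xi>. ?G \<xi> * cis (\<xi> \<bullet> y) \<partial>lborel) \<partial>\<mu>)"
  proof (rule bounded_kernel_swap[OF G])
    show "case_prod (\<lambda>(\<xi>::'a) y. cis (\<xi> \<bullet> y)) \<in> borel_measurable (borel \<Otimes>\<^sub>M borel)" by measurable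
  qed simp
  also have "\<dots> = (\<integral>y. (\<integral>\<xi>. cis (\<xi> \<bullet> (y - w)) * of_real (exp (- t * (\<xi> \<bullet> \<xi>))) \<partial>lborel) \<partial>\<mu>)"
    by (intro Bochner_Integration.integral_cong)
       (simp_all add: eq mult_ac)
  also have "\<dots> = (\<integral>y. of_real ((2 * pi) ^ DIM('a) * heat_kernel t (y - w)) \<partial>\<mu>)"
    unfolding integral_cis_eq_heat_kernel[OF t] ..
  also have "\<dots> = of_real ((2 * pi) ^ DIM('a) * mollify (heat_kernel t) w)"
    unfolding mollify_def using heat_kernel_minus[of t "w - y" for y] by simp
  finally show ?thesis unfolding char_fun_def by (simp add: mult_ac)
qed

text \<open>The squared modulus is \<open>char_fun\<close> times its conjugate; writing the
  conjugate as an integral over \<open>\<mu>\<close> and exchanging the integrals leaves the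
  inversion formula. Bounds on ball masses can thus control the Fourier side.\<close>

lemma energy_gaussian_eq:
  assumes t: "t > 0"
  shows "(\<integral>\<^sup>+\<xi>. ennreal (exp (- t * (\<xi> \<bullet> \<xi>)) * (norm (char_fun \<mu> \<xi>))\<^sup>2) \<partial>lborel)
    = ennreal ((2 * pi) ^ DIM('a) * (\<integral>w. mollify (heat_kernel t) w \<partial>\<mu>))"
proof -
  let ?G = "\<lambda>\<xi>. char_fun \<mu> \<xi> * of_real (exp (- t * (\<xi> \<bullet> \<xi>)))"
  have G: "integrable lborel ?G"
    by (rule Bochner_Integration.integrable_bound[OF integrable_gaussian[OF t]])
       (auto simp: norm_mult norm_char_fun_le_1)
  have G2: "integrable lborel (\<lambda>\<xi>. exp (- t * (\<xi> \<bullet> \<xi>)) * (norm (char_fun \<mu> \<xi>))\<^sup>2)"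
    by (rule Bochner_Integration.integrable_bound[OF integrable_gaussian[OF t]])
       (auto simp: norm_mult norm_char_fun_le_1 power_le_one mult_left_le)
  have "of_real (\<integral>\<xi>. exp (- t * (\<xi> \<bullet> \<xi>)) * (norm (char_fun \<mu> \<xi>))\<^sup>2 \<partial>lborel) = (\<integral>\<xi>. ?G \<xi> * (\<integral>w. cis (- (\<xi> \<bullet> w)) \<partial>\<mu>) \<partial>lborel)"
    unfolding cnj_char_fun[symmetric] integral_complex_of_real[symmetric]
    by (intro Bochner_Integration.integral_cong) (simp_all only: of_real_mult complex_norm_square mult_ac)
  also have "\<dots> = (\<integral>w. (\<integral>\<xi>. ?G \<xi> * cis (- (\<xi> \<bullet> w)) \<partial>lborel) \<partial>\<mu>)"
  proof (rule bounded_kernel_swap[OF G])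
    show "case_prod (\<lambda>(\<xi>::'a) y. cis (- (\<xi> \<bullet> y))) \<in> borel_measurable (borel \<Otimes>\<^sub>M borel)" by measurable
  qed simp
  also have "\<dots> = of_real ((2 * pi) ^ DIM('a) * (\<integral>w. mollify (heat_kernel t) w \<partial>\<mu>))"
    unfolding fourier_heat_mollify[OF t] by simp
  finally have "(\<integral>\<xi>. exp (- t * (\<xi> \<bullet> \<xi>)) * (norm (char_fun \<mu> \<xi>))\<^sup>2 \<partial>lborel) = (2 * pi) ^ DIM('a) * (\<integral>w. mollify (heat_kernel t) w \<partial>\<mu>)"
    by (simp only: of_real_eq_iff)
  then show ?thesis using nn_integral_eq_integral[OF G2] by simp
qed

end

section \<open>Gaussian tails and dyadic shells\<close>

lemma ennreal_le_suminf: "f i \<le> (\<Sum>i. f i)" for f :: "nat \<Rightarrow> ennreal"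
  using sum_le_suminf[of f "{i}"] by simp

text \<open>A single term of the exponential series at \<open>u = v\<^sup>2 / 4\<close> gives decay
  of order \<open>2 * N\<close>; it is weakened to \<open>N\<close>, which \<open>v \<ge> 1\<close>
  permits.\<close>

lemma exp_minus_square_le:
  fixes v :: real
  assumes "v \<ge> 1"
  shows "exp (- (v\<^sup>2 / 4)) \<le> (fact N * 4 ^ N) / v ^ N"
proof -
  define u where "u = v\<^sup>2 / 4"
  have u: "u > 0" using assms by (simp add: u_def)
  have "u ^ N / fact N \<le> exp u"
  proof -
    have "(\<Sum>n\<in>{N}. u ^ n /\<^sub>R fact n) \<le> (\<Sum>n. u ^ n /\<^sub>R fact n)"
      using u by (intro sum_le_suminf summable_exp_generic) auto
    then show ?thesis by (simp add: exp_def divide_inverse mult.commute)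
  qed
  then have "exp (- u) \<le> fact N / u ^ N"
    using u by (simp add: exp_minus field_simps)
  also have "\<dots> = (fact N * 4 ^ N) / (v\<^sup>2) ^ N"
    by (simp add: u_def power_divide)
  also have "\<dots> \<le> (fact N * 4 ^ N) / v ^ N"
    using assms by (intro divide_left_mono power_mono mult_pos_pos zero_less_power) (auto simp: power2_eq_square)
  finally show ?thesis by (simp add: u_def)
qed

text \<open>Replaces the Gaussian by a series of step functions, whose integrals are ball masses.
  The least \<open>j\<close> with \<open>v < 2 ^ Suc j\<close> satisfies
  \<open>2 ^ j \<le> v\<close> unless \<open>j = 0\<close>, and then the constant is already at
  least 1.\<close>

lemma exp_minus_square_dyadic:
  fixes v :: real
  assumes "v \<ge> 0"
  shows "ennreal (exp (- (v\<^sup>2 / 4))) \<le> (\<Sum>j. ennreal ((fact N * 4 ^ N) * (1 / 2 ^ j) ^ N) * indicator {..<2 ^ Suc j} v)"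
proof -
  let ?f = "\<lambda>j. ennreal ((fact N * 4 ^ N) * (1 / 2 ^ j) ^ N) * indicator {..<2 ^ Suc j} v"
  have "\<exists>j. v < 2 ^ Suc j"
    using real_arch_pow[of 2 v] by (metis less_trans one_less_numeral_iff power_strict_increasing_iff semiring_norm(76) lessI)
  define j where "j = (LEAST j. v < 2 ^ Suc j)"
  have j: "v < 2 ^ Suc j" unfolding j_def by (rule LeastI_ex) fact
  have "exp (- (v\<^sup>2 / 4)) \<le> (fact N * 4 ^ N) * (1 / 2 ^ j) ^ N"
  proof (cases j)
    case 0
    have "exp (- (v\<^sup>2 / 4)) \<le> 1" by simp
    also have "\<dots> \<le> fact N * 4 ^ N" by (intro mult_ge1_I) (auto simp: fact_ge_1)
    finally show ?thesis using 0 by simp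
  next
    case (Suc i)
    have "\<not> v < 2 ^ Suc i" using not_less_Least[of i "\<lambda>j. v < 2 ^ Suc j"] Suc unfolding j_def by simp
    then have v: "2 ^ j \<le> v" using Suc by simp
    then have v1: "v \<ge> 1" using one_le_power[of "2::real" j] by linarith
    have "exp (- (v\<^sup>2 / 4)) \<le> (fact N * 4 ^ N) / v ^ N" by (rule exp_minus_square_le[OF v1])
    also have "\<dots> \<le> (fact N * 4 ^ N) / (2 ^ j) ^ N"
      using v v1 by (intro divide_left_mono power_mono mult_pos_pos zero_less_power) auto
    finally show ?thesis by (simp add: power_divide)
  qed
  then have "ennreal (exp (- (v\<^sup>2 / 4))) \<le> ?f j" using j by (simp add: ennreal_leI)
  also have "\<dots> \<le> (\<Sum>j. ?f j)" by (rule ennreal_le_suminf)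
  finally show ?thesis .
qed

lemma power_powr_swap: "x > 0 \<Longrightarrow> (x ^ n) powr s = (x powr s) ^ n" for x s :: real
  by (induction n) (simp_all add: powr_mult)

context borel_prob
begin

text \<open>Integrability is not assumed: otherwise the integral is 0 by convention, a case covered
  by \<open>b \<ge> 0\<close>.\<close>

lemma mollify_le:
  assumes "emeasure \<mu> (- E) = 0" "closed E" "b \<ge> 0" "\<And>y. y \<in> E \<Longrightarrow> k (w - y) \<le> b"
  shows "mollify k w \<le> b"
proof (cases "integrable \<mu> (\<lambda>y. k (w - y))")
  case True
  have "AE y in \<mu>. y \<in> E"
    by (rule AE_I[of _ _ "- E"]) (use assms in \<open>auto simp: sets_eq_borel\<close>)
  then have "AE y in \<mu>. k (w - y) \<le> b" by eventually_elim (rule assms)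
  then have "(\<integral>y. k (w - y) \<partial>\<mu>) \<le> (\<integral>y. b \<partial>\<mu>)"
    by (intro integral_mono_AE True) simp_all
  then show ?thesis by (simp add: mollify_def prob_space)
next
  case False
  then show ?thesis using assms by (simp add: mollify_def not_integrable_integral_eq)
qed

lemma integral_pos:
  assumes f: "integrable \<mu> f" and pos: "\<And>x. f x > (0::real)"
  shows "(\<integral>x. f x \<partial>\<mu>) > 0"
proof -
  have "(\<integral>x. f x \<partial>\<mu>) \<ge> 0" using pos by (intro integral_nonneg_AE AE_I2 less_imp_le)
  moreover have "(\<integral>x. f x \<partial>\<mu>) \<noteq> 0"
  proof
    assume "(\<integral>x. f x \<partial>\<mu>) = 0"
    then have "AE x in \<mu>. f x = 0"
      using integral_nonneg_eq_0_iff_AE[OF f] pos by (simp add: less_imp_le)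
    then have "AE x in \<mu>. False" by eventually_elim (use pos in \<open>simp add: less_imp_neq[symmetric]\<close>)
    then show False by simp
  qed
  ultimately show ?thesis by simp
qed

lemma mollify_nonneg: "(\<And>z. k z \<ge> 0) \<Longrightarrow> mollify k w \<ge> 0"
  unfolding mollify_def by (intro integral_nonneg_AE) auto

lemma continuous_on_mollify:
  assumes k: "continuous_on UNIV k" and B: "\<And>z. \<bar>k z\<bar> \<le> B"
  shows "continuous_on UNIV (mollify k)"
proof (rule continuous_on_sequentiallyI)
  fix u :: "nat \<Rightarrow> 'a" and a assume u: "u \<longlonglongrightarrow> a"
  show "(\<lambda>n. mollify k (u n)) \<longlonglongrightarrow> mollify k a"
    unfolding mollify_def
  proof (rule integral_dominated_convergence[where w = "\<lambda>_. B"])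
    show "(\<lambda>y. k (a - y)) \<in> borel_measurable \<mu>" "(\<lambda>y. k (u n - y)) \<in> borel_measurable \<mu>" for n
      by (rule borel_measurable_integrable[OF integrable_kernel[OF k B]])+
    show "AE y in \<mu>. (\<lambda>n. k (u n - y)) \<longlonglongrightarrow> k (a - y)"
    proof (rule AE_I2)
      fix y
      have "(\<lambda>n. u n - y) \<longlonglongrightarrow> a - y" by (intro tendsto_intros u)
      then show "(\<lambda>n. k (u n - y)) \<longlonglongrightarrow> k (a - y)"
        using continuous_on_tendsto_compose[OF k, of "\<lambda>n. u n - y"] by simp
    qed
  qed (use B in simp_all)
qed

lemma ennreal_mollify:
  assumes "continuous_on UNIV k" "\<And>z. \<bar>k z\<bar> \<le> B" "\<And>z. k z \<ge> 0"
  shows "ennreal (mollify k w) = (\<integral>\<^sup>+y. ennreal (k (w - y)) \<partial>\<mu>)"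
  unfolding mollify_def by (rule nn_integral_eq_integral[symmetric, OF integrable_kernel[OF assms(1,2)]]) (use assms in simp)

lemma abs_heat_kernel_le:
  "t > 0 \<Longrightarrow> \<bar>heat_kernel t (z::'a)\<bar> \<le> (sqrt (pi / t) / (2 * pi)) ^ DIM('a)"
  using heat_kernel_le[of t z] heat_kernel_pos[of t z] by simp

lemma continuous_on_mollify_heat: "t > 0 \<Longrightarrow> continuous_on UNIV (mollify (heat_kernel t))"
  by (rule continuous_on_mollify[OF continuous_on_heat_kernel abs_heat_kernel_le])

lemma integrable_mollify_heat:
  assumes t: "t > 0"
  shows "integrable \<mu> (mollify (heat_kernel t))"
proof (rule integrable_const_bound[where B = "(sqrt (pi / t) / (2 * pi)) ^ DIM('a)"])
  show "mollify (heat_kernel t) \<in> borel_measurable \<mu>"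
    unfolding measurable_iff_borel by (intro borel_measurable_continuous_onI continuous_on_mollify_heat t)
  have "mollify (heat_kernel t) w \<le> (sqrt (pi / t) / (2 * pi)) ^ DIM('a)" for w
    by (rule mollify_le[of UNIV]) (use t in \<open>auto intro: heat_kernel_le\<close>)
  moreover have "mollify (heat_kernel t) w \<ge> 0" for w
    by (intro mollify_nonneg less_imp_le heat_kernel_pos t)
  ultimately show "AE w in \<mu>. norm (mollify (heat_kernel t) w) \<le> (sqrt (pi / t) / (2 * pi)) ^ DIM('a)"
    by (intro AE_I2) simp
qed

text \<open>The kernel has height of order \<open>t powr (- (DIM('a) / 2))\<close> and width
  \<open>sqrt t\<close>, and a ball of that radius has mass of order \<open>t powr (s / 2)\<close>.
  The product is the claimed rate; dyadic balls absorb the tail.\<close>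

lemma mollify_heat_le:
  fixes s C :: real
  assumes C: "C > 0" and s: "s > 0" and ball: "\<And>x r. r > 0 \<Longrightarrow> measure \<mu> (ball x r) \<le> C * r powr s"
  shows "\<exists>K\<ge>0. \<forall>t>0. \<forall>w. mollify (heat_kernel t) w \<le> K * t powr ((s - DIM('a)) / 2)"
proof -
  \<comment> \<open>Tail decay of order \<open>N > s\<close> outweighs the growth
    \<open>(2 powr s) ^ j\<close> of the ball masses, so the series over the balls is geometric with
    ratio \<open>q < 1\<close>.\<close>
  obtain N :: nat where N: "s < real N" using reals_Archimedean2 by blast
  define A where "A = (fact N * 4 ^ N :: real)"
  define q where "q = 2 powr (s - real N)"
  have q: "0 < q" "q < 1" using N by (auto simp: q_def powr_less_one)
  define D where "D = (1 / (2 * sqrt pi)) ^ DIM('a)"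
  define K where "K = D * (A * C * 2 powr s / (1 - q))"
  have A: "A > 0" and D: "D > 0" by (simp_all add: A_def D_def)
  have K: "K \<ge> 0" using A D C q by (simp add: K_def)
  show ?thesis
  proof (intro exI[of _ K] conjI allI impI K)
    fix t :: real and w :: 'a assume t: "t > 0"
    have c: "(sqrt (pi / t) / (2 * pi)) ^ DIM('a) = D * t powr (- (DIM('a) / 2))"
    proof -
      have "sqrt (pi / t) / (2 * pi) = (1 / (2 * sqrt pi)) * (1 / sqrt t)"
        using t by (simp add: real_sqrt_divide field_simps real_sqrt_mult_self)
      moreover have "(1 / sqrt t) ^ DIM('a) = t powr (- (DIM('a) / 2))"
        using t by (simp add: powr_half_sqrt[symmetric] powr_minus_divide[symmetric] powr_realpow[symmetric] powr_powr)
      ultimately show ?thesis by (simp only: D_def power_mult_distrib)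
    qed
    let ?v = "\<lambda>y. norm (w - y) / sqrt t"
    have "ennreal (mollify (heat_kernel t) w) = (\<integral>\<^sup>+y. ennreal (heat_kernel t (w - y)) \<partial>\<mu>)"
      by (rule ennreal_mollify[OF continuous_on_heat_kernel[OF t] abs_heat_kernel_le[OF t] less_imp_le[OF heat_kernel_pos[OF t]]])
    also have "\<dots> = (\<integral>\<^sup>+y. ennreal (D * t powr (- (DIM('a) / 2))) * ennreal (exp (- ((?v y)\<^sup>2 / 4))) \<partial>\<mu>)"
    proof (rule nn_integral_cong)
      fix y
      have eq: "((w - y) \<bullet> (w - y)) / (4 * t) = (?v y)\<^sup>2 / 4"
        using t by (simp add: power_divide dot_square_norm)
      show "ennreal (heat_kernel t (w - y)) = ennreal (D * t powr (- (DIM('a) / 2))) * ennreal (exp (- ((?v y)\<^sup>2 / 4)))"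
        unfolding heat_kernel_def c eq by (rule ennreal_mult) (use D in auto)
    qed
    also have "\<dots> \<le> (\<integral>\<^sup>+y. ennreal (D * t powr (- (DIM('a) / 2))) * (\<Sum>j. ennreal (A * (1 / 2 ^ j) ^ N) * indicator (ball w (2 ^ Suc j * sqrt t)) y) \<partial>\<mu>)"
    proof (intro nn_integral_mono mult_left_mono)
      fix y
      have "ennreal (exp (- ((?v y)\<^sup>2 / 4))) \<le> (\<Sum>j. ennreal (A * (1 / 2 ^ j) ^ N) * indicator {..<2 ^ Suc j} (?v y))"
        unfolding A_def using t by (intro exp_minus_square_dyadic) simp
      also have "(\<lambda>j. ennreal (A * (1 / 2 ^ j) ^ N) * indicator {..<2 ^ Suc j} (?v y)) = (\<lambda>j. ennreal (A * (1 / 2 ^ j) ^ N) * indicator (ball w (2 ^ Suc j * sqrt t)) y)"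
        using t by (auto simp: fun_eq_iff dist_norm divide_less_eq split: split_indicator)
      finally show "ennreal (exp (- ((?v y)\<^sup>2 / 4))) \<le> (\<Sum>j. ennreal (A * (1 / 2 ^ j) ^ N) * indicator (ball w (2 ^ Suc j * sqrt t)) y)" .
    qed simp
    also have "\<dots> = ennreal (D * t powr (- (DIM('a) / 2))) * (\<Sum>j. ennreal (A * (1 / 2 ^ j) ^ N) * emeasure \<mu> (ball w (2 ^ Suc j * sqrt t)))"
    proof -
      have [simp]: "\<And>x r. ball x r \<in> sets \<mu>" by (simp add: sets_eq_borel)
      have m: "(\<lambda>y. ennreal (A * (1 / 2 ^ j) ^ N) * indicator (ball w (2 ^ Suc j * sqrt t)) y) \<in> borel_measurable \<mu>" for j
        by (intro borel_measurable_times_ennreal borel_measurable_const borel_measurable_indicator) simp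
      show ?thesis
        by (simp only: nn_integral_cmult[OF borel_measurable_suminf_order[OF m]] nn_integral_suminf[OF m]
            nn_integral_cmult_indicator[OF \<open>\<And>x r. ball x r \<in> sets \<mu>\<close>])
    qed
    also have "\<dots> \<le> ennreal (D * t powr (- (DIM('a) / 2))) * (\<Sum>j. ennreal (A * C * 2 powr s * t powr (s / 2) * q ^ j))"
    proof (intro mult_left_mono suminf_le)
      fix j :: nat
      have p: "(2 ^ Suc j * sqrt t) powr s = 2 powr s * (2 powr s) ^ j * t powr (s / 2)"
      proof -
        have "(2 ^ Suc j * sqrt t) powr s = (2 ^ Suc j) powr s * (sqrt t) powr s"
          using t by (simp add: powr_mult)
        also have "(2 ^ Suc j :: real) powr s = 2 powr s * (2 powr s) ^ j"
          using power_powr_swap[of 2 "Suc j" s] by simp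
        also have "(sqrt t) powr s = t powr (s / 2)"
          using t by (simp add: powr_half_sqrt[symmetric] powr_powr)
        finally show ?thesis .
      qed
      have qj: "q ^ j = (2 powr s) ^ j * (1 / 2 ^ j) ^ N"
        unfolding q_def powr_diff by (simp add: powr_realpow power_divide power_mult[symmetric] mult.commute)
      have "measure \<mu> (ball w (2 ^ Suc j * sqrt t)) \<le> C * (2 ^ Suc j * sqrt t) powr s"
        using t by (intro ball) simp
      then have "A * (1 / 2 ^ j) ^ N * measure \<mu> (ball w (2 ^ Suc j * sqrt t)) \<le> A * (1 / 2 ^ j) ^ N * (C * (2 ^ Suc j * sqrt t) powr s)"
        using A by (intro mult_left_mono) auto
      also have "\<dots> = A * C * 2 powr s * t powr (s / 2) * q ^ j"
        unfolding p qj by (simp only: mult_ac)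
      finally have "ennreal (A * (1 / 2 ^ j) ^ N * measure \<mu> (ball w (2 ^ Suc j * sqrt t))) \<le> ennreal (A * C * 2 powr s * t powr (s / 2) * q ^ j)"
        by (rule ennreal_leI)
      then show "ennreal (A * (1 / 2 ^ j) ^ N) * emeasure \<mu> (ball w (2 ^ Suc j * sqrt t)) \<le> ennreal (A * C * 2 powr s * t powr (s / 2) * q ^ j)"
        using A by (simp add: emeasure_eq_measure ennreal_mult)
    qed auto
    also have "(\<Sum>j. ennreal (A * C * 2 powr s * t powr (s / 2) * q ^ j)) = ennreal (A * C * 2 powr s * t powr (s / 2) * (1 / (1 - q)))"
    proof -
      have "(\<lambda>j. A * C * 2 powr s * t powr (s / 2) * q ^ j) sums (A * C * 2 powr s * t powr (s / 2) * (1 / (1 - q)))"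
        using q by (intro sums_mult geometric_sums) auto
      then show ?thesis using A C q by (subst suminf_ennreal2) (auto simp: sums_iff)
    qed
    also have "ennreal (D * t powr (- (DIM('a) / 2))) * \<dots> = ennreal (K * t powr ((s - DIM('a)) / 2))"
    proof -
      have "t powr ((s - DIM('a)) / 2) = t powr (- (DIM('a) / 2)) * t powr (s / 2)"
        by (simp add: powr_add[symmetric] diff_divide_distrib)
      then have "K * t powr ((s - DIM('a)) / 2) = (D * t powr (- (DIM('a) / 2))) * (A * C * 2 powr s * t powr (s / 2) * (1 / (1 - q)))"
        by (simp add: K_def)
      then show ?thesis using D by (subst ennreal_mult'[symmetric]) simp_all
    qed
    finally show "mollify (heat_kernel t) w \<le> K * t powr ((s - DIM('a)) / 2)"
      using K by (subst (asm) ennreal_le_iff) auto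
  qed
qed

lemma energy_gaussian_le:
  fixes s C :: real
  assumes C: "C > 0" and s: "s > 0" and ball: "\<And>x r. r > 0 \<Longrightarrow> measure \<mu> (ball x r) \<le> C * r powr s"
  shows "\<exists>K\<ge>0. \<forall>t>0. (\<integral>\<^sup>+\<xi>. ennreal (exp (- t * (\<xi> \<bullet> \<xi>)) * (norm (char_fun \<mu> \<xi>))\<^sup>2) \<partial>lborel) \<le> ennreal (K * t powr ((s - DIM('a)) / 2))"
proof -
  obtain K where K: "K \<ge> 0" and K': "\<forall>t>0. \<forall>w. mollify (heat_kernel t) w \<le> K * t powr ((s - DIM('a)) / 2)"
    using mollify_heat_le[OF C s ball] by blast
  have K2: "mollify (heat_kernel t) w \<le> K * t powr ((s - DIM('a)) / 2)" if "t > 0" for t w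
    using K' that by blast
  show ?thesis
  proof (intro exI[of _ "(2 * pi) ^ DIM('a) * K"] conjI allI impI)
    show "(2 * pi) ^ DIM('a) * K \<ge> 0" using K by simp
    fix t :: real assume t: "t > 0"
    let ?b = "K * t powr ((s - DIM('a)) / 2)"
    have "(\<integral>w. mollify (heat_kernel t) w \<partial>\<mu>) \<le> (\<integral>w. ?b \<partial>\<mu>)"
      by (rule integral_mono[OF integrable_mollify_heat[OF t]]) (use K2[OF t] in auto)
    then have "(\<integral>w. mollify (heat_kernel t) w \<partial>\<mu>) \<le> ?b" by (simp add: prob_space)
    then show "(\<integral>\<^sup>+\<xi>. ennreal (exp (- t * (\<xi> \<bullet> \<xi>)) * (norm (char_fun \<mu> \<xi>))\<^sup>2) \<partial>lborel)
        \<le> ennreal ((2 * pi) ^ DIM('a) * K * t powr ((s - DIM('a)) / 2))"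
      unfolding energy_gaussian_eq[OF t] mult.assoc by (intro ennreal_leI mult_left_mono) auto
  qed
qed

text \<open>If \<open>s\<close> exceeded the dimension, the Gaussian energies would tend to \<open>0\<close> as \<open>t\<close> tends to \<open>0\<close>,
  although they increase as \<open>t\<close> decreases.\<close>

lemma frostman_exponent_le_DIM:
  fixes s C :: real
  assumes C: "C > 0" and s: "s > 0" and ball: "\<And>x r. r > 0 \<Longrightarrow> measure \<mu> (ball x r) \<le> C * r powr s"
  shows "s \<le> real DIM('a)"
proof (rule ccontr)
  assume "\<not> s \<le> real DIM('a)"
  then have e: "(s - DIM('a)) / 2 > 0" by simp
  obtain K where K: "K \<ge> 0" and K': "\<forall>t>0. (\<integral>\<^sup>+\<xi>. ennreal (exp (- t * (\<xi> \<bullet> \<xi>)) * (norm (char_fun \<mu> \<xi>))\<^sup>2) \<partial>lborel) \<le> ennreal (K * t powr ((s - DIM('a)) / 2))"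
    using energy_gaussian_le[OF C s ball] by blast
  have K2: "(\<integral>\<^sup>+\<xi>. ennreal (exp (- t * (\<xi> \<bullet> \<xi>)) * (norm (char_fun \<mu> \<xi>))\<^sup>2) \<partial>lborel) \<le> ennreal (K * t powr ((s - DIM('a)) / 2))" if "t > 0" for t
    using K' that by blast
  let ?T = "\<lambda>t. \<integral>\<^sup>+\<xi>. ennreal (exp (- t * (\<xi> \<bullet> \<xi>)) * (norm (char_fun \<mu> \<xi>))\<^sup>2) \<partial>lborel"
  have le: "?T 1 \<le> ennreal (K * t powr ((s - DIM('a)) / 2))" if t: "0 < t" "t < 1" for t
  proof -
    have "?T 1 \<le> ?T t"
      using t by (intro nn_integral_mono ennreal_leI mult_right_mono) (auto simp: mult_left_le_one_le)
    then show ?thesis using K2[OF t(1)] by (rule order_trans)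
  qed
  have lim: "((\<lambda>t. ennreal (K * t powr ((s - DIM('a)) / 2))) \<longlongrightarrow> ennreal (K * 0)) (at_right 0)"
    using e by (intro tendsto_ennrealI tendsto_mult tendsto_const tendsto_zero_powrI)
      (auto intro!: tendsto_eq_intros simp: eventually_at_filter)
  have "?T 1 \<le> ennreal (K * 0)"
  proof (rule tendsto_le[OF _ lim tendsto_const])
    show "\<forall>\<^sub>F t in at_right 0. ?T 1 \<le> ennreal (K * t powr ((s - DIM('a)) / 2))"
      by (rule eventually_mono[OF eventually_at_right_real[OF zero_less_one]]) (use le in auto)
  qed simp
  then have "?T 1 = 0" by simp
  then have "(\<integral>w. mollify (heat_kernel 1) w \<partial>\<mu>) \<le> 0"
    unfolding energy_gaussian_eq[OF zero_less_one] using pi_gt_zero by (auto simp: ennreal_eq_0_iff mult_le_0_iff power_le_zero_eq)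
  moreover have "mollify (heat_kernel 1) w > 0" for w
    unfolding mollify_def
    by (intro integral_pos integrable_kernel[OF continuous_on_heat_kernel abs_heat_kernel_le] heat_kernel_pos) simp_all
  ultimately show False
    using integral_pos[OF integrable_mollify_heat[OF zero_less_one]] by fastforce
qed

text \<open>\<open>(1 + |\<xi>|\<^sup>2)\<close> to the power \<open>- a\<close> is dominated by a sum over \<open>j\<close> of multiples of
  \<open>4\<close> to the power \<open>- a j\<close> times \<open>exp (- |\<xi>|\<^sup>2 / 4^j)\<close>; this replaces the Fourier transform of the Riesz kernel.\<close>

lemma energy_finite:
  fixes s C :: real
  assumes C: "C > 0" and s: "s > 0" and ball: "\<And>x r. r > 0 \<Longrightarrow> measure \<mu> (ball x r) \<le> C * r powr s"
    and a: "a > 0" "a > (DIM('a) - s) / 2"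
  shows "(\<integral>\<^sup>+\<xi>. ennreal ((1 + (norm \<xi>)\<^sup>2) powr (- a) * (norm (char_fun \<mu> \<xi>))\<^sup>2) \<partial>lborel) < \<infinity>"
proof -
  obtain K where K: "K \<ge> 0" and K': "\<forall>t>0. (\<integral>\<^sup>+\<xi>. ennreal (exp (- t * (\<xi> \<bullet> \<xi>)) * (norm (char_fun \<mu> \<xi>))\<^sup>2) \<partial>lborel) \<le> ennreal (K * t powr ((s - DIM('a)) / 2))"
    using energy_gaussian_le[OF C s ball] by blast
  have K2: "(\<integral>\<^sup>+\<xi>. ennreal (exp (- t * (\<xi> \<bullet> \<xi>)) * (norm (char_fun \<mu> \<xi>))\<^sup>2) \<partial>lborel) \<le> ennreal (K * t powr ((s - DIM('a)) / 2))" if "t > 0" for t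
    using K' that by blast
  \<comment> \<open>For \<open>4 ^ j \<le> 1 + |\<xi>|^2 < 4 ^ Suc j\<close> the exponent
    \<open>|\<xi>|^2 / 4 ^ j\<close> is at most 4, so \<open>exp 4\<close> compensates the Gaussian
    factor, while \<open>(4 powr (- a)) ^ j\<close> bounds the weight.\<close>
  define c where "c = (\<lambda>j. exp 4 * (4 powr (- a)) ^ j :: real)"
  have c: "c j > 0" for j by (simp add: c_def)
  let ?e = "\<lambda>j \<xi>. exp (- ((1 / 4) ^ j) * (\<xi> \<bullet> \<xi>)) * (norm (char_fun \<mu> \<xi>))\<^sup>2"
  have pw: "ennreal ((1 + (norm \<xi>)\<^sup>2) powr (- a) * (norm (char_fun \<mu> \<xi>))\<^sup>2) \<le> (\<Sum>j. ennreal (c j) * ennreal (?e j \<xi>))" for \<xi>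
  proof -
    define u where "u = 1 + (norm \<xi>)\<^sup>2"
    have u: "u \<ge> 1" by (simp add: u_def)
    have ex: "\<exists>j. u < 4 ^ Suc j"
    proof -
      obtain n where "u < 4 ^ n" using real_arch_pow[of 4 u] by auto
      also have "(4::real) ^ n \<le> 4 ^ Suc n" by simp
      finally show ?thesis by blast
    qed
    define j where "j = (LEAST j. u < 4 ^ Suc j)"
    have j1: "u < 4 ^ Suc j" unfolding j_def by (rule LeastI_ex[OF ex])
    have j2: "4 ^ j \<le> u"
    proof (cases j)
      case (Suc i)
      have "\<not> u < 4 ^ Suc i" using not_less_Least[of i "\<lambda>j. u < 4 ^ Suc j"] Suc unfolding j_def by simp
      then show ?thesis using Suc by simp
    qed (use u in simp)
    have "u powr (- a) \<le> (4 ^ j) powr (- a)" using j2 a u by (intro powr_mono2') auto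
    also have "\<dots> = (4 powr (- a)) ^ j" by (simp add: powr_realpow[symmetric] powr_powr mult.commute)
    finally have 1: "u powr (- a) \<le> (4 powr (- a)) ^ j" .
    have "(1 / 4) ^ j * (\<xi> \<bullet> \<xi>) \<le> (1 / 4) ^ j * 4 ^ Suc j"
      using j1 by (intro mult_left_mono) (auto simp: u_def dot_square_norm)
    also have "\<dots> = 4" by (simp add: power_divide)
    finally have "1 \<le> exp (4 - (1 / 4) ^ j * (\<xi> \<bullet> \<xi>))" by simp
    also have "\<dots> = exp 4 * exp (- ((1 / 4) ^ j) * (\<xi> \<bullet> \<xi>))" by (simp add: exp_add[symmetric])
    finally have 2: "1 \<le> exp 4 * exp (- ((1 / 4) ^ j) * (\<xi> \<bullet> \<xi>))" .
    have "u powr (- a) * 1 \<le> (4 powr (- a)) ^ j * (exp 4 * exp (- ((1 / 4) ^ j) * (\<xi> \<bullet> \<xi>)))"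
      by (rule mult_mono[OF 1 2]) auto
    then have "u powr (- a) * (norm (char_fun \<mu> \<xi>))\<^sup>2 \<le> (4 powr (- a)) ^ j * (exp 4 * exp (- ((1 / 4) ^ j) * (\<xi> \<bullet> \<xi>))) * (norm (char_fun \<mu> \<xi>))\<^sup>2"
      by (intro mult_right_mono) auto
    also have "\<dots> = c j * ?e j \<xi>" by (simp add: c_def mult_ac)
    finally have "ennreal (u powr (- a) * (norm (char_fun \<mu> \<xi>))\<^sup>2) \<le> ennreal (c j) * ennreal (?e j \<xi>)"
      using c[of j] by (simp add: ennreal_leI ennreal_mult[symmetric])
    also have "\<dots> \<le> (\<Sum>j. ennreal (c j) * ennreal (?e j \<xi>))" by (rule ennreal_le_suminf)
    finally show ?thesis unfolding u_def .
  qed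
  \<comment> \<open>The Gaussian energy at time \<open>(1 / 4) ^ j\<close> may grow like the
    \<open>j\<close>-th power of \<open>4 powr ((DIM('a) - s) / 2)\<close>; the assumption on
    \<open>a\<close> is precisely that the product with the weight still has ratio below 1.\<close>
  define q where "q = 4 powr (- (a - (DIM('a) - s) / 2))"
  have q: "0 < q" "q < 1" using a by (auto simp: q_def powr_less_one)
  have "(\<integral>\<^sup>+\<xi>. ennreal ((1 + (norm \<xi>)\<^sup>2) powr (- a) * (norm (char_fun \<mu> \<xi>))\<^sup>2) \<partial>lborel)
      \<le> (\<integral>\<^sup>+\<xi>. (\<Sum>j. ennreal (c j) * ennreal (?e j \<xi>)) \<partial>lborel)"
    by (intro nn_integral_mono pw)
  also have "\<dots> = (\<Sum>j. ennreal (c j) * (\<integral>\<^sup>+\<xi>. ennreal (?e j \<xi>) \<partial>lborel))"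
    by (simp add: nn_integral_suminf nn_integral_cmult)
  also have "\<dots> \<le> (\<Sum>j. ennreal (exp 4 * K * q ^ j))"
  proof (intro suminf_le)
    fix j
    define x where "x = (s - DIM('a)) / 2"
    have "(1 / 4 :: real) powr x = 4 powr (- x)"
      by (simp add: powr_divide powr_minus_divide)
    then have "((1 / 4) ^ j :: real) powr x = (4 powr (- x)) ^ j"
      by (simp add: power_powr_swap)
    moreover have "(4 powr (- a)) * 4 powr (- x) = q"
      unfolding q_def x_def powr_add[symmetric] by (rule arg_cong[where f = "(powr) 4"]) (simp add: field_simps)
    ultimately have q': "(4 powr (- a)) ^ j * ((1 / 4) ^ j :: real) powr ((s - DIM('a)) / 2) = q ^ j"
      unfolding x_def[symmetric] by (simp only: power_mult_distrib[symmetric])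
    have "ennreal (c j) * (\<integral>\<^sup>+\<xi>. ennreal (?e j \<xi>) \<partial>lborel) \<le> ennreal (c j) * ennreal (K * ((1 / 4) ^ j) powr ((s - DIM('a)) / 2))"
      using K2[of "(1 / 4) ^ j"] by (intro mult_left_mono) auto
    also have "\<dots> = ennreal (exp 4 * K * q ^ j)"
      unfolding ennreal_mult'[OF less_imp_le[OF c], symmetric] by (simp only: c_def q'[symmetric] mult_ac)
    finally show "ennreal (c j) * (\<integral>\<^sup>+\<xi>. ennreal (?e j \<xi>) \<partial>lborel) \<le> ennreal (exp 4 * K * q ^ j)" .
  qed auto
  also have "\<dots> = ennreal (exp 4 * K * (1 / (1 - q)))"
  proof -
    have "(\<lambda>j. exp 4 * K * q ^ j) sums (exp 4 * K * (1 / (1 - q)))"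
      using q by (intro sums_mult geometric_sums) auto
    then show ?thesis using K q by (subst suminf_ennreal2) (auto simp: sums_iff)
  qed
  also have "\<dots> < \<infinity>" by simp
  finally show ?thesis .
qed

end

section \<open>Mollification\<close>

lemma
  fixes g :: "'a::euclidean_space \<Rightarrow> 'b::{banach, second_countable_topology}"
  assumes g: "g \<in> borel_measurable borel"
  shows lborel_integral_translate: "(\<integral>w. g (w - y) \<partial>lborel) = (\<integral>w. g w \<partial>lborel)"
    and lborel_integrable_translate: "integrable lborel (\<lambda>w. g (w - y)) \<longleftrightarrow> integrable lborel g"
proof -
  have m: "(+) (- y) \<in> measurable lborel borel" by measurable
  have d: "distr lborel borel ((+) (- y)) = lborel" by (rule lborel_distr_plus)
  show "(\<integral>w. g (w - y) \<partial>lborel) = (\<integral>w. g w \<partial>lborel)"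
    using integral_distr[OF m g] unfolding d by simp
  show "integrable lborel (\<lambda>w. g (w - y)) \<longleftrightarrow> integrable lborel g"
    using integrable_distr_eq[OF m g] unfolding d by simp
qed

lemma lborel_nn_integral_translate:
  fixes g :: "'a::euclidean_space \<Rightarrow> ennreal"
  assumes g: "g \<in> borel_measurable borel"
  shows "(\<integral>\<^sup>+w. g (w - y) \<partial>lborel) = (\<integral>\<^sup>+w. g w \<partial>lborel)"
proof -
  have m: "(+) (- y) \<in> measurable lborel borel" by measurable
  have d: "distr lborel borel ((+) (- y)) = (lborel :: 'a measure)" by (rule lborel_distr_plus)
  show ?thesis using nn_integral_distr[OF m, of g] g unfolding d by simp
qed

definition kernel_ft :: "('a::euclidean_space \<Rightarrow> real) \<Rightarrow> 'a \<Rightarrow> complex" where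
  "kernel_ft k \<xi> = (\<integral>z. of_real (k z) * cis (- (\<xi> \<bullet> z)) \<partial>lborel)"

lemma borel_measurable_kernel_ft:
  fixes k :: "'a::euclidean_space \<Rightarrow> real"
  assumes [measurable]: "k \<in> borel_measurable borel"
  shows "kernel_ft k \<in> borel_measurable borel"
proof -
  have "(\<lambda>(\<xi>, z). of_real (k z) * cis (- (\<xi> \<bullet> z))) \<in> borel_measurable (borel \<Otimes>\<^sub>M lborel)"
    by measurable
  then have "(\<lambda>\<xi>. \<integral>z. of_real (k z) * cis (- (\<xi> \<bullet> z)) \<partial>lborel) \<in> borel_measurable borel"
    by (rule sigma_finite_measure.borel_measurable_lebesgue_integral[OF sigma_finite_lborel])
  then show ?thesis unfolding kernel_ft_def .
qed

lemma norm_kernel_ft_le_1: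
  assumes "\<And>z. k z \<ge> 0" "(\<integral>z. k z \<partial>lborel) = 1"
  shows "norm (kernel_ft k \<xi>) \<le> 1"
proof -
  have "norm (kernel_ft k \<xi>) \<le> (\<integral>z. norm (of_real (k z) * cis (- (\<xi> \<bullet> z))) \<partial>lborel)"
    unfolding kernel_ft_def by (rule integral_norm_bound)
  also have "\<dots> = 1" using assms by (simp add: norm_mult)
  finally show ?thesis .
qed

lemma norm_cis_minus_1_le: "norm (cis x - 1) \<le> \<bar>x\<bar>"
  using iexp_approx1[of x 0] by (simp add: cis_conv_exp)

text \<open>On the support, \<open>\<bar>\<xi> \<bullet> z\<bar>\<close> is at most
  \<open>norm \<xi> * \<epsilon>\<close>, and the exponential differs from 1 by no more than that.
  For shrinking bumps this gives pointwise convergence of the multipliers to 1.\<close>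

lemma norm_kernel_ft_minus_1_le:
  fixes k :: "'a::euclidean_space \<Rightarrow> real"
  assumes k: "\<And>z. k z \<ge> 0" "(\<integral>z. k z \<partial>lborel) = 1" "integrable lborel k"
    and supp: "\<And>z. norm z > \<epsilon> \<Longrightarrow> k z = 0"
  shows "norm (kernel_ft k \<xi> - 1) \<le> norm \<xi> * \<epsilon>"
proof -
  have [measurable]: "k \<in> borel_measurable borel" using borel_measurable_integrable[OF k(3)] by simp
  have i1: "integrable lborel (\<lambda>z. of_real (k z) * cis (- (\<xi> \<bullet> z)))"
    by (rule Bochner_Integration.integrable_bound[OF k(3)]) (auto simp: norm_mult)
  have i2: "integrable lborel (\<lambda>z. complex_of_real (k z))" using k(3) by simp
  have "kernel_ft k \<xi> - 1 = (\<integral>z. of_real (k z) * cis (- (\<xi> \<bullet> z)) \<partial>lborel) - (\<integral>z. complex_of_real (k z) \<partial>lborel)"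
    by (simp add: kernel_ft_def k(2))
  also have "\<dots> = (\<integral>z. of_real (k z) * (cis (- (\<xi> \<bullet> z)) - 1) \<partial>lborel)"
    using Bochner_Integration.integral_diff[OF i1 i2] by (simp only: right_diff_distrib mult_1_right)
  finally have "norm (kernel_ft k \<xi> - 1) = norm (\<integral>z. of_real (k z) * (cis (- (\<xi> \<bullet> z)) - 1) \<partial>lborel)"
    by simp
  also have "\<dots> \<le> (\<integral>z. norm (of_real (k z) * (cis (- (\<xi> \<bullet> z)) - 1)) \<partial>lborel)"
    by (rule integral_norm_bound)
  also have "\<dots> \<le> (\<integral>z. k z * (norm \<xi> * \<epsilon>) \<partial>lborel)"
  proof (rule integral_mono)
    show "integrable lborel (\<lambda>z. norm (of_real (k z) * (cis (- (\<xi> \<bullet> z)) - 1)))"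
      using integrable_norm[OF Bochner_Integration.integrable_diff[OF i1 i2]] by (simp add: right_diff_distrib)
    show "integrable lborel (\<lambda>z. k z * (norm \<xi> * \<epsilon>))" using k(3) by simp
    show "norm (of_real (k z) * (cis (- (\<xi> \<bullet> z)) - 1)) \<le> k z * (norm \<xi> * \<epsilon>)" for z
    proof (cases "norm z > \<epsilon>")
      case False
      have "norm (cis (- (\<xi> \<bullet> z)) - 1) \<le> \<bar>\<xi> \<bullet> z\<bar>" using norm_cis_minus_1_le[of "- (\<xi> \<bullet> z)"] by simp
      also have "\<dots> \<le> norm \<xi> * norm z" by (rule Cauchy_Schwarz_ineq2)
      also have "\<dots> \<le> norm \<xi> * \<epsilon>" using False by (intro mult_left_mono) auto
      finally show ?thesis using k(1)[of z] by (simp add: norm_mult mult_left_mono)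
    qed (simp add: supp)
  qed
  also have "\<dots> = norm \<xi> * \<epsilon>" using k(2) by simp
  finally show ?thesis .
qed

context borel_prob
begin

text \<open>The convolution theorem. Fubini applies because the integral of
  \<open>norm (?f y w)\<close> over \<open>w\<close> does not depend on \<open>y\<close>.\<close>

lemma
  assumes k: "k \<in> borel_measurable borel" "integrable lborel k"
  shows integrable_fourier_mollify: "integrable lborel (\<lambda>w. of_real (mollify k w) * cis (- (\<xi> \<bullet> w)))"
    and fourier_mollify: "(\<integral>w. of_real (mollify k w) * cis (- (\<xi> \<bullet> w)) \<partial>lborel) = kernel_ft k \<xi> * cnj (char_fun \<mu> \<xi>)"
proof -
  note k(1)[measurable]
  interpret P: pair_sigma_finite \<mu> lborel
    by (intro pair_sigma_finite.intro sigma_finite_measure_axioms sigma_finite_lborel)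
  let ?f = "\<lambda>y w. complex_of_real (k (w - y)) * cis (- (\<xi> \<bullet> w))"
  define h where "h = (\<lambda>z. complex_of_real (k z) * cis (- (\<xi> \<bullet> z)))"
  have h_meas: "h \<in> borel_measurable borel" unfolding h_def by measurable
  have h: "integrable lborel h"
    unfolding h_def by (rule Bochner_Integration.integrable_bound[OF k(2)]) (auto simp: norm_mult)
  have f: "?f y w = cis (- (\<xi> \<bullet> y)) * h (w - y)" for y w
    unfolding h_def by (simp add: inner_diff_right cis_mult mult.left_commute)
  have fi: "integrable lborel (?f y)" for y
    unfolding f using h by (simp add: lborel_integrable_translate[OF h_meas])
  have nf: "(\<integral>w. norm (?f y w) \<partial>lborel) = (\<integral>z. \<bar>k z\<bar> \<partial>lborel)" for y
    using lborel_integral_translate[of "\<lambda>z. \<bar>k z\<bar>" y] by (simp add: norm_mult)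
  have int: "integrable (\<mu> \<Otimes>\<^sub>M lborel) (case_prod ?f)"
  proof (rule P.Fubini_integrable)
    have meas: "measurable (\<mu> \<Otimes>\<^sub>M lborel) borel = measurable (borel \<Otimes>\<^sub>M borel) (borel :: complex measure)"
      by (intro measurable_cong_sets sets_pair_measure_cong sets_eq_borel sets_lborel refl)
    show "case_prod ?f \<in> borel_measurable (\<mu> \<Otimes>\<^sub>M lborel)" unfolding meas by measurable
    show "integrable \<mu> (\<lambda>y. \<integral>w. norm (case (y, w) of (y, w) \<Rightarrow> ?f y w) \<partial>lborel)"
      by (simp only: prod.case nf) simp
    show "AE y in \<mu>. integrable lborel (\<lambda>w. case (y, w) of (y, w) \<Rightarrow> ?f y w)"
      using fi by (intro AE_I2) simp
  qed
  have m: "(\<integral>y. ?f y w \<partial>\<mu>) = of_real (mollify k w) * cis (- (\<xi> \<bullet> w))" for w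
    unfolding mollify_def by simp
  show "integrable lborel (\<lambda>w. of_real (mollify k w) * cis (- (\<xi> \<bullet> w)))"
    using P.integrable_snd[OF int] unfolding m .
  have "(\<integral>w. of_real (mollify k w) * cis (- (\<xi> \<bullet> w)) \<partial>lborel) = (\<integral>y. (\<integral>w. ?f y w \<partial>lborel) \<partial>\<mu>)"
    using P.Fubini_integral[OF int] unfolding m .
  also have "\<dots> = (\<integral>y. cis (- (\<xi> \<bullet> y)) * kernel_ft k \<xi> \<partial>\<mu>)"
    unfolding f kernel_ft_def h_def[symmetric] using lborel_integral_translate[OF h_meas] by (simp add: h_def)
  also have "\<dots> = kernel_ft k \<xi> * cnj (char_fun \<mu> \<xi>)"
    unfolding cnj_char_fun by simp
  finally show "(\<integral>w. of_real (mollify k w) * cis (- (\<xi> \<bullet> w)) \<partial>lborel) = kernel_ft k \<xi> * cnj (char_fun \<mu> \<xi>)" .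
qed

text \<open>Mass starting in the ball of radius \<open>r\<close> and displaced by less than
  \<open>r\<close> stays in the ball of radius \<open>2 * r\<close>. The resulting lower bound is
  uniform over all kernels that keep mass at least \<open>c\<close> within distance
  \<open>r\<close>.\<close>

lemma mollify_mass_ball:
  assumes k: "continuous_on UNIV k" "\<And>z. \<bar>k z\<bar> \<le> B" "\<And>z. k z \<ge> 0"
    and c: "c \<le> (\<integral>\<^sup>+z. ennreal (k z) * indicator (ball 0 r) z \<partial>lborel)"
  shows "c * emeasure \<mu> (ball x r) \<le> (\<integral>\<^sup>+w. ennreal (mollify k w) * indicator (ball x (2 * r)) w \<partial>lborel)"
proof -
  have [measurable]: "k \<in> borel_measurable borel" by (rule borel_measurable_continuous_onI[OF k(1)])
  have [measurable]: "ball x r \<in> sets borel" for x :: 'a and r by simp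
  interpret P: pair_sigma_finite \<mu> lborel
    by (intro pair_sigma_finite.intro sigma_finite_measure_axioms sigma_finite_lborel)
  let ?f = "\<lambda>y w. ennreal (k (w - y)) * indicator (ball x (2 * r)) w"
  have meas: "measurable (\<mu> \<Otimes>\<^sub>M lborel) borel = measurable (borel \<Otimes>\<^sub>M borel) (borel :: ennreal measure)"
    by (intro measurable_cong_sets sets_pair_measure_cong sets_eq_borel sets_lborel refl)
  have fm: "case_prod ?f \<in> borel_measurable (\<mu> \<Otimes>\<^sub>M lborel)" unfolding meas by measurable
  have "c * emeasure \<mu> (ball x r) = (\<integral>\<^sup>+y. c * indicator (ball x r) y \<partial>\<mu>)"
    by (rule nn_integral_cmult_indicator[symmetric]) (simp add: sets_eq_borel)
  also have "\<dots> \<le> (\<integral>\<^sup>+y. (\<integral>\<^sup>+w. ?f y w \<partial>lborel) \<partial>\<mu>)"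
  proof (rule nn_integral_mono)
    fix y
    show "c * indicator (ball x r) y \<le> (\<integral>\<^sup>+w. ?f y w \<partial>lborel)"
    proof (cases "y \<in> ball x r")
      case True
      have "c \<le> (\<integral>\<^sup>+z. ennreal (k z) * indicator (ball 0 r) z \<partial>lborel)" by (rule c)
      also have "\<dots> = (\<integral>\<^sup>+w. ennreal (k (w - y)) * indicator (ball 0 r) (w - y) \<partial>lborel)"
        by (rule lborel_nn_integral_translate[symmetric]) measurable
      also have "\<dots> \<le> (\<integral>\<^sup>+w. ?f y w \<partial>lborel)"
      proof (intro nn_integral_mono mult_left_mono)
        fix w
        have "w \<in> ball x (2 * r)" if "w - y \<in> ball 0 r"
          using that True norm_triangle_ineq[of "w - y" "y - x"]
          by (simp add: dist_norm norm_minus_commute)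
        then show "(indicator (ball 0 r) (w - y) :: ennreal) \<le> indicator (ball x (2 * r)) w"
          by (auto split: split_indicator)
      qed simp
      finally show ?thesis using True by simp
    qed simp
  qed
  also have "\<dots> = (\<integral>\<^sup>+w. (\<integral>\<^sup>+y. ?f y w \<partial>\<mu>) \<partial>lborel)"
    by (rule P.Fubini'[OF fm, symmetric])
  also have "\<dots> = (\<integral>\<^sup>+w. ennreal (mollify k w) * indicator (ball x (2 * r)) w \<partial>lborel)"
  proof (rule nn_integral_cong)
    fix w
    have "(\<lambda>y. ennreal (k (w - y))) \<in> borel_measurable \<mu>" unfolding measurable_iff_borel by measurable
    then show "(\<integral>\<^sup>+y. ?f y w \<partial>\<mu>) = ennreal (mollify k w) * indicator (ball x (2 * r)) w"
      by (simp add: nn_integral_multc ennreal_mollify[OF k])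
  qed
  finally show ?thesis .
qed

end

section \<open>Compactly supported mollifiers\<close>

definition bump :: "real \<Rightarrow> 'a::euclidean_space \<Rightarrow> real" where
  "bump n z = exp_flat 0 (1 - n\<^sup>2 * (z \<bullet> z))"

lemma Ck_on_bump: "Ck_on m UNIV (bump n)"
  unfolding bump_def by (rule Ck_on_exp_flat_sphere)

lemma continuous_on_bump: "continuous_on UNIV (bump n)"
  using Ck_on_bump[of 0 n] by simp

lemma borel_measurable_bump [measurable]: "bump n \<in> borel_measurable borel"
  by (rule borel_measurable_continuous_onI[OF continuous_on_bump])

lemma bump_nonneg: "bump n z \<ge> 0"
  by (simp add: bump_def exp_flat_nonneg)

lemma bump_le_1: "bump n z \<le> 1"
  by (simp add: bump_def exp_flat_def)

text \<open>The parameter \<open>n\<close> is the inverse of the support radius, so that large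
  \<open>n\<close> means fine mollification.\<close>

lemma bump_eq_0: "n > 0 \<Longrightarrow> norm z \<ge> 1 / n \<Longrightarrow> bump n z = 0"
proof -
  assume n: "n > 0" "norm z \<ge> 1 / n"
  then have "1 \<le> n * norm z" by (simp add: field_simps)
  then have "1 * 1 \<le> (n * norm z) * (n * norm z)" by (intro mult_mono) auto
  then have "1 \<le> n\<^sup>2 * (z \<bullet> z)" by (simp add: dot_square_norm power2_eq_square mult_ac)
  then show ?thesis by (simp add: bump_def exp_flat_def)
qed

text \<open>At half the support radius the argument of \<open>exp_flat\<close> is still at least
  \<open>3 / 4\<close>, whose inverse is the constant \<open>4 / 3\<close>.\<close>

lemma bump_ge: "n > 0 \<Longrightarrow> norm z \<le> 1 / (2 * n) \<Longrightarrow> bump n z \<ge> exp (- (4 / 3))"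
proof -
  assume n: "n > 0" "norm z \<le> 1 / (2 * n)"
  then have "n * norm z \<le> 1 / 2" by (simp add: field_simps)
  then have "(n * norm z) * (n * norm z) \<le> 1 / 2 * (1 / 2)" using n by (intro mult_mono) auto
  then have t: "1 - n\<^sup>2 * (z \<bullet> z) \<ge> 3 / 4" by (simp add: dot_square_norm power2_eq_square mult_ac)
  then have "1 / (1 - n\<^sup>2 * (z \<bullet> z)) \<le> 1 / (3 / 4)" by (intro divide_left_mono) auto
  then show ?thesis using t by (simp add: bump_def exp_flat_def)
qed

lemma integrable_bump: "n > 0 \<Longrightarrow> integrable lborel (bump n :: 'a::euclidean_space \<Rightarrow> real)"
proof -
  assume n: "n > 0"
  have "integrable lborel (\<lambda>z. indicat_real (cball (0::'a) (1 / n)) z)"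
    by (rule integrable_real_indicator) (auto simp: emeasure_lborel_cball_finite[unfolded infinity_ennreal_def])
  then show ?thesis
  proof (rule Bochner_Integration.integrable_bound)
    show "AE z in lborel. norm (bump n z) \<le> norm (indicat_real (cball (0::'a) (1 / n)) z)"
    proof (rule AE_I2)
      fix z :: 'a
      show "norm (bump n z) \<le> norm (indicat_real (cball (0::'a) (1 / n)) z)"
      proof (cases "norm z \<le> 1 / n")
        case True
        then show ?thesis using bump_nonneg[of n z] bump_le_1[of n z] by simp
      next
        case False
        then show ?thesis using bump_eq_0[OF n, of z] by simp
      qed
    qed
  qed simp
qed

lemma integral_bump_ge:
  assumes n: "n > 0"
  shows "(\<integral>z. bump n (z::'a::euclidean_space) \<partial>lborel) \<ge> exp (- (4 / 3)) * ((1 / (2 * n)) ^ DIM('a) * measure lborel (ball (0::'a) 1))"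
proof -
  have "exp (- (4 / 3)) * measure lborel (ball (0::'a) (1 / (2 * n))) = (\<integral>z. exp (- (4 / 3)) * indicat_real (ball (0::'a) (1 / (2 * n))) z \<partial>lborel)"
    by simp
  also have "\<dots> \<le> (\<integral>z. bump n (z::'a) \<partial>lborel)"
  proof (rule integral_mono[OF _ integrable_bump[OF n]])
    show "integrable lborel (\<lambda>z. exp (- (4 / 3)) * indicat_real (ball (0::'a) (1 / (2 * n))) z)"
      by (intro integrable_mult_right integrable_real_indicator) (auto simp: emeasure_lborel_ball_finite[unfolded infinity_ennreal_def])
    show "exp (- (4 / 3)) * indicat_real (ball 0 (1 / (2 * n))) z \<le> bump n z" for z :: 'a
      using bump_ge[OF n, of z] bump_nonneg[of n z] by (auto split: split_indicator)
  qed
  finally show ?thesis using n by (subst (asm) content_ball_conv_unit_ball) auto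
qed

definition bump_kernel :: "real \<Rightarrow> 'a::euclidean_space \<Rightarrow> real" where
  "bump_kernel n z = bump n z / (\<integral>z. bump n (z::'a) \<partial>lborel)"

lemma integral_bump_pos: "n > 0 \<Longrightarrow> (\<integral>z. bump n (z::'a::euclidean_space) \<partial>lborel) > 0"
proof -
  assume n: "n > 0"
  have "measure lborel (ball (0::'a) 1) > 0" by (simp add: content_ball_pos)
  then have "exp (- (4 / 3)) * ((1 / (2 * n)) ^ DIM('a) * measure lborel (ball (0::'a) 1)) > 0" using n by simp
  then show ?thesis using integral_bump_ge[OF n, where 'a = 'a] by linarith
qed

lemma bump_kernel_nonneg: "n > 0 \<Longrightarrow> bump_kernel n z \<ge> 0"
  using integral_bump_pos[where n = n] by (simp add: bump_kernel_def bump_nonneg less_imp_le)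

lemma bump_kernel_eq_0: "n > 0 \<Longrightarrow> norm z \<ge> 1 / n \<Longrightarrow> bump_kernel n z = 0"
  by (simp add: bump_kernel_def bump_eq_0)

lemma integrable_bump_kernel: "n > 0 \<Longrightarrow> integrable lborel (bump_kernel n)"
  unfolding bump_kernel_def by (intro integrable_divide integrable_bump)

lemma integral_bump_kernel: "n > 0 \<Longrightarrow> (\<integral>z. bump_kernel n (z::'a::euclidean_space) \<partial>lborel) = 1"
  using integral_bump_pos[where n = n and 'a = 'a] by (simp add: bump_kernel_def)

lemma Ck_on_bump_kernel: "Ck_on m UNIV (bump_kernel n)"
  unfolding bump_kernel_def divide_inverse
  by (intro Ck_on_mult Ck_on_bump Ck_on_const)

lemma continuous_on_bump_kernel: "continuous_on UNIV (bump_kernel n)"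
  using Ck_on_bump_kernel[of 0 n] by simp

text \<open>The normalising integral is at least the volume of the half-size ball times a constant,
  hence of order \<open>1 / n ^ DIM('a)\<close>.\<close>

lemma bump_kernel_le:
  "\<exists>A>0. \<forall>n>0. \<forall>z::'a::euclidean_space. bump_kernel n z \<le> A * n ^ DIM('a)"
proof -
  define v where "v = exp (- (4 / 3)) * ((1 / 2) ^ DIM('a) * measure lborel (ball (0::'a) 1))"
  have v: "v > 0" unfolding v_def by (simp add: content_ball_pos)
  show ?thesis
  proof (intro exI[of _ "1 / v"] conjI allI impI)
    fix n :: real and z :: 'a assume n: "n > 0"
    have "v / n ^ DIM('a) \<le> (\<integral>z. bump n (z::'a) \<partial>lborel)"
      using integral_bump_ge[OF n, where 'a = 'a] by (simp add: v_def power_divide power_mult_distrib)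
    then have "bump_kernel n z \<le> 1 / (v / n ^ DIM('a))"
      unfolding bump_kernel_def using v n bump_le_1 bump_nonneg by (intro frac_le) auto
    then show "bump_kernel n z \<le> 1 / v * n ^ DIM('a)" by simp
  qed (use v in simp)
qed

lemma bump_kernel_mass:
  assumes n: "n > 0" "1 / n < r"
  shows "(\<integral>\<^sup>+z. ennreal (bump_kernel n (z::'a::euclidean_space)) * indicator (ball 0 r) z \<partial>lborel) = 1"
proof -
  have "(\<integral>\<^sup>+z. ennreal (bump_kernel n (z::'a)) * indicator (ball 0 r) z \<partial>lborel) = (\<integral>\<^sup>+z. ennreal (bump_kernel n (z::'a)) \<partial>lborel)"
  proof (rule nn_integral_cong)
    fix z :: 'a
    show "ennreal (bump_kernel n z) * indicator (ball 0 r) z = ennreal (bump_kernel n z)"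
      using bump_kernel_eq_0[OF n(1), of z] n(2) by (cases "norm z < r") simp_all
  qed
  also have "\<dots> = 1"
    using nn_integral_eq_integral[OF integrable_bump_kernel[OF n(1), where 'a = 'a] AE_I2[OF bump_kernel_nonneg[OF n(1)]]]
    by (simp add: integral_bump_kernel[OF n(1)])
  finally show ?thesis .
qed

text \<open>On the ball of radius \<open>sqrt t\<close> the kernel is at least
  \<open>exp (- (1 / 4))\<close> times its maximum; multiplied by the volume of that ball, the
  powers of \<open>t\<close> cancel.\<close>

lemma heat_kernel_mass:
  "\<exists>c>0. \<forall>t r. 0 < t \<longrightarrow> sqrt t \<le> r \<longrightarrow>
     ennreal c \<le> (\<integral>\<^sup>+z. ennreal (heat_kernel t (z::'a::euclidean_space)) * indicator (ball 0 r) z \<partial>lborel)"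
proof -
  define c where "c = (1 / (2 * sqrt pi)) ^ DIM('a) * exp (- (1 / 4)) * measure lborel (ball (0::'a) 1)"
  have "c > 0" unfolding c_def by (simp add: content_ball_pos)
  moreover have "ennreal c \<le> (\<integral>\<^sup>+z. ennreal (heat_kernel t (z::'a)) * indicator (ball 0 r) z \<partial>lborel)"
    if t: "t > 0" and r: "sqrt t \<le> r" for t r
  proof -
    define b where "b = (sqrt (pi / t) / (2 * pi)) ^ DIM('a) * exp (- (1 / 4))"
    have b: "b > 0" unfolding b_def using t by simp
    have "sqrt (pi / t) / (2 * pi) * sqrt t = 1 / (2 * sqrt pi)"
      using t by (simp add: real_sqrt_divide field_simps)
    then have "c = b * (sqrt t ^ DIM('a) * measure lborel (ball (0::'a) 1))"
      unfolding b_def c_def by (simp only: power_mult_distrib[symmetric] mult_ac) (simp add: power_mult_distrib[symmetric] mult_ac)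
    also have "\<dots> = b * measure lborel (ball (0::'a) (sqrt t))"
      using t by (subst content_ball_conv_unit_ball[of "sqrt t"]) auto
    finally have "ennreal c = ennreal b * emeasure lborel (ball (0::'a) (sqrt t))"
      using b emeasure_lborel_ball_finite[of "0::'a" "sqrt t"] by (simp add: ennreal_mult emeasure_eq_ennreal_measure)
    also have "\<dots> = (\<integral>\<^sup>+z. ennreal b * indicator (ball (0::'a) (sqrt t)) z \<partial>lborel)"
      by (rule nn_integral_cmult_indicator[symmetric]) simp
    also have "\<dots> \<le> (\<integral>\<^sup>+z. ennreal (heat_kernel t (z::'a)) * indicator (ball 0 r) z \<partial>lborel)"
    proof (rule nn_integral_mono)
      fix z :: 'a
      show "ennreal b * indicator (ball 0 (sqrt t)) z \<le> ennreal (heat_kernel t z) * indicator (ball 0 r) z"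
      proof (cases "z \<in> ball 0 (sqrt t)")
        case True
        then have "norm z * norm z \<le> sqrt t * sqrt t" using t by (intro mult_mono) auto
        then have "z \<bullet> z \<le> t" using t by (simp add: dot_square_norm power2_eq_square)
        then have "(z \<bullet> z) / (4 * t) \<le> 1 / 4" using t by (simp add: field_simps)
        then have "b \<le> heat_kernel t z" unfolding b_def heat_kernel_def using t by (intro mult_left_mono) auto
        then show ?thesis using True r by (simp add: ennreal_leI)
      qed simp
    qed
    finally show ?thesis .
  qed
  ultimately show ?thesis by blast
qed

section \<open>Sobolev norms of tensor products\<close>

definition sobolev_weight :: "'k::finite set \<Rightarrow> real \<Rightarrow> ('k \<Rightarrow> real ^ 'd::finite) \<Rightarrow> real" where
  "sobolev_weight S e \<xi> = (1 + (\<Sum>i\<in>S. (norm (\<xi> i))\<^sup>2)) powr e"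

text \<open>The Sobolev integral of a function of the frequency rather than of a distribution; it
  also measures the symbols on the dual side of a pairing.\<close>

definition weighted_sq :: "'k::finite set \<Rightarrow> real \<Rightarrow> (('k \<Rightarrow> real ^ 'd::finite) \<Rightarrow> complex) \<Rightarrow> ennreal" where
  "weighted_sq S e u = (\<integral>\<^sup>+\<xi>. ennreal (sobolev_weight S e \<xi> * (norm (u \<xi>))\<^sup>2) \<partial>block_lborel S)"

lemma sobolev_integral_eq: "sobolev_integral S r u = weighted_sq S r (fourier S u)"
  by (simp add: sobolev_integral_def weighted_sq_def sobolev_weight_def)

lemma sobolev_weight_pos: "sobolev_weight S e \<xi> > 0"
proof -
  have "0 \<le> (\<Sum>i\<in>S. (norm (\<xi> i))\<^sup>2)" by (intro sum_nonneg) auto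
  then have "1 + (\<Sum>i\<in>S. (norm (\<xi> i))\<^sup>2) > 0" by linarith
  then show ?thesis unfolding sobolev_weight_def by (simp only: powr_gt_zero)
qed

lemma measurable_block_component:
  assumes "i \<in> S" "u \<in> measurable borel N"
  shows "(\<lambda>\<xi>. u (\<xi> i)) \<in> measurable (block_lborel S :: ('k::finite \<Rightarrow> real ^ 'd::finite) measure) N"
proof (rule measurable_compose[OF measurable_component_singleton[OF assms(1)]])
  show "u \<in> measurable lborel N" using assms(2) by simp
qed

lemma borel_measurable_sobolev_weight [measurable]:
  "sobolev_weight S e \<in> borel_measurable (block_lborel S)"
proof -
  have "(\<lambda>\<xi>. (norm (\<xi> i :: real ^ 'b))\<^sup>2) \<in> borel_measurable (block_lborel S)" if "i \<in> S" for i
    by (rule measurable_block_component[OF that, of "\<lambda>x. (norm x)\<^sup>2"]) measurable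
  then have "(\<lambda>\<xi>. \<Sum>i\<in>S. (norm (\<xi> i :: real ^ 'b))\<^sup>2) \<in> borel_measurable (block_lborel S)"
    by (rule borel_measurable_sum)
  then show ?thesis unfolding sobolev_weight_def[abs_def] by measurable
qed

lemma borel_measurable_block_prod:
  fixes u :: "real ^ 'd::finite \<Rightarrow> complex"
  assumes "u \<in> borel_measurable borel"
  shows "(\<lambda>\<xi>. \<Prod>i\<in>S. u (\<xi> i)) \<in> borel_measurable (block_lborel (S :: 'k::finite set))"
  by (intro borel_measurable_prod measurable_block_component assms)

text \<open>The joint bracket dominates each single one, so with negative exponents the joint weight
  is the smaller. Thus order \<open>- a\<close> for each factor gives order
  \<open>- (a * card S)\<close> for the tensor product.\<close>

lemma sobolev_weight_le_prod:
  fixes a :: real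
  assumes a: "a \<ge> 0"
  shows "sobolev_weight S (- (a * card S)) \<xi> \<le> (\<Prod>i\<in>S. (1 + (norm (\<xi> i))\<^sup>2) powr (- a))"
proof -
  let ?u = "1 + (\<Sum>i\<in>S. (norm (\<xi> i))\<^sup>2)"
  have nn: "0 \<le> (\<Sum>i\<in>S. (norm (\<xi> i))\<^sup>2)" by (intro sum_nonneg) auto
  then have u: "?u > 0" by linarith
  have "?u powr (- (a * card S)) = (?u powr (- a)) ^ card S"
    using u by (simp add: powr_realpow[symmetric] powr_powr)
  also have "\<dots> = (\<Prod>i\<in>S. ?u powr (- a))" by simp
  also have "\<dots> \<le> (\<Prod>i\<in>S. (1 + (norm (\<xi> i))\<^sup>2) powr (- a))"
  proof (rule prod_mono)
    fix i assume i: "i \<in> S"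
    have "(norm (\<xi> i))\<^sup>2 \<le> (\<Sum>i\<in>S. (norm (\<xi> i))\<^sup>2)" by (rule member_le_sum[OF i]) auto
    then have "?u powr (- a) \<le> (1 + (norm (\<xi> i))\<^sup>2) powr (- a)"
      using a by (intro powr_mono2') (auto intro: add_pos_nonneg)
    then show "0 \<le> ?u powr (- a) \<and> ?u powr (- a) \<le> (1 + (norm (\<xi> i))\<^sup>2) powr (- a)" by simp
  qed
  finally show ?thesis unfolding sobolev_weight_def .
qed

lemma weighted_sq_tensor_finite:
  fixes h :: "real ^ 'd::finite \<Rightarrow> complex" and S :: "'k::finite set" and a :: real
  assumes a: "a \<ge> 0" and h: "h \<in> borel_measurable borel"
    and fin: "(\<integral>\<^sup>+x. ennreal ((1 + (norm x)\<^sup>2) powr (- a) * (norm (h x))\<^sup>2) \<partial>lborel) < \<infinity>"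
  shows "weighted_sq S (- (a * card S)) (\<lambda>\<xi>. \<Prod>i\<in>S. h (\<xi> i)) < \<infinity>"
proof -
  interpret product_sigma_finite "\<lambda>_::'k. lborel :: (real ^ 'd) measure" ..
  note h[measurable]
  have "weighted_sq S (- (a * card S)) (\<lambda>\<xi>. \<Prod>i\<in>S. h (\<xi> i))
      \<le> (\<integral>\<^sup>+\<xi>. (\<Prod>i\<in>S. ennreal ((1 + (norm (\<xi> i))\<^sup>2) powr (- a) * (norm (h (\<xi> i)))\<^sup>2)) \<partial>block_lborel S)"
    unfolding weighted_sq_def
  proof (rule nn_integral_mono)
    fix \<xi> :: "'k \<Rightarrow> real ^ 'd"
    have "sobolev_weight S (- (a * card S)) \<xi> * (norm (\<Prod>i\<in>S. h (\<xi> i)))\<^sup>2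
        \<le> (\<Prod>i\<in>S. (1 + (norm (\<xi> i))\<^sup>2) powr (- a)) * (\<Prod>i\<in>S. (norm (h (\<xi> i)))\<^sup>2)"
      using sobolev_weight_le_prod[OF a, of S \<xi>]
      by (simp add: prod_norm[symmetric] prod_power_distrib[symmetric] mult_right_mono)
    then show "ennreal (sobolev_weight S (- (a * card S)) \<xi> * (norm (\<Prod>i\<in>S. h (\<xi> i)))\<^sup>2)
        \<le> (\<Prod>i\<in>S. ennreal ((1 + (norm (\<xi> i))\<^sup>2) powr (- a) * (norm (h (\<xi> i)))\<^sup>2))"
      by (simp add: prod_ennreal prod.distrib[symmetric] ennreal_leI)
  qed
  also have "\<dots> = (\<Prod>i\<in>S. (\<integral>\<^sup>+x. ennreal ((1 + (norm x)\<^sup>2) powr (- a) * (norm (h x))\<^sup>2) \<partial>lborel))"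
    by (rule product_nn_integral_prod) auto
  also have "\<dots> < \<infinity>"
    using fin by (simp add: power_less_top_ennreal)
  finally show ?thesis .
qed

lemma norm_diff_sq_le: "(norm (x - y))\<^sup>2 \<le> 2 * (norm (x - z))\<^sup>2 + 2 * (norm (y - z))\<^sup>2"
  for x y z :: "'a::real_normed_vector"
proof -
  have "norm (x - y) \<le> norm (x - z) + norm (y - z)"
    using norm_triangle_ineq4[of "x - z" "y - z"] by simp
  then have "(norm (x - y))\<^sup>2 \<le> (norm (x - z) + norm (y - z))\<^sup>2" by (intro power_mono) auto
  also have "\<dots> \<le> 2 * (norm (x - z))\<^sup>2 + 2 * (norm (y - z))\<^sup>2"
    using zero_le_power2[of "norm (x - z) - norm (y - z)"] by (simp add: power2_eq_square algebra_simps)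
  finally show ?thesis .
qed

lemma weighted_sq_diff_le:
  assumes "u \<in> borel_measurable (block_lborel S)" "v \<in> borel_measurable (block_lborel S)" "w \<in> borel_measurable (block_lborel S)"
  shows "weighted_sq S e (\<lambda>\<xi>. u \<xi> - v \<xi>) \<le> 2 * weighted_sq S e (\<lambda>\<xi>. u \<xi> - w \<xi>) + 2 * weighted_sq S e (\<lambda>\<xi>. v \<xi> - w \<xi>)"
proof -
  note assms[measurable]
  have "weighted_sq S e (\<lambda>\<xi>. u \<xi> - v \<xi>) \<le> (\<integral>\<^sup>+\<xi>. 2 * ennreal (sobolev_weight S e \<xi> * (norm (u \<xi> - w \<xi>))\<^sup>2) +
      2 * ennreal (sobolev_weight S e \<xi> * (norm (v \<xi> - w \<xi>))\<^sup>2) \<partial>block_lborel S)"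
    unfolding weighted_sq_def
  proof (rule nn_integral_mono)
    fix \<xi>
    have "sobolev_weight S e \<xi> * (norm (u \<xi> - v \<xi>))\<^sup>2 \<le> sobolev_weight S e \<xi> * (2 * (norm (u \<xi> - w \<xi>))\<^sup>2 + 2 * (norm (v \<xi> - w \<xi>))\<^sup>2)"
      using sobolev_weight_pos[of S e \<xi>] norm_diff_sq_le by (intro mult_left_mono) auto
    also have "\<dots> = 2 * (sobolev_weight S e \<xi> * (norm (u \<xi> - w \<xi>))\<^sup>2) + 2 * (sobolev_weight S e \<xi> * (norm (v \<xi> - w \<xi>))\<^sup>2)"
      by (simp add: algebra_simps)
    finally have "ennreal (sobolev_weight S e \<xi> * (norm (u \<xi> - v \<xi>))\<^sup>2) \<le>
        ennreal (2 * (sobolev_weight S e \<xi> * (norm (u \<xi> - w \<xi>))\<^sup>2) + 2 * (sobolev_weight S e \<xi> * (norm (v \<xi> - w \<xi>))\<^sup>2))"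
      by (rule ennreal_leI)
    also have "\<dots> = 2 * ennreal (sobolev_weight S e \<xi> * (norm (u \<xi> - w \<xi>))\<^sup>2) + 2 * ennreal (sobolev_weight S e \<xi> * (norm (v \<xi> - w \<xi>))\<^sup>2)"
      using sobolev_weight_pos[of S e \<xi>] by (simp add: ennreal_plus ennreal_mult)
    finally show "ennreal (sobolev_weight S e \<xi> * (norm (u \<xi> - v \<xi>))\<^sup>2) \<le>
        2 * ennreal (sobolev_weight S e \<xi> * (norm (u \<xi> - w \<xi>))\<^sup>2) + 2 * ennreal (sobolev_weight S e \<xi> * (norm (v \<xi> - w \<xi>))\<^sup>2)" .
  qed
  also have "\<dots> = 2 * weighted_sq S e (\<lambda>\<xi>. u \<xi> - w \<xi>) + 2 * weighted_sq S e (\<lambda>\<xi>. v \<xi> - w \<xi>)"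
    unfolding weighted_sq_def by (simp add: nn_integral_add nn_integral_cmult)
  finally show ?thesis .
qed

section \<open>Convergence of regularised tensor symbols\<close>

context
  fixes h :: "real ^ 'd::finite \<Rightarrow> complex" and b :: "nat \<Rightarrow> real ^ 'd \<Rightarrow> complex" and a :: real
  assumes a: "a \<ge> 0" and h [measurable]: "h \<in> borel_measurable borel"
    and fin: "(\<integral>\<^sup>+x. ennreal ((1 + (norm x)\<^sup>2) powr (- a) * (norm (h x))\<^sup>2) \<partial>lborel) < \<infinity>"
    and b [measurable]: "\<And>m. b m \<in> borel_measurable borel"
    and b_le: "\<And>m x. norm (b m x) \<le> 1" and b_lim: "\<And>x. (\<lambda>m. b m x) \<longlonglongrightarrow> 1"
begin

lemma weighted_sq_tensor_le:
  fixes S :: "'k::finite set"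
  shows "weighted_sq S (- (a * card S)) (\<lambda>\<xi>. \<Prod>i\<in>S. b m (\<xi> i) * h (\<xi> i)) \<le>
    weighted_sq S (- (a * card S)) (\<lambda>\<xi>. \<Prod>i\<in>S. h (\<xi> i))"
  unfolding weighted_sq_def
proof (intro nn_integral_mono ennreal_leI mult_left_mono power_mono)
  fix \<xi> :: "'k \<Rightarrow> real ^ 'd"
  show "norm (\<Prod>i\<in>S. b m (\<xi> i) * h (\<xi> i)) \<le> norm (\<Prod>i\<in>S. h (\<xi> i))"
    unfolding prod_norm[symmetric] by (intro prod_mono) (simp add: norm_mult mult_left_le_one_le b_le)
qed (auto intro: less_imp_le sobolev_weight_pos)

text \<open>Dominated convergence: as the multipliers have norm at most 1, the squared difference is
  at most 4 times the square of the limit symbol, which is integrable against the weight.\<close>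

lemma weighted_sq_tensor_tendsto:
  fixes S :: "'k::finite set"
  shows "(\<lambda>m. weighted_sq S (- (a * card S)) (\<lambda>\<xi>. (\<Prod>i\<in>S. b m (\<xi> i) * h (\<xi> i)) - (\<Prod>i\<in>S. h (\<xi> i)))) \<longlonglongrightarrow> 0"
proof -
  let ?w = "\<lambda>\<xi>. sobolev_weight S (- (a * card S)) \<xi>"
  let ?P = "\<lambda>\<xi>. \<Prod>i\<in>S. h (\<xi> i)" and ?Pm = "\<lambda>m \<xi>. \<Prod>i\<in>S. b m (\<xi> i) * h (\<xi> i)"
  have m1: "?P \<in> borel_measurable (block_lborel S)" by (rule borel_measurable_block_prod) measurable
  have m2: "?Pm m \<in> borel_measurable (block_lborel S)" for m
    by (rule borel_measurable_block_prod[where u = "\<lambda>x. b m x * h x"]) measurable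
  note m1[measurable] m2[measurable]
  have le: "norm (?Pm m \<xi> - ?P \<xi>) \<le> 2 * norm (?P \<xi>)" for m \<xi>
  proof -
    have "norm (?Pm m \<xi>) \<le> norm (?P \<xi>)"
      unfolding prod_norm[symmetric] by (intro prod_mono) (simp add: norm_mult mult_left_le_one_le b_le)
    then show ?thesis using norm_triangle_ineq4[of "?Pm m \<xi>" "?P \<xi>"] by simp
  qed
  have "(\<lambda>m. \<integral>\<^sup>+\<xi>. ennreal (?w \<xi> * (norm (?Pm m \<xi> - ?P \<xi>))\<^sup>2) \<partial>block_lborel S) \<longlonglongrightarrow> (\<integral>\<^sup>+\<xi>. 0 \<partial>(block_lborel S :: ('k \<Rightarrow> real ^ 'd) measure))"
  proof (rule nn_integral_dominated_convergence[where u = "\<lambda>m \<xi>. ennreal (?w \<xi> * (norm (?Pm m \<xi> - ?P \<xi>))\<^sup>2)"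
      and u' = "\<lambda>_. 0" and w = "\<lambda>\<xi>. 4 * ennreal (?w \<xi> * (norm (?P \<xi>))\<^sup>2)"])
    show "AE \<xi> in block_lborel S. ennreal (?w \<xi> * (norm (?Pm m \<xi> - ?P \<xi>))\<^sup>2) \<le> 4 * ennreal (?w \<xi> * (norm (?P \<xi>))\<^sup>2)" for m
    proof (rule AE_I2)
      fix \<xi>
      have "(norm (?Pm m \<xi> - ?P \<xi>))\<^sup>2 \<le> (2 * norm (?P \<xi>))\<^sup>2" by (intro power_mono le) auto
      then have "?w \<xi> * (norm (?Pm m \<xi> - ?P \<xi>))\<^sup>2 \<le> ?w \<xi> * (2 * norm (?P \<xi>))\<^sup>2"
        using sobolev_weight_pos[of S _ \<xi>] by (intro mult_left_mono) (auto intro: less_imp_le)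
      also have "\<dots> = 4 * (?w \<xi> * (norm (?P \<xi>))\<^sup>2)" by (simp add: power_mult_distrib)
      finally have "ennreal (?w \<xi> * (norm (?Pm m \<xi> - ?P \<xi>))\<^sup>2) \<le> ennreal (4 * (?w \<xi> * (norm (?P \<xi>))\<^sup>2))"
        by (rule ennreal_leI)
      also have "\<dots> = 4 * ennreal (?w \<xi> * (norm (?P \<xi>))\<^sup>2)"
        by (subst ennreal_mult') simp_all
      finally show "ennreal (?w \<xi> * (norm (?Pm m \<xi> - ?P \<xi>))\<^sup>2) \<le> 4 * ennreal (?w \<xi> * (norm (?P \<xi>))\<^sup>2)" .
    qed
    show "(\<integral>\<^sup>+\<xi>. 4 * ennreal (?w \<xi> * (norm (?P \<xi>))\<^sup>2) \<partial>block_lborel S) < \<infinity>"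
      using weighted_sq_tensor_finite[OF a h fin, of S] unfolding weighted_sq_def
      by (subst nn_integral_cmult) (auto simp: ennreal_mult_less_top)
    show "AE \<xi> in block_lborel S. (\<lambda>m. ennreal (?w \<xi> * (norm (?Pm m \<xi> - ?P \<xi>))\<^sup>2)) \<longlonglongrightarrow> 0"
    proof (rule AE_I2)
      fix \<xi> :: "'k \<Rightarrow> real ^ 'd"
      have "(\<lambda>m. ?Pm m \<xi>) \<longlonglongrightarrow> (\<Prod>i\<in>S. 1 * h (\<xi> i))"
        by (intro tendsto_prod tendsto_mult b_lim tendsto_const)
      then have "(\<lambda>m. ?Pm m \<xi>) \<longlonglongrightarrow> ?P \<xi>" by simp
      then have "(\<lambda>m. ?w \<xi> * (norm (?Pm m \<xi> - ?P \<xi>))\<^sup>2) \<longlonglongrightarrow> ?w \<xi> * (norm (?P \<xi> - ?P \<xi>))\<^sup>2"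
        by (intro tendsto_mult tendsto_const tendsto_power tendsto_norm tendsto_diff)
      then have "(\<lambda>m. ennreal (?w \<xi> * (norm (?Pm m \<xi> - ?P \<xi>))\<^sup>2)) \<longlonglongrightarrow> ennreal (?w \<xi> * (norm (?P \<xi> - ?P \<xi>))\<^sup>2)"
        by (rule tendsto_ennrealI)
      then show "(\<lambda>m. ennreal (?w \<xi> * (norm (?Pm m \<xi> - ?P \<xi>))\<^sup>2)) \<longlonglongrightarrow> 0" by simp
    qed
  qed measurable
  then show ?thesis unfolding weighted_sq_def by simp
qed

text \<open>The Cauchy form is the usable one: the limit belongs to a tensor power of a measure, not
  in general to an element of \<open>block_Cc_infinity\<close>, to which the operator estimates
  refer.\<close>

lemma weighted_sq_tensor_Cauchy:
  fixes S :: "'k::finite set"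
  assumes e: "e > 0"
  shows "\<exists>M. \<forall>m\<ge>M. \<forall>n\<ge>M. weighted_sq S (- (a * card S))
    (\<lambda>\<xi>. (\<Prod>i\<in>S. b m (\<xi> i) * h (\<xi> i)) - (\<Prod>i\<in>S. b n (\<xi> i) * h (\<xi> i))) \<le> ennreal e"
proof -
  let ?P = "\<lambda>\<xi>. \<Prod>i\<in>S. h (\<xi> i)" and ?Pm = "\<lambda>m \<xi>. \<Prod>i\<in>S. b m (\<xi> i) * h (\<xi> i)"
  let ?W = "weighted_sq S (- (a * card S))"
  have m1: "?P \<in> borel_measurable (block_lborel S)" by (rule borel_measurable_block_prod) measurable
  have m2: "?Pm m \<in> borel_measurable (block_lborel S)" for m
    by (rule borel_measurable_block_prod[where u = "\<lambda>x. b m x * h x"]) measurable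
  have "\<forall>\<^sub>F m in sequentially. ?W (\<lambda>\<xi>. ?Pm m \<xi> - ?P \<xi>) < ennreal (e / 4)"
    using weighted_sq_tensor_tendsto[of S] e by (simp add: order_tendsto_iff)
  then obtain M where M: "?W (\<lambda>\<xi>. ?Pm m \<xi> - ?P \<xi>) < ennreal (e / 4)" if "m \<ge> M" for m
    by (auto simp: eventually_sequentially)
  show ?thesis
  proof (intro exI[of _ M] allI impI)
    fix m n assume mn: "M \<le> m" "M \<le> n"
    have "?W (\<lambda>\<xi>. ?Pm m \<xi> - ?Pm n \<xi>) \<le> 2 * ?W (\<lambda>\<xi>. ?Pm m \<xi> - ?P \<xi>) + 2 * ?W (\<lambda>\<xi>. ?Pm n \<xi> - ?P \<xi>)"
      by (rule weighted_sq_diff_le[OF m2 m2 m1])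
    also have "\<dots> \<le> 2 * ennreal (e / 4) + 2 * ennreal (e / 4)"
      by (intro add_mono mult_left_mono less_imp_le M mn) auto
    also have "\<dots> = ennreal (e / 2) + ennreal (e / 2)"
      using ennreal_mult'[of 2 "e / 4"] by simp
    also have "\<dots> = ennreal e"
      using e by (subst ennreal_plus[symmetric]) simp_all
    finally show "?W (\<lambda>\<xi>. ?Pm m \<xi> - ?Pm n \<xi>) \<le> ennreal e" .
  qed
qed

end

definition tensor :: "'k::finite set \<Rightarrow> ('v \<Rightarrow> real) \<Rightarrow> ('k \<Rightarrow> 'v) \<Rightarrow> complex" where
  "tensor S u w = (\<Prod>i\<in>S. complex_of_real (u (w i)))"

text \<open>Duality of the Sobolev orders \<open>e\<close> and \<open>- e\<close>: the square roots
  of the two weights multiply to 1, and Cauchy-Schwarz does the rest.\<close>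

lemma
  fixes G F :: "('k::finite \<Rightarrow> real ^ 'd::finite) \<Rightarrow> complex"
  assumes G: "G \<in> borel_measurable (block_lborel S)" and F: "F \<in> borel_measurable (block_lborel S)"
    and fin: "weighted_sq S (- e) G < \<infinity>" "weighted_sq S e F < \<infinity>"
  shows integrable_mult_weighted: "integrable (block_lborel S) (\<lambda>\<xi>. G \<xi> * F \<xi>)"
    and norm_integral_mult_le_weighted: "norm (\<integral>\<xi>. G \<xi> * F \<xi> \<partial>block_lborel S)
    \<le> sqrt (enn2real (weighted_sq S (- e) G)) * sqrt (enn2real (weighted_sq S e F))"
proof -
  note G[measurable] F[measurable]
  let ?A = "weighted_sq S (- e) G" and ?B = "weighted_sq S e F"
  let ?g = "\<lambda>\<xi>. ennreal (sqrt (sobolev_weight S (- e) \<xi>) * norm (G \<xi>))"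
  let ?f = "\<lambda>\<xi>. ennreal (sqrt (sobolev_weight S e \<xi>) * norm (F \<xi>))"
  have w: "sobolev_weight S (- e) \<xi> * sobolev_weight S e \<xi> = 1" for \<xi> :: "'k \<Rightarrow> real ^ 'd"
    using sobolev_weight_pos[of S e \<xi>] by (simp add: sobolev_weight_def powr_minus)
  have prod: "?g \<xi> * ?f \<xi> = ennreal (norm (G \<xi> * F \<xi>))" for \<xi>
  proof -
    have "sqrt (sobolev_weight S (- e) \<xi>) * sqrt (sobolev_weight S e \<xi>) = 1"
      using w[of \<xi>] by (simp add: real_sqrt_mult[symmetric])
    then have "sqrt (sobolev_weight S (- e) \<xi>) * norm (G \<xi>) * (sqrt (sobolev_weight S e \<xi>) * norm (F \<xi>)) = norm (G \<xi> * F \<xi>)"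
      by (metis (no_types, lifting) mult.assoc mult.commute mult.left_neutral norm_mult)
    then show ?thesis
      using sobolev_weight_pos[of S e \<xi>] sobolev_weight_pos[of S "- e" \<xi>]
      by (subst ennreal_mult[symmetric]) (auto intro!: mult_nonneg_nonneg less_imp_le)
  qed
  have sq: "(ennreal (sqrt (sobolev_weight S e' \<xi>) * norm z))\<^sup>2 = ennreal (sobolev_weight S e' \<xi> * (norm z)\<^sup>2)" for e' \<xi> and z :: complex
    using sobolev_weight_pos[of S e' \<xi>] by (simp add: ennreal_power power_mult_distrib)
  have "(\<integral>\<^sup>+\<xi>. ?g \<xi> * ?f \<xi> \<partial>block_lborel S)\<^sup>2 \<le> (\<integral>\<^sup>+\<xi>. (?g \<xi>)\<^sup>2 \<partial>block_lborel S) * (\<integral>\<^sup>+\<xi>. (?f \<xi>)\<^sup>2 \<partial>block_lborel S)"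
    by (rule Cauchy_Schwarz_nn_integral) measurable
  then have CS: "(\<integral>\<^sup>+\<xi>. ennreal (norm (G \<xi> * F \<xi>)) \<partial>block_lborel S)\<^sup>2 \<le> ?A * ?B"
    unfolding prod sq weighted_sq_def .
  also have "\<dots> = ennreal ((sqrt (enn2real ?A) * sqrt (enn2real ?B))\<^sup>2)"
    using fin by (simp add: power_mult_distrib ennreal_mult ennreal_enn2real)
  finally have CS': "(\<integral>\<^sup>+\<xi>. ennreal (norm (G \<xi> * F \<xi>)) \<partial>block_lborel S)\<^sup>2 \<le> ennreal ((sqrt (enn2real ?A) * sqrt (enn2real ?B))\<^sup>2)" .
  have "(\<integral>\<^sup>+\<xi>. ennreal (norm (G \<xi> * F \<xi>)) \<partial>block_lborel S)\<^sup>2 < \<infinity>"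
    using CS' by (rule le_less_trans) simp
  then have f: "(\<integral>\<^sup>+\<xi>. ennreal (norm (G \<xi> * F \<xi>)) \<partial>block_lborel S) < \<infinity>"
    by (simp add: power_less_top_ennreal)
  then show int: "integrable (block_lborel S) (\<lambda>\<xi>. G \<xi> * F \<xi>)"
    by (intro integrableI_bounded) auto
  have "(\<integral>\<^sup>+\<xi>. ennreal (norm (G \<xi> * F \<xi>)) \<partial>block_lborel S) = ennreal (\<integral>\<xi>. norm (G \<xi> * F \<xi>) \<partial>block_lborel S)"
    by (rule nn_integral_eq_integral[OF integrable_norm[OF int]]) simp
  then have "ennreal ((\<integral>\<xi>. norm (G \<xi> * F \<xi>) \<partial>block_lborel S)\<^sup>2) \<le> ennreal ((sqrt (enn2real ?A) * sqrt (enn2real ?B))\<^sup>2)"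
    using CS' by (simp add: ennreal_power)
  then have "(\<integral>\<xi>. norm (G \<xi> * F \<xi>) \<partial>block_lborel S)\<^sup>2 \<le> (sqrt (enn2real ?A) * sqrt (enn2real ?B))\<^sup>2"
    by (subst (asm) ennreal_le_iff) auto
  then have "(\<integral>\<xi>. norm (G \<xi> * F \<xi>) \<partial>block_lborel S) \<le> sqrt (enn2real ?A) * sqrt (enn2real ?B)"
    by (rule power2_le_imp_le) simp
  then show "norm (\<integral>\<xi>. G \<xi> * F \<xi> \<partial>block_lborel S) \<le> sqrt (enn2real ?A) * sqrt (enn2real ?B)"
    using integral_norm_bound[of "block_lborel S" "\<lambda>\<xi>. G \<xi> * F \<xi>"] by linarith
qed

section \<open>Generalized Radon transforms\<close>

lemma block_apply: "i \<in> S \<Longrightarrow> block S x i = x $ i"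
  by (simp add: block_def)

lemma tensor_block: "tensor S u (block S x) = (\<Prod>i\<in>S. complex_of_real (u (x $ i)))"
  unfolding tensor_def by (intro prod.cong) (simp_all add: block_apply)

lemma Ck_on_tensor_block:
  fixes u :: "real ^ 'd::finite \<Rightarrow> real" and S :: "'k::finite set"
  assumes "Ck_on n UNIV u"
  shows "Ck_on n UNIV (\<lambda>x :: real ^ 'd ^ 'k. tensor S u (block S x))"
  unfolding tensor_block
  by (intro Ck_on_prod Ck_on_bounded_linear_compose[OF bounded_linear_of_real]
      Ck_on_compose_bounded_linear[OF bounded_linear_vec_nth] assms)

lemma tensor_eq_0:
  assumes "\<And>x. norm x > R \<Longrightarrow> u x = 0" "tensor S u w \<noteq> 0" "i \<in> (S :: 'k::finite set)"
  shows "norm (w i) \<le> R"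
proof (rule ccontr)
  assume "\<not> ?thesis"
  then have "u (w i) = 0" by (intro assms(1)) simp
  then have "tensor S u w = 0" unfolding tensor_def using assms(3) by (intro prod_zero) auto
  with assms(2) show False by simp
qed

text \<open>Differences are treated separately since they are in general not tensors, and the
  operator estimate will be applied to them.\<close>

lemma tensor_in_block_Cc_infinity:
  fixes u v :: "real ^ 'd::finite \<Rightarrow> real" and S :: "'k::finite set"
  assumes u: "\<And>n. Ck_on n UNIV u" "\<And>x. norm x > R \<Longrightarrow> u x = 0"
    and v: "\<And>n. Ck_on n UNIV v" "\<And>x. norm x > R \<Longrightarrow> v x = 0"
  shows "tensor S u \<in> block_Cc_infinity S"
    and "(\<lambda>w. tensor S u w - tensor S v w) \<in> block_Cc_infinity S"
proof -
  have "\<exists>B. \<forall>w\<in>block_space S. tensor S u w \<noteq> 0 \<longrightarrow> (\<forall>i\<in>S. norm (w i) \<le> B)"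
    using tensor_eq_0[of R u S, OF u(2)] by blast
  then show "tensor S u \<in> block_Cc_infinity S"
    unfolding block_Cc_infinity_def smooth_on_def comp_def using Ck_on_tensor_block[OF u(1)] by blast
  have "\<forall>i\<in>S. norm (w i) \<le> R" if "tensor S u w - tensor S v w \<noteq> 0" for w
  proof
    fix i assume i: "i \<in> S"
    from that have "tensor S u w \<noteq> 0 \<or> tensor S v w \<noteq> 0" by auto
    then show "norm (w i) \<le> R"
      using tensor_eq_0[of R u S w i, OF u(2) _ i] tensor_eq_0[of R v S w i, OF v(2) _ i] by blast
  qed
  then have "\<exists>B. \<forall>w\<in>block_space S. tensor S u w - tensor S v w \<noteq> 0 \<longrightarrow> (\<forall>i\<in>S. norm (w i) \<le> B)"
    by blast
  moreover have "Ck_on n UNIV (\<lambda>x :: real ^ 'd ^ 'k. tensor S u (block S x) - tensor S v (block S x))" for n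
    using Ck_on_add[OF Ck_on_tensor_block[OF u(1)] Ck_on_minus[OF Ck_on_tensor_block[OF v(1)]], of n S S] by simp
  ultimately show "(\<lambda>w. tensor S u w - tensor S v w) \<in> block_Cc_infinity S"
    unfolding block_Cc_infinity_def smooth_on_def comp_def by blast
qed

lemma
  fixes \<mu> :: "(real ^ 'd::finite) measure" and S :: "'k::finite set"
  assumes \<mu>: "borel_prob \<mu>" and k: "k \<in> borel_measurable borel" "integrable lborel k"
  shows integrable_tensor_mollify:
      "integrable (block_lborel S) (\<lambda>w. tensor S (borel_prob.mollify \<mu> k) w * cis (- (\<Sum>i\<in>S. \<xi> i \<bullet> w i)))"
    and fourier_tensor_mollify:
      "fourier S (distr_of_fun S (tensor S (borel_prob.mollify \<mu> k))) \<xi>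
        = (\<Prod>i\<in>S. kernel_ft k (\<xi> i) * cnj (char_fun \<mu> (\<xi> i)))"
proof -
  interpret \<mu>: borel_prob \<mu> by (rule \<mu>)
  interpret product_sigma_finite "\<lambda>_::'k. lborel :: (real ^ 'd) measure" ..
  have eq: "tensor S (\<mu>.mollify k) w * cis (- (\<Sum>i\<in>S. \<xi> i \<bullet> w i))
      = (\<Prod>i\<in>S. of_real (\<mu>.mollify k (w i)) * cis (- (\<xi> i \<bullet> w i)))" for w
    unfolding tensor_def prod.distrib by (simp add: cis_sum flip: sum_negf)
  note i = \<mu>.integrable_fourier_mollify[OF k]
  show "integrable (block_lborel S) (\<lambda>w. tensor S (\<mu>.mollify k) w * cis (- (\<Sum>i\<in>S. \<xi> i \<bullet> w i)))"
    unfolding eq by (rule product_integrable_prod[OF finite i])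
  have "fourier S (distr_of_fun S (tensor S (\<mu>.mollify k))) \<xi>
      = (\<integral>w. (\<Prod>i\<in>S. of_real (\<mu>.mollify k (w i)) * cis (- (\<xi> i \<bullet> w i))) \<partial>block_lborel S)"
    unfolding fourier_def distr_of_fun_def eq ..
  also have "\<dots> = (\<Prod>i\<in>S. (\<integral>w. of_real (\<mu>.mollify k w) * cis (- (\<xi> i \<bullet> w)) \<partial>lborel))"
    by (rule product_integral_prod[OF finite i])
  also have "\<dots> = (\<Prod>i\<in>S. kernel_ft k (\<xi> i) * cnj (char_fun \<mu> (\<xi> i)))"
    unfolding \<mu>.fourier_mollify[OF k] ..
  finally show "fourier S (distr_of_fun S (tensor S (\<mu>.mollify k))) \<xi>
        = (\<Prod>i\<in>S. kernel_ft k (\<xi> i) * cnj (char_fun \<mu> (\<xi> i)))" .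
qed

text \<open>Explicit Fourier inversion for the left block. The Gaussian factor makes the symbol
  integrable, and \<open>char_fun\<close> occurs without conjugation because the inversion carries
  the sign of \<open>fourier\<close>.\<close>

lemma
  fixes \<mu> :: "(real ^ 'd::finite) measure" and S :: "'k::finite set"
  assumes \<mu>: "borel_prob \<mu>" and t: "t > 0"
  defines "G \<equiv> \<lambda>\<xi>. \<Prod>i\<in>S. of_real (exp (- t * (\<xi> i \<bullet> \<xi> i))) * (char_fun \<mu> (\<xi> i) / of_real ((2 * pi) ^ DIM(real ^ 'd)))"
  shows integrable_heat_symbol: "integrable (block_lborel S) G"
    and tensor_heat_eq: "tensor S (borel_prob.mollify \<mu> (heat_kernel t)) w
      = (\<integral>\<xi>. G \<xi> * cis (- (\<Sum>i\<in>S. \<xi> i \<bullet> w i)) \<partial>block_lborel S)"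
proof -
  interpret \<mu>: borel_prob \<mu> by (rule \<mu>)
  interpret product_sigma_finite "\<lambda>_::'k. lborel :: (real ^ 'd) measure" ..
  let ?c = "of_real ((2 * pi) ^ DIM(real ^ 'd)) :: complex"
  let ?g = "\<lambda>x. of_real (exp (- t * (x \<bullet> x))) * (char_fun \<mu> x / ?c)"
  have c: "?c \<noteq> 0" by simp
  have g0: "integrable lborel (\<lambda>x. of_real (exp (- t * (x \<bullet> x))) * char_fun \<mu> x)"
    by (rule Bochner_Integration.integrable_bound[OF integrable_gaussian[OF t]])
       (auto simp: norm_mult \<mu>.norm_char_fun_le_1)
  have g: "integrable lborel ?g"
    using integrable_divide[OF g0, of ?c] by simp
  have gc: "integrable lborel (\<lambda>x. ?g x * cis (- (x \<bullet> y)))" for y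
  proof (rule Bochner_Integration.integrable_bound[OF g])
    show "(\<lambda>x. ?g x * cis (- (x \<bullet> y))) \<in> borel_measurable lborel" by measurable
    show "AE x in lborel. norm (?g x * cis (- (x \<bullet> y))) \<le> norm (?g x)"
      by (intro AE_I2) (simp only: norm_mult norm_cis mult_1_right order_refl)
  qed
  show "integrable (block_lborel S) G"
    unfolding G_def by (rule product_integrable_prod[OF finite g])
  have eq: "G \<xi> * cis (- (\<Sum>i\<in>S. \<xi> i \<bullet> w i)) = (\<Prod>i\<in>S. ?g (\<xi> i) * cis (- (\<xi> i \<bullet> w i)))" for \<xi>
    unfolding G_def prod.distrib by (simp add: cis_sum flip: sum_negf)
  have "(\<integral>\<xi>. G \<xi> * cis (- (\<Sum>i\<in>S. \<xi> i \<bullet> w i)) \<partial>block_lborel S)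
      = (\<Prod>i\<in>S. (\<integral>x. ?g x * cis (- (x \<bullet> w i)) \<partial>lborel))"
    unfolding eq by (rule product_integral_prod[OF finite gc])
  also have "\<dots> = (\<Prod>i\<in>S. of_real (\<mu>.mollify (heat_kernel t) (w i)))"
  proof (rule prod.cong[OF refl])
    fix i
    have "(\<integral>x. ?g x * cis (- (x \<bullet> w i)) \<partial>lborel) = (\<integral>x. char_fun \<mu> x * of_real (exp (- t * (x \<bullet> x))) * cis (- (x \<bullet> w i)) / ?c \<partial>lborel)"
      by (intro Bochner_Integration.integral_cong) (simp_all add: mult_ac)
    also have "\<dots> = (\<integral>x. char_fun \<mu> x * of_real (exp (- t * (x \<bullet> x))) * cis (- (x \<bullet> w i)) \<partial>lborel) / ?c"
      by (rule integral_divide_zero)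
    also have "\<dots> = of_real (\<mu>.mollify (heat_kernel t) (w i))"
      unfolding \<mu>.fourier_heat_mollify[OF t] using c by (simp only: of_real_mult nonzero_mult_div_cancel_left[OF c])
    finally show "(\<integral>x. ?g x * cis (- (x \<bullet> w i)) \<partial>lborel) = of_real (\<mu>.mollify (heat_kernel t) (w i))" .
  qed
  finally show "tensor S (\<mu>.mollify (heat_kernel t)) w = (\<integral>\<xi>. G \<xi> * cis (- (\<Sum>i\<in>S. \<xi> i \<bullet> w i)) \<partial>block_lborel S)"
    unfolding tensor_def ..
qed

lemma integrable_of_compact_support:
  fixes h :: "'a::euclidean_space \<Rightarrow> 'b::{banach, second_countable_topology}"
  assumes \<nu>: "sets \<nu> = sets borel" "\<And>C. compact C \<Longrightarrow> emeasure \<nu> C < \<infinity>"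
    and h: "continuous_on UNIV h" "compact K" "\<And>x. x \<notin> K \<Longrightarrow> h x = 0"
  shows "integrable \<nu> h"
proof -
  have "compact (h ` K)" by (rule compact_continuous_image[OF continuous_on_subset[OF h(1)] h(2)]) simp
  then obtain B where B: "\<And>x. x \<in> K \<Longrightarrow> norm (h x) \<le> B"
    using compact_imp_bounded bounded_iff by (metis image_eqI)
  have K: "K \<in> sets \<nu>" using h(2) by (simp add: \<nu>(1) borel_compact)
  have "integrable \<nu> (\<lambda>x. B * indicat_real K x)"
    using K \<nu>(2)[OF h(2)] by (intro integrable_mult_right integrable_real_indicator)
  then show ?thesis
  proof (rule Bochner_Integration.integrable_bound)
    show "h \<in> borel_measurable \<nu>"
      unfolding measurable_cong_sets[OF \<nu>(1) refl] by (rule borel_measurable_continuous_onI[OF h(1)])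
    show "AE x in \<nu>. norm (h x) \<le> norm (B * indicat_real K x)"
    proof (rule AE_I2)
      fix x show "norm (h x) \<le> norm (B * indicat_real K x)"
        using B[of x] h(3)[of x] by (cases "x \<in> K") auto
    qed
  qed
qed

lemma sigma_finite_of_compact_finite:
  fixes \<nu> :: "'a::euclidean_space measure"
  assumes \<nu>: "sets \<nu> = sets borel" "\<And>C. compact C \<Longrightarrow> emeasure \<nu> C < \<infinity>"
  shows "sigma_finite_measure \<nu>"
proof
  have "(\<Union>n::nat. cball (0::'a) (real n)) = UNIV"
    using real_arch_simple by (auto simp: UN_iff)
  then show "\<exists>A. countable A \<and> A \<subseteq> sets \<nu> \<and> \<Union>A = space \<nu> \<and> (\<forall>a\<in>A. emeasure \<nu> a \<noteq> \<infinity>)"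
    using \<nu>(2)[OF compact_cball] sets_eq_imp_space_eq[OF \<nu>(1)]
    by (intro exI[of _ "range (\<lambda>n::nat. cball 0 (real n))"]) (auto simp: \<nu>(1) less_top)
qed

text \<open>A Parseval formula for the pairing: \<open>g\<close> is replaced by its inversion
  integral and the integrals are exchanged. Integrability of \<open>G\<close> and compact support of
  \<open>\<eta>\<close> are what permit this; \<open>g\<close> itself need not have compact
  support.\<close>

lemma radon_eq_fourier:
  fixes \<eta> :: "real ^ 'd::finite ^ 'k::finite \<Rightarrow> complex" and L :: "'k set"
  assumes \<nu>: "sets \<nu> = sets borel" "\<And>C. compact C \<Longrightarrow> emeasure \<nu> C < \<infinity>"
    and \<eta>: "continuous_on UNIV \<eta>" "compact K" "\<And>x. x \<notin> K \<Longrightarrow> \<eta> x = 0"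
    and f: "continuous_on UNIV (\<lambda>x :: real ^ 'd ^ 'k. f (block (- L) x))"
    and G: "integrable (block_lborel L) G"
    and g: "\<And>w. g w = (\<integral>\<xi>. G \<xi> * cis (- (\<Sum>i\<in>L. \<xi> i \<bullet> w i)) \<partial>block_lborel L)"
  shows "radon L \<eta> \<nu> f g = (\<integral>\<xi>. G \<xi> * fourier L (radon L \<eta> \<nu> f) \<xi> \<partial>block_lborel L)"
proof -
  interpret product_sigma_finite "\<lambda>_::'k. lborel :: (real ^ 'd) measure" ..
  let ?b = "\<lambda>\<xi> (x :: real ^ 'd ^ 'k). cis (- (\<Sum>i\<in>L. \<xi> i \<bullet> x $ i))"
  have blk: "(\<Sum>i\<in>L. \<xi> i \<bullet> block L x i) = (\<Sum>i\<in>L. \<xi> i \<bullet> x $ i)" for \<xi> and x :: "real ^ 'd ^ 'k"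
    by (intro sum.cong) (simp_all add: block_apply)
  have h: "integrable \<nu> (\<lambda>x. \<eta> x * f (block (- L) x))"
    by (rule integrable_of_compact_support[OF \<nu> _ \<eta>(2)]) (auto intro: continuous_on_mult \<eta>(1) f simp: \<eta>(3))
  have meas: "measurable (block_lborel L \<Otimes>\<^sub>M \<nu>) borel = measurable (block_lborel L \<Otimes>\<^sub>M borel) (borel :: complex measure)"
    by (intro measurable_cong_sets sets_pair_measure_cong \<nu>(1) refl)
  have comp: "(\<lambda>p. fst p i) \<in> borel_measurable ((block_lborel L :: ('k \<Rightarrow> real ^ 'd) measure) \<Otimes>\<^sub>M (borel :: (real ^ 'd ^ 'k) measure))" if "i \<in> L" for i
    by (rule measurable_compose[OF measurable_fst measurable_block_component[OF that]]) simp
  have vec: "(\<lambda>p. snd p $ i) \<in> borel_measurable ((block_lborel L :: ('k \<Rightarrow> real ^ 'd) measure) \<Otimes>\<^sub>M (borel :: (real ^ 'd ^ 'k) measure))" for i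
    by (rule measurable_compose[OF measurable_snd])
       (intro borel_measurable_continuous_onI linear_continuous_on bounded_linear_vec_nth)
  have "(\<lambda>p. cis (- (\<Sum>i\<in>L. fst p i \<bullet> snd p $ i))) \<in> borel_measurable ((block_lborel L :: ('k \<Rightarrow> real ^ 'd) measure) \<Otimes>\<^sub>M (borel :: (real ^ 'd ^ 'k) measure))"
    by (intro measurable_compose[OF _ borel_measurable_cis] borel_measurable_uminus borel_measurable_sum borel_measurable_inner comp vec)
  then have bm: "case_prod ?b \<in> borel_measurable (block_lborel L \<Otimes>\<^sub>M \<nu>)"
    unfolding meas by (simp add: case_prod_beta')
  have "radon L \<eta> \<nu> f g = (\<integral>x. (\<eta> x * f (block (- L) x)) * (\<integral>\<xi>. G \<xi> * ?b \<xi> x \<partial>block_lborel L) \<partial>\<nu>)"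
    unfolding radon_def g blk ..
  also have "\<dots> = (\<integral>\<xi>. G \<xi> * (\<integral>x. (\<eta> x * f (block (- L) x)) * ?b \<xi> x \<partial>\<nu>) \<partial>block_lborel L)"
  proof (rule integral_bounded_kernel_swap[symmetric, OF _ sigma_finite_of_compact_finite[OF \<nu>] G h bm])
    show "sigma_finite_measure (block_lborel L :: ('k \<Rightarrow> real ^ 'd) measure)" by (rule sigma_finite) simp
    show "norm (?b \<xi> x) \<le> 1" for \<xi> x by (subst norm_cis) (rule order_refl)
  qed
  also have "\<dots> = (\<integral>\<xi>. G \<xi> * fourier L (radon L \<eta> \<nu> f) \<xi> \<partial>block_lborel L)"
    unfolding fourier_def radon_def blk ..
  finally show ?thesis .
qed

text \<open>Linearity is not formal here, since a non-integrable integrand would have integral 0;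
  compact support of \<open>\<eta>\<close> and local finiteness of \<open>\<nu>\<close> supply
  integrability.\<close>

lemma fourier_radon_diff:
  fixes \<eta> :: "real ^ 'd::finite ^ 'k::finite \<Rightarrow> complex" and L :: "'k set"
  assumes \<nu>: "sets \<nu> = sets borel" "\<And>C. compact C \<Longrightarrow> emeasure \<nu> C < \<infinity>"
    and \<eta>: "continuous_on UNIV \<eta>" "compact K" "\<And>x. x \<notin> K \<Longrightarrow> \<eta> x = 0"
    and f1: "continuous_on UNIV (\<lambda>x :: real ^ 'd ^ 'k. f1 (block (- L) x))"
    and f2: "continuous_on UNIV (\<lambda>x :: real ^ 'd ^ 'k. f2 (block (- L) x))"
  shows "fourier L (radon L \<eta> \<nu> (\<lambda>w. f1 w - f2 w)) \<xi> = fourier L (radon L \<eta> \<nu> f1) \<xi> - fourier L (radon L \<eta> \<nu> f2) \<xi>"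
proof -
  let ?b = "\<lambda>x :: real ^ 'd ^ 'k. cis (- (\<Sum>i\<in>L. \<xi> i \<bullet> x $ i))"
  have blk: "(\<Sum>i\<in>L. \<xi> i \<bullet> block L x i) = (\<Sum>i\<in>L. \<xi> i \<bullet> x $ i)" for x :: "real ^ 'd ^ 'k"
    by (intro sum.cong) (simp_all add: block_apply)
  have b: "continuous_on UNIV ?b" by (intro continuous_intros)
  have i: "integrable \<nu> (\<lambda>x. \<eta> x * f (block (- L) x) * ?b x)"
    if "continuous_on UNIV (\<lambda>x :: real ^ 'd ^ 'k. f (block (- L) x))" for f
    by (rule integrable_of_compact_support[OF \<nu> _ \<eta>(2)]) (auto intro!: continuous_on_mult \<eta>(1) that b simp: \<eta>(3))
  have "fourier L (radon L \<eta> \<nu> (\<lambda>w. f1 w - f2 w)) \<xi> = (\<integral>x. \<eta> x * f1 (block (- L) x) * ?b x - \<eta> x * f2 (block (- L) x) * ?b x \<partial>\<nu>)"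
    unfolding fourier_def radon_def blk by (simp add: algebra_simps)
  also have "\<dots> = fourier L (radon L \<eta> \<nu> f1) \<xi> - fourier L (radon L \<eta> \<nu> f2) \<xi>"
    unfolding fourier_def radon_def blk by (rule Bochner_Integration.integral_diff[OF i[OF f1] i[OF f2]])
  finally show ?thesis .
qed

lemma continuous_of_block_Cc_infinity:
  fixes f :: "('k::finite \<Rightarrow> real ^ 'd::finite) \<Rightarrow> complex"
  assumes "f \<in> block_Cc_infinity S"
  shows "continuous_on UNIV (\<lambda>x :: real ^ 'd ^ 'k. f (block S x))"
proof -
  have "Ck_on 0 UNIV (f \<circ> (block S :: real ^ 'd ^ 'k \<Rightarrow> _))"
    using assms unfolding block_Cc_infinity_def smooth_on_def by blast
  then show ?thesis by (simp add: comp_def)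
qed

text \<open>Repackages the operator estimate on the Fourier side. The constant in
  \<open>sobolev_bounded\<close> carries no sign, hence the absolute value.\<close>

lemma sobolev_bounded_radonD:
  assumes "sobolev_bounded R L r s C A" "f \<in> block_Cc_infinity R" "sobolev_integral R r (distr_of_fun R f) \<le> ennreal b" and b: "b \<ge> 0"
  shows "fourier L (A f) \<in> borel_measurable (block_lborel L)" "weighted_sq L s (fourier L (A f)) < \<infinity>"
    "sqrt (enn2real (weighted_sq L s (fourier L (A f)))) \<le> \<bar>C\<bar> * sqrt b"
proof -
  have 1: "in_sobolev L s (A f)" "sobolev_norm L s (A f) \<le> C * sobolev_norm R r (distr_of_fun R f)"
    using assms(1,2) unfolding sobolev_bounded_def by blast+
  show "fourier L (A f) \<in> borel_measurable (block_lborel L)" "weighted_sq L s (fourier L (A f)) < \<infinity>"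
    using 1(1) unfolding in_sobolev_def sobolev_integral_eq by blast+
  have "sobolev_norm R r (distr_of_fun R f) \<le> sqrt b"
    using enn2real_leI[OF b assms(3)] by (simp add: sobolev_norm_def)
  moreover have "0 \<le> sobolev_norm R r (distr_of_fun R f)" by (simp add: sobolev_norm_def)
  ultimately have "C * sobolev_norm R r (distr_of_fun R f) \<le> \<bar>C\<bar> * sqrt b"
    by (intro mult_mono) auto
  then show "sqrt (enn2real (weighted_sq L s (fourier L (A f)))) \<le> \<bar>C\<bar> * sqrt b"
    using 1(2) unfolding sobolev_norm_def sobolev_integral_eq by linarith
qed

text \<open>With \<open>F\<close> the transform of the Radon image, the difference of pairings
  splits into \<open>G m\<close> against the difference of the \<open>F\<close> and the difference
  of the \<open>G\<close> against \<open>F\<close> of \<open>fs n\<close>. Each term is bounded by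
  duality, and uniformity in \<open>t\<close> comes from the single constant
  \<open>C\<close>.\<close>

lemma radon_uniform_Cauchy:
  fixes \<eta> :: "real ^ 'd::finite ^ 'k::finite \<Rightarrow> complex" and L :: "'k set"
    and fs gs G :: "nat \<Rightarrow> ('k \<Rightarrow> real ^ 'd) \<Rightarrow> complex" and \<nu> :: "'t \<Rightarrow> (real ^ 'd ^ 'k) measure"
  assumes \<nu>: "\<And>t. t \<in> V \<Longrightarrow> sets (\<nu> t) = sets borel" "\<And>t C. t \<in> V \<Longrightarrow> compact C \<Longrightarrow> emeasure (\<nu> t) C < \<infinity>"
    and \<eta>: "continuous_on UNIV \<eta>" "compact K" "\<And>x. x \<notin> K \<Longrightarrow> \<eta> x = 0"
    and fs: "\<And>n. fs n \<in> block_Cc_infinity (- L)" "\<And>m n. (\<lambda>w. fs m w - fs n w) \<in> block_Cc_infinity (- L)"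
    and fsB: "\<And>n. sobolev_integral (- L) r (distr_of_fun (- L) (fs n)) \<le> ennreal B"
    and fsC: "\<And>e. e > 0 \<Longrightarrow> \<exists>M. \<forall>m\<ge>M. \<forall>n\<ge>M. sobolev_integral (- L) r (distr_of_fun (- L) (\<lambda>w. fs m w - fs n w)) \<le> ennreal e"
    and G: "\<And>n. integrable (block_lborel L) (G n)"
    and gs: "\<And>n w. gs n w = (\<integral>\<xi>. G n \<xi> * cis (- (\<Sum>i\<in>L. \<xi> i \<bullet> w i)) \<partial>block_lborel L)"
    and GB: "\<And>n. weighted_sq L (- s) (G n) \<le> ennreal B"
    and GC: "\<And>e. e > 0 \<Longrightarrow> \<exists>M. \<forall>m\<ge>M. \<forall>n\<ge>M. weighted_sq L (- s) (\<lambda>\<xi>. G m \<xi> - G n \<xi>) \<le> ennreal e"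
    and est: "\<And>t. t \<in> V \<Longrightarrow> sobolev_bounded (- L) L r s C (radon L \<eta> (\<nu> t))"
    and B: "B \<ge> 0" and e: "e > 0"
  shows "\<exists>M. \<forall>m\<ge>M. \<forall>n\<ge>M. \<forall>t\<in>V. norm (radon L \<eta> (\<nu> t) (fs m) (gs m) - radon L \<eta> (\<nu> t) (fs n) (gs n)) \<le> e"
proof -
  \<comment> \<open>The two terms of the splitting contribute \<open>\<bar>C\<bar> * sqrt B\<close>
    each; the added 1 allows division by \<open>c\<close>. The next constant is squared because
    \<open>weighted_sq\<close> is a squared norm.\<close>
  define c where "c = 2 * \<bar>C\<bar> * sqrt B + 1"
  have c: "c > 0" using B by (simp add: c_def add_nonneg_pos)
  define d where "d = (e / c)\<^sup>2"
  have d: "d > 0" "sqrt d = e / c" using e c by (simp_all add: d_def)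
  obtain M1 where M1: "\<And>m n. m \<ge> M1 \<Longrightarrow> n \<ge> M1 \<Longrightarrow> sobolev_integral (- L) r (distr_of_fun (- L) (\<lambda>w. fs m w - fs n w)) \<le> ennreal d"
    using fsC[OF d(1)] by blast
  obtain M2 where M2: "\<And>m n. m \<ge> M2 \<Longrightarrow> n \<ge> M2 \<Longrightarrow> weighted_sq L (- s) (\<lambda>\<xi>. G m \<xi> - G n \<xi>) \<le> ennreal d"
    using GC[OF d(1)] by blast
  show ?thesis
  proof (intro exI[of _ "max M1 M2"] allI impI ballI)
    fix m n t assume m: "max M1 M2 \<le> m" and n: "max M1 M2 \<le> n" and t: "t \<in> V"
    let ?F = "\<lambda>f. fourier L (radon L \<eta> (\<nu> t) f)"
    note cont = continuous_of_block_Cc_infinity[OF fs(1)]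
    note E = sobolev_bounded_radonD[OF est[OF t]]
    note En = E[OF fs(1) fsB B]
    have Md: "sobolev_integral (- L) r (distr_of_fun (- L) (\<lambda>w. fs m w - fs n w)) \<le> ennreal d"
      using M1 m n by simp
    note Ed = E[OF fs(2) Md less_imp_le[OF d(1)]]
    have Gd: "weighted_sq L (- s) (\<lambda>\<xi>. G m \<xi> - G n \<xi>) \<le> ennreal d" using M2 m n by simp
    have Gm: "G n \<in> borel_measurable (block_lborel L)" for n using G[of n] by simp
    have Gdm: "(\<lambda>\<xi>. G m \<xi> - G n \<xi>) \<in> borel_measurable (block_lborel L)" using Gm by simp
    have fin1: "weighted_sq L (- s) (G k) < \<infinity>" for k using GB[of k] by (rule le_less_trans) simp
    have fin2: "weighted_sq L (- s) (\<lambda>\<xi>. G m \<xi> - G n \<xi>) < \<infinity>" using Gd by (rule le_less_trans) simp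
    have diff: "?F (\<lambda>w. fs m w - fs n w) \<xi> = ?F (fs m) \<xi> - ?F (fs n) \<xi>" for \<xi>
      by (rule fourier_radon_diff[OF \<nu>(1)[OF t] \<nu>(2)[OF t] \<eta> cont cont])
    have rad: "radon L \<eta> (\<nu> t) (fs k) (gs k) = (\<integral>\<xi>. G k \<xi> * ?F (fs k) \<xi> \<partial>block_lborel L)" for k
      by (rule radon_eq_fourier[OF \<nu>(1)[OF t] \<nu>(2)[OF t] \<eta> cont G gs])
    have "radon L \<eta> (\<nu> t) (fs m) (gs m) - radon L \<eta> (\<nu> t) (fs n) (gs n)
        = (\<integral>\<xi>. G m \<xi> * ?F (fs m) \<xi> \<partial>block_lborel L) - (\<integral>\<xi>. G n \<xi> * ?F (fs n) \<xi> \<partial>block_lborel L)"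
      by (simp only: rad)
    also have "\<dots> = (\<integral>\<xi>. G m \<xi> * ?F (fs m) \<xi> - G n \<xi> * ?F (fs n) \<xi> \<partial>block_lborel L)"
      by (intro Bochner_Integration.integral_diff[symmetric] integrable_mult_weighted[OF Gm En(1) fin1 En(2)])
    also have "\<dots> = (\<integral>\<xi>. G m \<xi> * ?F (\<lambda>w. fs m w - fs n w) \<xi> + (G m \<xi> - G n \<xi>) * ?F (fs n) \<xi> \<partial>block_lborel L)"
      unfolding diff by (simp add: algebra_simps)
    also have "\<dots> = (\<integral>\<xi>. G m \<xi> * ?F (\<lambda>w. fs m w - fs n w) \<xi> \<partial>block_lborel L) + (\<integral>\<xi>. (G m \<xi> - G n \<xi>) * ?F (fs n) \<xi> \<partial>block_lborel L)"
      by (intro Bochner_Integration.integral_add integrable_mult_weighted[OF Gm Ed(1) fin1 Ed(2)]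
          integrable_mult_weighted[OF Gdm En(1) fin2 En(2)])
    finally have "norm (radon L \<eta> (\<nu> t) (fs m) (gs m) - radon L \<eta> (\<nu> t) (fs n) (gs n))
        \<le> norm (\<integral>\<xi>. G m \<xi> * ?F (\<lambda>w. fs m w - fs n w) \<xi> \<partial>block_lborel L) + norm (\<integral>\<xi>. (G m \<xi> - G n \<xi>) * ?F (fs n) \<xi> \<partial>block_lborel L)"
      by (simp only: norm_triangle_ineq)
    also have "norm (\<integral>\<xi>. G m \<xi> * ?F (\<lambda>w. fs m w - fs n w) \<xi> \<partial>block_lborel L)
        \<le> sqrt (enn2real (weighted_sq L (- s) (G m))) * sqrt (enn2real (weighted_sq L s (?F (\<lambda>w. fs m w - fs n w))))"
      by (rule norm_integral_mult_le_weighted[OF Gm Ed(1) fin1 Ed(2)])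
    also have "\<dots> \<le> sqrt B * (\<bar>C\<bar> * sqrt d)"
      using enn2real_leI[OF B GB] B by (intro mult_mono Ed(3)) auto
    also have "norm (\<integral>\<xi>. (G m \<xi> - G n \<xi>) * ?F (fs n) \<xi> \<partial>block_lborel L)
        \<le> sqrt (enn2real (weighted_sq L (- s) (\<lambda>\<xi>. G m \<xi> - G n \<xi>))) * sqrt (enn2real (weighted_sq L s (?F (fs n))))"
      by (rule norm_integral_mult_le_weighted[OF Gdm En(1) fin2 En(2)])
    also have "\<dots> \<le> sqrt d * (\<bar>C\<bar> * sqrt B)"
      using enn2real_leI[OF less_imp_le[OF d(1)] Gd] d(1) by (intro mult_mono En(3)) auto
    also have "sqrt B * (\<bar>C\<bar> * sqrt d) + sqrt d * (\<bar>C\<bar> * sqrt B) = (2 * \<bar>C\<bar> * sqrt B) * (e / c)"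
      unfolding d(2) by simp
    also have "\<dots> \<le> c * (e / c)" using e c by (intro mult_right_mono) (auto simp: c_def)
    also have "\<dots> = e" using c by simp
    finally show "norm (radon L \<eta> (\<nu> t) (fs m) (gs m) - radon L \<eta> (\<nu> t) (fs n) (gs n)) \<le> e" by simp
  qed
qed

section \<open>Mollified product measures\<close>

lemma borel_measurable_vec_lambda:
  "(\<lambda>f. (\<chi> i. f i) :: real ^ 'd::finite ^ 'k::finite) \<in> borel_measurable (PiM UNIV (\<lambda>_. lborel))"
proof (subst borel_measurable_euclidean_space, rule ballI)
  fix b :: "real ^ 'd ^ 'k" assume "b \<in> Basis"
  then obtain i c where b: "b = axis i c" by (auto simp: Basis_vec_def)
  have "(\<lambda>f. f i \<bullet> c) \<in> borel_measurable (PiM UNIV (\<lambda>_. lborel))"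
    by (rule measurable_compose[OF measurable_component_singleton]) auto
  then show "(\<lambda>f. ((\<chi> i. f i) :: real ^ 'd ^ 'k) \<bullet> b) \<in> borel_measurable (PiM UNIV (\<lambda>_. lborel))"
    by (simp add: b inner_axis)
qed

text \<open>A box in the space of configurations is a product of boxes in the factors, and Lebesgue
  measure is determined by its values on boxes. This makes integrals of product functions
  factor.\<close>

lemma lborel_vec_eq:
  "(lborel :: (real ^ 'd::finite ^ 'k::finite) measure) = distr (PiM UNIV (\<lambda>_. lborel)) borel (\<lambda>f. \<chi> i. f i)"
proof (rule lborel_eqI)
  interpret product_sigma_finite "\<lambda>_::'k. lborel :: (real ^ 'd) measure" ..
  let ?P = "PiM UNIV (\<lambda>_::'k. lborel :: (real ^ 'd) measure)"
  let ?v = "\<lambda>f. (\<chi> i. f i) :: real ^ 'd ^ 'k"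
  note meas = borel_measurable_vec_lambda[where 'd = 'd and 'k = 'k]
  fix l u :: "real ^ 'd ^ 'k" assume lu: "\<And>b. b \<in> Basis \<Longrightarrow> l \<bullet> b \<le> u \<bullet> b"
  have lu': "l $ i \<bullet> c \<le> u $ i \<bullet> c" if "c \<in> Basis" for i c
    using lu[of "axis i c"] that by (simp add: inner_axis axis_in_Basis_iff)
  have box: "?v -` box l u \<inter> space ?P = PiE UNIV (\<lambda>i. box (l $ i) (u $ i))"
  proof -
    have "?v f \<in> box l u \<longleftrightarrow> (\<forall>i. f i \<in> box (l $ i) (u $ i))" for f
      unfolding mem_box Basis_vec_def by (auto simp: inner_axis)
    then show ?thesis by (auto simp: space_PiM PiE_def Pi_def)
  qed
  have "emeasure (distr ?P borel ?v) (box l u) = emeasure ?P (PiE UNIV (\<lambda>i. box (l $ i) (u $ i)))"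
    unfolding box[symmetric] by (rule emeasure_distr[OF meas]) simp
  also have "\<dots> = (\<Prod>i\<in>UNIV. emeasure lborel (box (l $ i) (u $ i)))"
    by (rule emeasure_PiM) auto
  also have "\<dots> = (\<Prod>i\<in>UNIV. ennreal (\<Prod>c\<in>Basis. (u $ i - l $ i) \<bullet> c))"
    using lu' by (intro prod.cong refl emeasure_lborel_box) auto
  also have "\<dots> = ennreal (\<Prod>i\<in>UNIV. \<Prod>c\<in>Basis. (u $ i - l $ i) \<bullet> c)"
    using lu' by (intro prod_ennreal prod_nonneg) (auto simp: inner_diff_left)
  also have "(\<Prod>i\<in>UNIV. \<Prod>c\<in>Basis. (u $ i - l $ i) \<bullet> c) = (\<Prod>(i, c)\<in>UNIV \<times> Basis. (u - l) \<bullet> axis i c)"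
    by (simp add: prod.cartesian_product inner_axis)
  also have "\<dots> = (\<Prod>b\<in>Basis. (u - l) \<bullet> b)"
  proof -
    have img: "(Basis :: (real ^ 'd ^ 'k) set) = (\<lambda>(i, c). axis i c) ` (UNIV \<times> Basis)"
      by (auto simp: Basis_vec_def)
    have inj: "inj_on (\<lambda>(i, c). axis i c :: real ^ 'd ^ 'k) (UNIV \<times> Basis)"
      by (auto simp: inj_on_def axis_eq_axis nonzero_Basis)
    show ?thesis unfolding img prod.reindex[OF inj] by (intro prod.cong) auto
  qed
  finally show "emeasure (distr ?P borel ?v) (box l u) = (\<Prod>b\<in>Basis. (u - l) \<bullet> b)" .
qed simp

lemma nn_integral_lborel_vec_prod:
  fixes u :: "'k::finite \<Rightarrow> real ^ 'd::finite \<Rightarrow> ennreal"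
  assumes u: "\<And>i. u i \<in> borel_measurable borel"
  shows "(\<integral>\<^sup>+x. (\<Prod>i\<in>UNIV. u i (x $ i)) \<partial>(lborel :: (real ^ 'd ^ 'k) measure)) = (\<Prod>i\<in>UNIV. (\<integral>\<^sup>+x. u i x \<partial>lborel))"
proof -
  interpret product_sigma_finite "\<lambda>_::'k. lborel :: (real ^ 'd) measure" ..
  let ?P = "PiM UNIV (\<lambda>_::'k. lborel :: (real ^ 'd) measure)"
  let ?v = "\<lambda>f. (\<chi> i. f i) :: real ^ 'd ^ 'k"
  note meas = borel_measurable_vec_lambda[where 'd = 'd and 'k = 'k]
  have nth: "(\<lambda>x :: real ^ 'd ^ 'k. x $ i) \<in> borel_measurable borel" for i
    by (intro borel_measurable_continuous_onI linear_continuous_on bounded_linear_vec_nth)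
  have m: "(\<lambda>x :: real ^ 'd ^ 'k. \<Prod>i\<in>UNIV. u i (x $ i)) \<in> borel_measurable borel"
    by (intro borel_measurable_prod_ennreal measurable_compose[OF nth u])
  have "(\<integral>\<^sup>+x. (\<Prod>i\<in>UNIV. u i (x $ i)) \<partial>(lborel :: (real ^ 'd ^ 'k) measure)) = (\<integral>\<^sup>+f. (\<Prod>i\<in>UNIV. u i (f i)) \<partial>?P)"
    unfolding lborel_vec_eq by (subst nn_integral_distr[OF meas]) (use m in simp_all)
  also have "\<dots> = (\<Prod>i\<in>UNIV. (\<integral>\<^sup>+x. u i x \<partial>lborel))"
    by (rule product_nn_integral_prod) (auto intro: u)
  finally show ?thesis .
qed

lemma Ck_on_translate:
  fixes f :: "'a::euclidean_space \<Rightarrow> 'b::euclidean_space"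
  shows "Ck_on n UNIV f \<Longrightarrow> Ck_on n UNIV (\<lambda>x. f (x - c))"
proof (induction n arbitrary: f)
  case 0
  then have "continuous_on UNIV f" by simp
  then have "continuous_on UNIV (\<lambda>x. f (x - c))"
    by (rule continuous_on_compose2[where f = "\<lambda>x. x - c"]) (auto intro!: continuous_intros)
  then show ?case by simp
next
  case (Suc n)
  note D = Ck_on_Suc_derivative[OF Suc.prems]
  show ?case
  proof (rule Ck_on_SucI)
    have "((\<lambda>x. x - c) has_derivative (\<lambda>v. v)) (at x)" for x
      by (auto intro!: derivative_eq_intros)
    from has_derivative_compose[OF this D(1)]
    show "((\<lambda>x. f (x - c)) has_derivative (\<lambda>v. frechet_derivative f (at (x - c)) v)) (at x)" for x .
    show "Ck_on n UNIV (\<lambda>x. frechet_derivative f (at (x - c)) v)" for v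
      by (rule Suc.IH[OF D(2)])
  qed
qed

lemma bump_in_Cc_infinity:
  fixes x0 :: "'a::euclidean_space"
  assumes n: "n > 0" and U: "cball x0 (1 / n) \<subseteq> U"
  shows "(\<lambda>x. complex_of_real (bump n (x - x0))) \<in> Cc_infinity U"
proof -
  have "{x. complex_of_real (bump n (x - x0)) \<noteq> 0} \<subseteq> cball x0 (1 / n)"
  proof
    fix x assume "x \<in> {x. complex_of_real (bump n (x - x0)) \<noteq> 0}"
    then have "\<not> norm (x - x0) \<ge> 1 / n" using bump_eq_0[OF n, of "x - x0"] by auto
    then show "x \<in> cball x0 (1 / n)" by (simp add: dist_norm norm_minus_commute)
  qed
  then have c: "closure {x. complex_of_real (bump n (x - x0)) \<noteq> 0} \<subseteq> cball x0 (1 / n)"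
    by (rule closure_minimal) simp
  then have "bounded (closure {x. complex_of_real (bump n (x - x0)) \<noteq> 0})"
    by (rule bounded_subset[OF bounded_cball])
  moreover have "Ck_on m UNIV (\<lambda>x. complex_of_real (bump n (x - x0)))" for m
    by (intro Ck_on_bounded_linear_compose[OF bounded_linear_of_real] Ck_on_translate Ck_on_bump)
  ultimately show ?thesis
    unfolding Cc_infinity_def smooth_on_def using c U by (auto simp: compact_eq_bounded_closed)
qed

context borel_prob
begin

definition smooth_approx :: "nat \<Rightarrow> 'a \<Rightarrow> real" where
  "smooth_approx m = mollify (bump_kernel (Suc m))"

text \<open>The time is the square of the bump radius, so both mollifiers act on the length scale
  \<open>1 / Suc m\<close>.\<close>

definition heat_approx :: "nat \<Rightarrow> 'a \<Rightarrow> real" where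
  "heat_approx m = mollify (heat_kernel (1 / (real (Suc m))\<^sup>2))"

lemma heat_time_pos: "1 / (real (Suc m))\<^sup>2 > 0"
  by simp

lemma abs_bump_kernel_le: "\<exists>B. \<forall>z::'a. \<bar>bump_kernel (Suc m) z\<bar> \<le> B"
proof -
  obtain A where A: "\<forall>n>0. \<forall>z::'a. bump_kernel n z \<le> A * n ^ DIM('a)"
    using bump_kernel_le by blast
  have "\<bar>bump_kernel (Suc m) z\<bar> \<le> A * real (Suc m) ^ DIM('a)" for z :: 'a
    using A[rule_format, of "real (Suc m)" z] bump_kernel_nonneg[of "real (Suc m)" z] by simp
  then show ?thesis by blast
qed

lemma Ck_on_smooth_approx: "Ck_on n UNIV (smooth_approx m)"
  unfolding smooth_approx_def mollify_def
proof (rule Ck_on_convolution[OF finite_measure_axioms sets_eq_borel Ck_on_bump_kernel])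
  show "bump_kernel (Suc m) x = 0" if "norm x > 1 / real (Suc m)" for x :: 'a
    using that by (intro bump_kernel_eq_0) auto
qed

lemma continuous_on_smooth_approx: "continuous_on UNIV (smooth_approx m)"
  using Ck_on_smooth_approx[of 0 m] by simp

lemma continuous_on_heat_approx: "continuous_on UNIV (heat_approx m)"
  unfolding heat_approx_def by (rule continuous_on_mollify_heat[OF heat_time_pos])

lemma smooth_approx_nonneg: "smooth_approx m w \<ge> 0"
  unfolding smooth_approx_def by (intro mollify_nonneg bump_kernel_nonneg) simp

lemma heat_approx_nonneg: "heat_approx m w \<ge> 0"
  unfolding heat_approx_def by (intro mollify_nonneg less_imp_le heat_kernel_pos heat_time_pos)

lemma smooth_approx_eq_0:
  assumes "emeasure \<mu> (- E) = 0" "closed E" "\<And>y. y \<in> E \<Longrightarrow> norm (w - y) \<ge> 1 / real (Suc m)"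
  shows "smooth_approx m w = 0"
proof -
  have "smooth_approx m w \<le> 0"
    unfolding smooth_approx_def
  proof (rule mollify_le[OF assms(1,2) order_refl])
    fix y assume "y \<in> E"
    then have "bump_kernel (real (Suc m)) (w - y) = 0" by (intro bump_kernel_eq_0 assms(3)) simp
    then show "bump_kernel (real (Suc m)) (w - y) \<le> 0" by simp
  qed
  then show ?thesis using smooth_approx_nonneg[of m w] by simp
qed

lemma heat_kernel_time_le:
  "heat_kernel (1 / (real (Suc m))\<^sup>2) (z::'a) \<le> real (Suc m) ^ DIM('a) * exp (- ((norm z * real (Suc m))\<^sup>2 / 4))"
proof -
  let ?n = "real (Suc m)"
  have "sqrt (pi / (1 / ?n\<^sup>2)) / (2 * pi) = (sqrt pi * ?n) / (2 * (sqrt pi * sqrt pi))"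
    by (simp add: real_sqrt_mult)
  also have "\<dots> = ?n / (2 * sqrt pi)"
    unfolding times_divide_times_eq[symmetric] mult.left_commute[of 2] by simp
  also have "\<dots> \<le> ?n / 1"
  proof (rule divide_left_mono)
    have "1 \<le> sqrt pi" using pi_gt3 by simp
    then show "1 \<le> 2 * sqrt pi" by linarith
  qed auto
  finally have "(sqrt (pi / (1 / ?n\<^sup>2)) / (2 * pi)) ^ DIM('a) \<le> ?n ^ DIM('a)"
    by (intro power_mono) auto
  moreover have "(z \<bullet> z) / (4 * (1 / ?n\<^sup>2)) = (norm z * ?n)\<^sup>2 / 4"
    by (simp add: power_mult_distrib dot_square_norm)
  ultimately show ?thesis unfolding heat_kernel_def by (simp only:) (intro mult_right_mono, auto)
qed

text \<open>At positive distance from \<open>E\<close> the heat mollification is not 0, but for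
  fixed \<open>\<rho> > 0\<close> its bound decays faster than any power of \<open>m\<close>, which
  substitutes for the vanishing of the bump mollification.\<close>

lemma heat_approx_le_off:
  assumes "emeasure \<mu> (- E) = 0" "closed E" "\<rho> \<ge> 0" "\<And>y. y \<in> E \<Longrightarrow> norm (w - y) \<ge> \<rho>"
  shows "heat_approx m w \<le> real (Suc m) ^ DIM('a) * exp (- ((\<rho> * real (Suc m))\<^sup>2 / 4))"
  unfolding heat_approx_def
proof (rule mollify_le[OF assms(1,2)])
  fix y assume "y \<in> E"
  then have "\<rho> * real (Suc m) \<le> norm (w - y) * real (Suc m)" by (intro mult_right_mono assms(4)) auto
  then have "(\<rho> * real (Suc m))\<^sup>2 \<le> (norm (w - y) * real (Suc m))\<^sup>2" using assms(3) by (intro power_mono) auto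
  then have "exp (- ((norm (w - y) * real (Suc m))\<^sup>2 / 4)) \<le> exp (- ((\<rho> * real (Suc m))\<^sup>2 / 4))" by simp
  then have "real (Suc m) ^ DIM('a) * exp (- ((norm (w - y) * real (Suc m))\<^sup>2 / 4))
      \<le> real (Suc m) ^ DIM('a) * exp (- ((\<rho> * real (Suc m))\<^sup>2 / 4))" by (intro mult_left_mono) auto
  then show "heat_kernel (1 / (real (Suc m))\<^sup>2) (w - y) \<le> real (Suc m) ^ DIM('a) * exp (- ((\<rho> * real (Suc m))\<^sup>2 / 4))"
    using heat_kernel_time_le[of m "w - y"] by (rule order_trans[rotated])
qed simp

lemma approx_le:
  "\<exists>A\<ge>1. \<forall>m w. smooth_approx m w \<le> A * real (Suc m) ^ DIM('a) \<and> heat_approx m w \<le> A * real (Suc m) ^ DIM('a)"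
proof -
  obtain A where A: "\<forall>n>0. \<forall>z::'a. bump_kernel n z \<le> A * n ^ DIM('a)"
    using bump_kernel_le by blast
  show ?thesis
  proof (intro exI[of _ "max A 1"] conjI allI)
    fix m w
    have le: "A * real (Suc m) ^ DIM('a) \<le> max A 1 * real (Suc m) ^ DIM('a)" by (intro mult_right_mono) auto
    show "smooth_approx m w \<le> max A 1 * real (Suc m) ^ DIM('a)"
      unfolding smooth_approx_def
    proof (rule mollify_le[of UNIV])
      show "bump_kernel (real (Suc m)) (w - y) \<le> max A 1 * real (Suc m) ^ DIM('a)" for y
        by (rule order_trans[OF A[rule_format] le]) simp
    qed auto
    have "heat_approx m w \<le> real (Suc m) ^ DIM('a) * exp (- ((0 * real (Suc m))\<^sup>2 / 4))"
      by (rule heat_approx_le_off[of UNIV]) auto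
    also have "\<dots> \<le> max A 1 * real (Suc m) ^ DIM('a)"
      using mult_right_mono[of 1 "max A 1" "real (Suc m) ^ DIM('a)"] by simp
    finally show "heat_approx m w \<le> max A 1 * real (Suc m) ^ DIM('a)" .
  qed simp
qed

lemma smooth_approx_mass:
  assumes "1 / real (Suc m) < r"
  shows "emeasure \<mu> (ball x r) \<le> (\<integral>\<^sup>+w. ennreal (smooth_approx m w) * indicator (ball x (2 * r)) w \<partial>lborel)"
proof -
  obtain B where B: "\<And>z::'a. \<bar>bump_kernel (Suc m) z\<bar> \<le> B" using abs_bump_kernel_le by blast
  have "1 * emeasure \<mu> (ball x r) \<le> (\<integral>\<^sup>+w. ennreal (smooth_approx m w) * indicator (ball x (2 * r)) w \<partial>lborel)"
    unfolding smooth_approx_def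
    by (rule mollify_mass_ball[OF continuous_on_bump_kernel B bump_kernel_nonneg])
       (use bump_kernel_mass[of "real (Suc m)" r, where 'a = 'a] assms in simp_all)
  then show ?thesis by simp
qed

lemma heat_approx_mass:
  "\<exists>c>0. \<forall>m x r. 1 / real (Suc m) < r \<longrightarrow>
    ennreal c * emeasure \<mu> (ball x r) \<le> (\<integral>\<^sup>+w. ennreal (heat_approx m w) * indicator (ball x (2 * r)) w \<partial>lborel)"
proof -
  obtain c where c: "c > 0" "\<And>t r. 0 < t \<Longrightarrow> sqrt t \<le> r \<Longrightarrow>
     ennreal c \<le> (\<integral>\<^sup>+z. ennreal (heat_kernel t (z::'a)) * indicator (ball 0 r) z \<partial>lborel)"
    using heat_kernel_mass by blast
  have "ennreal c * emeasure \<mu> (ball x r) \<le> (\<integral>\<^sup>+w. ennreal (heat_approx m w) * indicator (ball x (2 * r)) w \<partial>lborel)"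
    if r: "1 / real (Suc m) < r" for m x r
    unfolding heat_approx_def
  proof (rule mollify_mass_ball[OF continuous_on_heat_kernel[OF heat_time_pos] abs_heat_kernel_le[OF heat_time_pos] less_imp_le[OF heat_kernel_pos[OF heat_time_pos]]])
    have "sqrt (1 / (real (Suc m))\<^sup>2) \<le> r" using r by (simp add: real_sqrt_divide)
    then show "ennreal c \<le> (\<integral>\<^sup>+z. ennreal (heat_kernel (1 / (real (Suc m))\<^sup>2) (z::'a)) * indicator (ball 0 r) z \<partial>lborel)"
      by (rule c(2)[OF heat_time_pos])
  qed
  then show ?thesis using c(1) by blast
qed

lemma kernel_ft_bump:
  shows "norm (kernel_ft (bump_kernel (Suc m)) (\<xi>::'a)) \<le> 1"
    and "(\<lambda>m. kernel_ft (bump_kernel (Suc m)) (\<xi>::'a)) \<longlonglongrightarrow> 1"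
proof -
  have p: "real (Suc m) > 0" for m by simp
  show "norm (kernel_ft (bump_kernel (Suc m)) (\<xi>::'a)) \<le> 1"
    by (rule norm_kernel_ft_le_1[OF bump_kernel_nonneg[OF p] integral_bump_kernel[OF p]])
  have le: "norm (kernel_ft (bump_kernel (Suc m)) \<xi> - 1) \<le> norm \<xi> * (1 / real (Suc m))" for m
  proof (rule norm_kernel_ft_minus_1_le[OF bump_kernel_nonneg[OF p] integral_bump_kernel[OF p] integrable_bump_kernel[OF p]])
    show "bump_kernel (real (Suc m)) z = 0" if "norm z > 1 / real (Suc m)" for z :: 'a
      by (rule bump_kernel_eq_0[OF p less_imp_le[OF that]])
  qed
  have "(\<lambda>m. norm \<xi> * (1 / real (Suc m))) \<longlonglongrightarrow> norm \<xi> * 0"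
    by (intro tendsto_mult tendsto_const) (use LIMSEQ_inverse_real_of_nat in \<open>simp add: inverse_eq_divide\<close>)
  then have "(\<lambda>m. norm \<xi> * (1 / real (Suc m))) \<longlonglongrightarrow> 0" by simp
  then have "(\<lambda>m. kernel_ft (bump_kernel (Suc m)) \<xi> - 1) \<longlonglongrightarrow> 0"
    by (rule Lim_null_comparison[rotated]) (use le in simp)
  then show "(\<lambda>m. kernel_ft (bump_kernel (Suc m)) (\<xi>::'a)) \<longlonglongrightarrow> 1"
    by (rule LIM_zero_cancel)
qed

end

text \<open>Instantiates the abstract Cauchy estimate with both mollifications. The finite energy of
  order \<open>a\<close> enters twice, as order \<open>- (a * card (- L))\<close> of the input and
  as the order dual to that of the output.\<close>

lemma radon_approx_Cauchy:
  fixes \<mu> :: "(real ^ 'd::finite) measure" and \<eta> :: "real ^ 'd ^ 'k::finite \<Rightarrow> complex" and L :: "'k set"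
    and \<nu> :: "'t \<Rightarrow> (real ^ 'd ^ 'k) measure"
  assumes \<mu>: "borel_prob \<mu>" and E: "emeasure \<mu> (- E) = 0" "compact E" and a: "a \<ge> 0"
    and fin: "(\<integral>\<^sup>+x. ennreal ((1 + (norm x)\<^sup>2) powr (- a) * (norm (char_fun \<mu> x))\<^sup>2) \<partial>lborel) < \<infinity>"
    and \<nu>: "\<And>t. t \<in> V \<Longrightarrow> sets (\<nu> t) = sets borel" "\<And>t C. t \<in> V \<Longrightarrow> compact C \<Longrightarrow> emeasure (\<nu> t) C < \<infinity>"
    and \<eta>: "continuous_on UNIV \<eta>" "compact K" "\<And>x. x \<notin> K \<Longrightarrow> \<eta> x = 0"
    and est: "\<And>t. t \<in> V \<Longrightarrow> sobolev_bounded (- L) L (- (a * card (- L))) (a * card L) C (radon L \<eta> (\<nu> t))"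
    and e: "e > 0"
  shows "\<exists>M. \<forall>m\<ge>M. \<forall>n\<ge>M. \<forall>t\<in>V.
    norm (radon L \<eta> (\<nu> t) (tensor (- L) (borel_prob.smooth_approx \<mu> m)) (tensor L (borel_prob.heat_approx \<mu> m))
      - radon L \<eta> (\<nu> t) (tensor (- L) (borel_prob.smooth_approx \<mu> n)) (tensor L (borel_prob.heat_approx \<mu> n))) \<le> e"
proof -
  interpret \<mu>: borel_prob \<mu> by (rule \<mu>)
  let ?c = "of_real ((2 * pi) ^ DIM(real ^ 'd)) :: complex"
  let ?k = "\<lambda>m. bump_kernel (real (Suc m)) :: real ^ 'd \<Rightarrow> real"
  let ?G = "\<lambda>m \<xi>. \<Prod>i\<in>L. of_real (exp (- (1 / (real (Suc m))\<^sup>2) * (\<xi> i \<bullet> \<xi> i))) * (char_fun \<mu> (\<xi> i) / ?c)"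
  have kint: "integrable lborel (?k m)" for m by (rule integrable_bump_kernel) simp
  have km: "?k m \<in> borel_measurable borel" for m
    by (rule borel_measurable_continuous_onI[OF continuous_on_bump_kernel])
  \<comment> \<open>On each side \<open>h\<close> is the limiting symbol of one factor and
    \<open>b\<close> the multiplier tending to 1: the transform of the bump on the right, a Gaussian
    on the left.\<close>
  define h1 where "h1 = (\<lambda>x. cnj (char_fun \<mu> x))"
  define b1 where "b1 = (\<lambda>m. kernel_ft (?k m))"
  have h1: "h1 \<in> borel_measurable borel"
  proof -
    have "cnj \<in> borel_measurable borel" by (intro borel_measurable_continuous_onI continuous_intros)
    then show ?thesis unfolding h1_def using \<mu>.borel_measurable_char_fun by (rule measurable_compose[rotated])
  qed
  have fin1: "(\<integral>\<^sup>+x. ennreal ((1 + (norm x)\<^sup>2) powr (- a) * (norm (h1 x))\<^sup>2) \<partial>lborel) < \<infinity>"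
    using fin by (simp add: h1_def)
  have b1: "b1 m \<in> borel_measurable borel" "norm (b1 m x) \<le> 1" "(\<lambda>m. b1 m x) \<longlonglongrightarrow> 1" for m x
    unfolding b1_def by (rule borel_measurable_kernel_ft[OF km] \<mu>.kernel_ft_bump)+
  define h2 where "h2 = (\<lambda>x. char_fun \<mu> x / ?c)"
  define b2 where "b2 = (\<lambda>m (x :: real ^ 'd). complex_of_real (exp (- (1 / (real (Suc m))\<^sup>2) * (x \<bullet> x))))"
  have h2: "h2 \<in> borel_measurable borel" unfolding h2_def by measurable
  have fin2: "(\<integral>\<^sup>+x. ennreal ((1 + (norm x)\<^sup>2) powr (- a) * (norm (h2 x))\<^sup>2) \<partial>lborel) < \<infinity>"
  proof (rule le_less_trans[OF _ fin], rule nn_integral_mono, rule ennreal_leI, rule mult_left_mono)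
    fix x :: "real ^ 'd"
    \<comment> \<open>The normalisation of Fourier inversion only decreases the symbol, so the
      energy bound carries over without a constant.\<close>
    have "1 \<le> (2 * pi) ^ DIM(real ^ 'd)" using pi_gt3 by (intro one_le_power) simp
    then have "1 \<le> norm ?c" by (simp only: norm_of_real)
    then have "norm (h2 x) \<le> norm (char_fun \<mu> x)"
      unfolding h2_def norm_divide using divide_left_mono[of 1 "norm ?c" "norm (char_fun \<mu> x)"] by simp
    then show "(norm (h2 x))\<^sup>2 \<le> (norm (char_fun \<mu> x))\<^sup>2" by (intro power_mono) auto
  qed simp
  have b2m: "b2 m \<in> borel_measurable borel" for m unfolding b2_def by measurable
  have b2n: "norm (b2 m x) \<le> 1" for m x by (simp add: b2_def)
  have b2l: "(\<lambda>m. b2 m x) \<longlonglongrightarrow> 1" for x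
  proof -
    have "(\<lambda>m. inverse (real (Suc m))) \<longlonglongrightarrow> 0" by (rule LIMSEQ_inverse_real_of_nat)
    then have "(\<lambda>m. complex_of_real (exp (- ((inverse (real (Suc m)))\<^sup>2) * (x \<bullet> x)))) \<longlonglongrightarrow> complex_of_real (exp (- (0\<^sup>2) * (x \<bullet> x)))"
      by (intro tendsto_of_real tendsto_exp tendsto_mult tendsto_minus tendsto_power tendsto_const)
    then show ?thesis by (simp add: b2_def power_divide inverse_eq_divide)
  qed
  note W1 = weighted_sq_tensor_finite[OF a h1 fin1, of "- L"] weighted_sq_tensor_le[OF a h1 fin1 b1, of "- L"]
    weighted_sq_tensor_Cauchy[OF a h1 fin1 b1, of _ "- L"]
  note W2 = weighted_sq_tensor_finite[OF a h2 fin2, of L] weighted_sq_tensor_le[OF a h2 fin2 b2m b2n b2l, of L]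
    weighted_sq_tensor_Cauchy[OF a h2 fin2 b2m b2n b2l, of _ L]
  let ?B1 = "weighted_sq (- L) (- (a * card (- L))) (\<lambda>\<xi>. \<Prod>i\<in>- L. h1 (\<xi> i))"
  let ?B2 = "weighted_sq L (- (a * card L)) (\<lambda>\<xi>. \<Prod>i\<in>L. h2 (\<xi> i))"
  define B where "B = max (enn2real ?B1) (enn2real ?B2)"
  have B: "?B1 \<le> ennreal B" "?B2 \<le> ennreal B" "B \<ge> 0"
  proof -
    show "B \<ge> 0" unfolding B_def by (simp add: le_max_iff_disj)
    have "?B1 = ennreal (enn2real ?B1)" using W1(1) by (simp add: ennreal_enn2real)
    also have "\<dots> \<le> ennreal B" unfolding B_def by (intro ennreal_leI) simp
    finally show "?B1 \<le> ennreal B" .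
    have "?B2 = ennreal (enn2real ?B2)" using W2(1) by (simp add: ennreal_enn2real)
    also have "\<dots> \<le> ennreal B" unfolding B_def by (intro ennreal_leI) simp
    finally show "?B2 \<le> ennreal B" .
  qed
  \<comment> \<open>All bump radii are at most 1, so \<open>R + 1\<close> bounds the supports of all
    mollifications at once.\<close>
  obtain R where R: "R > 0" "E \<subseteq> ball 0 R"
    using bounded_subset_ballD[OF compact_imp_bounded[OF E(2)], of 0] by blast
  have supp: "\<mu>.smooth_approx m x = 0" if "norm x > R + 1" for m x
  proof (rule \<mu>.smooth_approx_eq_0[OF E(1) compact_imp_closed[OF E(2)]])
    fix y assume "y \<in> E"
    then have "norm y < R" using R(2) by auto
    then have "1 \<le> norm (x - y)" using that norm_triangle_ineq2[of x y] by linarith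
    moreover have "1 / real (Suc m) \<le> 1" by simp
    ultimately show "1 / real (Suc m) \<le> norm (x - y)" by linarith
  qed
  have ft: "fourier (- L) (distr_of_fun (- L) (tensor (- L) (\<mu>.smooth_approx m))) = (\<lambda>\<xi>. \<Prod>i\<in>- L. b1 m (\<xi> i) * h1 (\<xi> i))" for m
    unfolding \<mu>.smooth_approx_def b1_def h1_def by (rule ext) (rule fourier_tensor_mollify[OF \<mu> km kint])
  have ftd: "fourier (- L) (distr_of_fun (- L) (\<lambda>w. tensor (- L) (\<mu>.smooth_approx m) w - tensor (- L) (\<mu>.smooth_approx n) w))
      = (\<lambda>\<xi>. (\<Prod>i\<in>- L. b1 m (\<xi> i) * h1 (\<xi> i)) - (\<Prod>i\<in>- L. b1 n (\<xi> i) * h1 (\<xi> i)))" for m n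
  proof
    fix \<xi> :: "'k \<Rightarrow> real ^ 'd"
    note i = integrable_tensor_mollify[OF \<mu> km kint, of "- L" _ \<xi>, folded \<mu>.smooth_approx_def]
    have "fourier (- L) (distr_of_fun (- L) (\<lambda>w. tensor (- L) (\<mu>.smooth_approx m) w - tensor (- L) (\<mu>.smooth_approx n) w)) \<xi>
      = fourier (- L) (distr_of_fun (- L) (tensor (- L) (\<mu>.smooth_approx m))) \<xi> - fourier (- L) (distr_of_fun (- L) (tensor (- L) (\<mu>.smooth_approx n))) \<xi>"
      unfolding fourier_def distr_of_fun_def left_diff_distrib by (rule Bochner_Integration.integral_diff[OF i i])
    then show "fourier (- L) (distr_of_fun (- L) (\<lambda>w. tensor (- L) (\<mu>.smooth_approx m) w - tensor (- L) (\<mu>.smooth_approx n) w)) \<xi>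
      = (\<Prod>i\<in>- L. b1 m (\<xi> i) * h1 (\<xi> i)) - (\<Prod>i\<in>- L. b1 n (\<xi> i) * h1 (\<xi> i))"
      unfolding ft .
  qed
  note tens = tensor_in_block_Cc_infinity[where R = "R + 1" and S = "- L", OF \<mu>.Ck_on_smooth_approx supp \<mu>.Ck_on_smooth_approx supp]
  have Geq: "?G m = (\<lambda>\<xi>. \<Prod>i\<in>L. b2 m (\<xi> i) * h2 (\<xi> i))" for m
    by (simp only: b2_def h2_def)
  show ?thesis
  proof (rule radon_uniform_Cauchy[where G = ?G and B = B, OF \<nu> \<eta> tens(1) tens(2)])
    show "sobolev_integral (- L) (- (a * card (- L))) (distr_of_fun (- L) (tensor (- L) (\<mu>.smooth_approx n))) \<le> ennreal B" for n
      unfolding sobolev_integral_eq ft by (rule order_trans[OF W1(2) B(1)])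
    show "\<exists>M. \<forall>m\<ge>M. \<forall>n\<ge>M. sobolev_integral (- L) (- (a * card (- L)))
        (distr_of_fun (- L) (\<lambda>w. tensor (- L) (\<mu>.smooth_approx m) w - tensor (- L) (\<mu>.smooth_approx n) w)) \<le> ennreal e" if "e > 0" for e
      unfolding sobolev_integral_eq ftd by (rule W1(3)[OF that])
    show "integrable (block_lborel L) (?G n)" for n
      by (rule integrable_heat_symbol[OF \<mu> \<mu>.heat_time_pos])
    show "tensor L (\<mu>.heat_approx n) w = (\<integral>\<xi>. ?G n \<xi> * cis (- (\<Sum>i\<in>L. \<xi> i \<bullet> w i)) \<partial>block_lborel L)" for n w
      unfolding \<mu>.heat_approx_def by (rule tensor_heat_eq[OF \<mu> \<mu>.heat_time_pos])
    show "weighted_sq L (- (a * card L)) (?G n) \<le> ennreal B" for n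
      unfolding Geq by (rule order_trans[OF W2(2) B(2)])
    show "\<exists>M. \<forall>m\<ge>M. \<forall>n\<ge>M. weighted_sq L (- (a * card L)) (\<lambda>\<xi>. ?G m \<xi> - ?G n \<xi>) \<le> ennreal e" if "e > 0" for e
      using W2(3)[OF that] by (simp only: b2_def h2_def)
    show "sobolev_bounded (- L) L (- (a * card (- L))) (a * card L) C (radon L \<eta> (\<nu> t))" if "t \<in> V" for t
      by (rule est[OF that])
  qed (use B(3) e in auto)
qed

text \<open>Otherwise compactness would cover \<open>E\<close> by finitely many null balls,
  contradicting total mass 1.\<close>

lemma (in borel_prob) exists_point_of_positive_mass:
  assumes E: "emeasure \<mu> (- E) = 0" "compact E"
  shows "\<exists>x\<in>E. \<forall>r>0. measure \<mu> (ball x r) > 0"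
proof (rule ccontr)
  assume neg: "\<not> ?thesis"
  have ex: "\<exists>r. r > 0 \<and> measure \<mu> (ball x r) = 0" if x: "x \<in> E" for x
  proof -
    obtain r where "r > 0" "\<not> measure \<mu> (ball x r) > 0" using neg x by blast
    then show ?thesis using measure_nonneg[of \<mu> "ball x r"] by (intro exI[of _ r]) linarith
  qed
  define r where "r = (\<lambda>x. SOME r. r > 0 \<and> measure \<mu> (ball x r) = 0)"
  have r: "r x > 0 \<and> measure \<mu> (ball x (r x)) = 0" if "x \<in> E" for x
    unfolding r_def by (rule someI_ex[OF ex[OF that]])
  have "E \<subseteq> (\<Union>x\<in>E. ball x (r x))" using r by force
  then obtain T where T: "T \<subseteq> E" "finite T" "E \<subseteq> (\<Union>x\<in>T. ball x (r x))"
    using compactE_image[OF E(2), of E "\<lambda>x. ball x (r x)"] by auto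
  have sets: "- E \<in> sets \<mu>" "ball x s \<in> sets \<mu>" for x s
    using compact_imp_closed[OF E(2)] by (auto simp: sets_eq_borel)
  have U: "- E \<union> (\<Union>x\<in>T. ball x (r x)) = space \<mu>" using T(3) by (auto simp: space_eq_UNIV)
  have "measure \<mu> (space \<mu>) \<le> measure \<mu> (- E) + measure \<mu> (\<Union>x\<in>T. ball x (r x))"
    unfolding U[symmetric] by (rule measure_Un_le) (use sets T(2) in auto)
  also have "measure \<mu> (- E) = 0" using E(1) by (simp add: measure_def)
  also have "measure \<mu> (\<Union>x\<in>T. ball x (r x)) \<le> (\<Sum>x\<in>T. measure \<mu> (ball x (r x)))"
    by (rule measure_UNION_le[OF T(2)]) (use sets in auto)
  also have "\<dots> = 0" using r T(1) by (intro sum.neutral) auto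
  finally show False by (simp add: prob_space)
qed

text \<open>The condition \<open>b \<ge> 0\<close> makes the intermediate exponent positive, hence a
  competitor in the infimum that defines the dimension.\<close>

lemma less_hausdorff_dimE:
  assumes "ereal b < hausdorff_dim E" "b \<ge> 0"
  obtains s where "b < s" "hausdorff_measure s E \<noteq> 0"
proof -
  obtain s where s: "ereal b < ereal s" "ereal s < hausdorff_dim E"
    using ereal_dense2[OF assms(1)] by blast
  have "hausdorff_measure s E \<noteq> 0"
  proof
    assume "hausdorff_measure s E = 0"
    then have "hausdorff_dim E \<le> ereal s"
      unfolding hausdorff_dim_def using s(1) assms(2) by (intro Inf_lower) auto
    with s(2) show False by simp
  qed
  then show thesis using that s(1) by simp
qed

lemma norm_vec_le_sum: "norm (x :: 'a::real_normed_vector ^ 'k::finite) \<le> (\<Sum>i\<in>UNIV. norm (x $ i))"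
  unfolding norm_vec_def by (rule L2_set_le_sum) simp

context
  fixes \<mu> :: "(real ^ 'd::finite) measure" and L :: "'k::finite set"
  assumes \<mu>: "borel_prob \<mu>"
begin

interpretation \<mu>: borel_prob \<mu> by (rule \<mu>)

text \<open>Written as one product over all indices, so that integration over the configuration
  space factors; the splitting into blocks is recovered in
  \<open>of_real_approx_density\<close>.\<close>

definition approx_density :: "nat \<Rightarrow> real ^ 'd ^ 'k \<Rightarrow> real" where
  "approx_density m x = (\<Prod>i\<in>UNIV. if i \<in> L then \<mu>.heat_approx m (x $ i) else \<mu>.smooth_approx m (x $ i))"

lemma approx_density_nonneg: "approx_density m x \<ge> 0"
  unfolding approx_density_def by (intro prod_nonneg) (simp add: \<mu>.heat_approx_nonneg \<mu>.smooth_approx_nonneg)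

lemma continuous_on_approx_density: "continuous_on UNIV (approx_density m)"
proof -
  have "continuous_on UNIV (\<lambda>x :: real ^ 'd ^ 'k. if i \<in> L then \<mu>.heat_approx m (x $ i) else \<mu>.smooth_approx m (x $ i))" for i
    using continuous_on_compose2[OF \<mu>.continuous_on_heat_approx, of UNIV "\<lambda>x. x $ i" m]
      continuous_on_compose2[OF \<mu>.continuous_on_smooth_approx, of UNIV "\<lambda>x. x $ i" m]
    by (cases "i \<in> L") (simp_all add: linear_continuous_on bounded_linear_vec_nth)
  then show ?thesis unfolding approx_density_def[abs_def] by (rule continuous_on_prod)
qed

lemma of_real_approx_density:
  "complex_of_real (approx_density m x) = tensor (- L) (\<mu>.smooth_approx m) (block (- L) x) * tensor L (\<mu>.heat_approx m) (block L x)"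
proof -
  have "approx_density m x = (\<Prod>i\<in>L. \<mu>.heat_approx m (x $ i)) * (\<Prod>i\<in>- L. \<mu>.smooth_approx m (x $ i))"
    unfolding approx_density_def by (subst prod.If_cases) (simp_all add: Compl_eq)
  then show ?thesis by (simp add: tensor_block mult.commute)
qed

text \<open>Integration over a product of balls factors, and each factor has a lower bound
  independent of \<open>m\<close> once \<open>1 / Suc m < \<rho>\<close>.\<close>

lemma approx_density_mass:
  assumes q: "measure \<mu> (ball x0 \<rho>) > 0" and \<rho>: "\<rho> > 0"
  shows "\<exists>c>0. \<exists>M. \<forall>m\<ge>M. ennreal c \<le>
    (\<integral>\<^sup>+x. ennreal (approx_density m x) * indicator {x. \<forall>i. x $ i \<in> ball x0 (2 * \<rho>)} x \<partial>lborel)"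
proof -
  obtain c where c: "c > 0" "\<And>m x r. 1 / real (Suc m) < r \<Longrightarrow>
    ennreal c * emeasure \<mu> (ball x r) \<le> (\<integral>\<^sup>+w. ennreal (\<mu>.heat_approx m w) * indicator (ball x (2 * r)) w \<partial>lborel)"
    using \<mu>.heat_approx_mass by blast
  define q where "q = measure \<mu> (ball x0 \<rho>)"
  define v where "v = (\<lambda>i. if i \<in> L then c * q else q)"
  have v: "v i > 0" for i using c(1) assms(1) by (simp add: v_def q_def)
  obtain M :: nat where M: "1 / \<rho> < real M" using reals_Archimedean2 by blast
  have small: "1 / real (Suc m) < \<rho>" if "m \<ge> M" for m
  proof -
    have "1 / \<rho> < real (Suc m)" using M that by linarith
    then show ?thesis using \<rho> by (simp add: field_simps)
  qed
  show ?thesis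
  proof (intro exI[of _ "\<Prod>i\<in>UNIV. v i"] conjI exI[of _ M] allI impI)
    show "(\<Prod>i\<in>UNIV. v i) > 0" using v by (intro prod_pos) simp
    fix m assume m: "M \<le> m"
    let ?u = "\<lambda>i w. ennreal (if i \<in> L then \<mu>.heat_approx m w else \<mu>.smooth_approx m w) * indicator (ball x0 (2 * \<rho>)) w"
    have hm: "\<mu>.heat_approx m \<in> borel_measurable borel" "\<mu>.smooth_approx m \<in> borel_measurable borel"
      by (intro borel_measurable_continuous_onI \<mu>.continuous_on_heat_approx \<mu>.continuous_on_smooth_approx)+
    have um: "?u i \<in> borel_measurable borel" for i
      using hm by (cases "i \<in> L") (auto intro!: borel_measurable_times_ennreal borel_measurable_indicator)
    have vi: "ennreal (v i) \<le> (\<integral>\<^sup>+w. ?u i w \<partial>lborel)" for i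
    proof (cases "i \<in> L")
      case True
      have "ennreal (v i) = ennreal c * emeasure \<mu> (ball x0 \<rho>)"
        using True c(1) by (simp add: v_def q_def \<mu>.emeasure_eq_measure ennreal_mult)
      then show ?thesis using c(2)[OF small[OF m], of x0] True by simp
    next
      case False
      have "ennreal (v i) = emeasure \<mu> (ball x0 \<rho>)"
        using False by (simp add: v_def q_def \<mu>.emeasure_eq_measure)
      then show ?thesis using \<mu>.smooth_approx_mass[OF small[OF m], of x0] False by simp
    qed
    have "ennreal (\<Prod>i\<in>UNIV. v i) = (\<Prod>i\<in>UNIV. ennreal (v i))"
      using v by (intro prod_ennreal[symmetric]) (simp add: less_imp_le)
    also have "\<dots> \<le> (\<Prod>i\<in>UNIV. (\<integral>\<^sup>+w. ?u i w \<partial>lborel))"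
      by (intro prod_mono_ennreal vi)
    also have "\<dots> = (\<integral>\<^sup>+x. (\<Prod>i\<in>UNIV. ?u i (x $ i)) \<partial>(lborel :: (real ^ 'd ^ 'k) measure))"
      by (rule nn_integral_lborel_vec_prod[OF um, symmetric])
    also have "\<dots> = (\<integral>\<^sup>+x. ennreal (approx_density m x) * indicator {x. \<forall>i. x $ i \<in> ball x0 (2 * \<rho>)} x \<partial>lborel)"
    proof (rule nn_integral_cong)
      fix x :: "real ^ 'd ^ 'k"
      have i: "(\<Prod>i\<in>UNIV. indicator (ball x0 (2 * \<rho>)) (x $ i)) = (indicator {x. \<forall>i. x $ i \<in> ball x0 (2 * \<rho>)} x :: ennreal)"
      proof (cases "\<forall>i. x $ i \<in> ball x0 (2 * \<rho>)")
        case False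
        then obtain j where "x $ j \<notin> ball x0 (2 * \<rho>)" by blast
        then have "(\<Prod>i\<in>UNIV. indicator (ball x0 (2 * \<rho>)) (x $ i)) = (0 :: ennreal)"
          by (intro prod_zero bexI[of _ j]) simp_all
        then show ?thesis using False by simp
      qed simp
      have "(\<Prod>i\<in>UNIV. ennreal (if i \<in> L then \<mu>.heat_approx m (x $ i) else \<mu>.smooth_approx m (x $ i))) = ennreal (approx_density m x)"
        unfolding approx_density_def
        by (intro prod_ennreal) (simp add: \<mu>.heat_approx_nonneg \<mu>.smooth_approx_nonneg)
      then show "(\<Prod>i\<in>UNIV. ?u i (x $ i)) = ennreal (approx_density m x) * indicator {x. \<forall>i. x $ i \<in> ball x0 (2 * \<rho>)} x"
        unfolding prod.distrib i by simp
    qed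
    finally show "ennreal (\<Prod>i\<in>UNIV. v i) \<le> (\<integral>\<^sup>+x. ennreal (approx_density m x) * indicator {x. \<forall>i. x $ i \<in> ball x0 (2 * \<rho>)} x \<partial>lborel)" .
  qed
qed

text \<open>It is enough that one coordinate be far from \<open>E\<close>: its factor vanishes or is
  a Gaussian tail, while the others grow at most like \<open>real (Suc m) ^ DIM(real ^ 'd)\<close>
  each. The condition on \<open>m\<close> puts the mollification scale below
  \<open>\<rho>\<close>.\<close>

lemma approx_density_off_le:
  assumes E: "emeasure \<mu> (- E) = 0" "closed E" and \<rho>: "\<rho> > 0"
  shows "\<exists>\<kappa>\<ge>0. \<forall>m x. 1 / \<rho> < real (Suc m) \<longrightarrow> (\<exists>i. \<forall>y\<in>E. norm (x $ i - y) \<ge> \<rho>) \<longrightarrow> approx_density m x \<le> \<kappa> / real (Suc m)"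
proof -
  let ?D = "DIM(real ^ 'd)" and ?k = "CARD('k)"
  obtain A where A: "A \<ge> 1" "\<And>m w. \<mu>.smooth_approx m w \<le> A * real (Suc m) ^ ?D" "\<And>m w. \<mu>.heat_approx m w \<le> A * real (Suc m) ^ ?D"
    using \<mu>.approx_le by blast
  \<comment> \<open>One power more than the total growth of all \<open>?k\<close> factors, which
    leaves exactly the rate \<open>1 / real (Suc m)\<close>.\<close>
  define N where "N = ?D * ?k + 1"
  define F where "F = (fact N * 4 ^ N :: real)"
  define \<kappa> where "\<kappa> = A ^ ?k * (F / \<rho> ^ N)"
  have F: "F > 0" by (simp add: F_def)
  have \<kappa>: "\<kappa> \<ge> 0" using A F \<rho> by (simp add: \<kappa>_def)
  show ?thesis
  proof (intro exI[of _ \<kappa>] conjI allI impI \<kappa>)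
    fix m and x :: "real ^ 'd ^ 'k"
    assume m: "1 / \<rho> < real (Suc m)" and "\<exists>i. \<forall>y\<in>E. norm (x $ i - y) \<ge> \<rho>"
    then obtain j where j: "\<And>y. y \<in> E \<Longrightarrow> norm (x $ j - y) \<ge> \<rho>" by blast
    let ?n = "real (Suc m)"
    let ?f = "\<lambda>i. if i \<in> L then \<mu>.heat_approx m (x $ i) else \<mu>.smooth_approx m (x $ i)"
    define b where "b = A * ?n ^ ?D"
    have b: "b \<ge> 0" using A(1) by (simp add: b_def)
    have n1: "\<rho> * ?n \<ge> 1" using m \<rho> by (simp add: field_simps)
    have f0: "?f i \<ge> 0" for i by (simp add: \<mu>.heat_approx_nonneg \<mu>.smooth_approx_nonneg)
    have fb: "?f i \<le> b" for i using A(2,3) by (simp add: b_def)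
    have fj: "?f j \<le> b * (F / (\<rho> * ?n) ^ N)"
    proof (cases "j \<in> L")
      case True
      have "\<mu>.heat_approx m (x $ j) \<le> ?n ^ ?D * exp (- ((\<rho> * ?n)\<^sup>2 / 4))"
        by (rule \<mu>.heat_approx_le_off[OF E less_imp_le[OF \<rho>] j])
      also have "\<dots> \<le> b * (F / (\<rho> * ?n) ^ N)"
      proof (rule mult_mono)
        show "?n ^ ?D \<le> b" using mult_right_mono[OF A(1), of "?n ^ ?D"] by (simp add: b_def)
        show "exp (- ((\<rho> * ?n)\<^sup>2 / 4)) \<le> F / (\<rho> * ?n) ^ N" unfolding F_def by (rule exp_minus_square_le[OF n1])
      qed (use b in auto)
      finally show ?thesis using True by simp
    next
      case False
      have "1 / ?n \<le> \<rho>" using n1 by (simp add: field_simps)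
      then have "\<mu>.smooth_approx m (x $ j) = 0"
        using j by (intro \<mu>.smooth_approx_eq_0[OF E]) (meson order_trans)
      moreover have "b * (F / (\<rho> * ?n) ^ N) \<ge> 0" using b F \<rho> by simp
      ultimately show ?thesis using False by simp
    qed
    have "approx_density m x = ?f j * (\<Prod>i\<in>UNIV - {j}. ?f i)"
      unfolding approx_density_def by (rule prod.remove) auto
    also have "\<dots> \<le> (b * (F / (\<rho> * ?n) ^ N)) * (\<Prod>i\<in>UNIV - {j}. b)"
      using f0 fb fj b F \<rho> by (intro mult_mono prod_mono prod_nonneg) auto
    also have "\<dots> = (b * b ^ (?k - 1)) * (F / (\<rho> * ?n) ^ N)"
      by (simp add: card_Diff_singleton)
    also have "b * b ^ (?k - 1) = b ^ ?k" by (simp add: power_eq_if)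
    also have "b ^ ?k * (F / (\<rho> * ?n) ^ N) = \<kappa> * (?n ^ (?D * ?k) / ?n ^ N)"
      unfolding b_def \<kappa>_def by (simp add: power_mult_distrib power_mult)
    also have "?n ^ (?D * ?k) / ?n ^ N = 1 / ?n" by (simp add: N_def)
    finally show "approx_density m x \<le> \<kappa> / ?n" by simp
  qed
qed

text \<open>\<open>Z\<close> stands for a level set and \<open>K\<close> for the support of the
  cutoff. Compactness of \<open>Z \<inter> K\<close> turns disjointness from the product of copies
  of \<open>E\<close> into a positive distance, where the density tends to 0 uniformly.\<close>

lemma integral_approx_density_tendsto_0:
  assumes E: "emeasure \<mu> (- E) = 0" "compact E"
    and \<nu>: "sets \<nu> = sets borel" "\<And>C. compact C \<Longrightarrow> emeasure \<nu> C < \<infinity>"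
    and \<eta>: "continuous_on UNIV \<eta>" "\<And>x. 0 \<le> \<eta> x" "\<And>x. \<eta> x \<le> 1" "compact K" "\<And>x. x \<notin> K \<Longrightarrow> \<eta> x = 0"
    and Z: "AE x in \<nu>. x \<in> Z" "compact (Z \<inter> K)" "\<And>x. x \<in> Z \<Longrightarrow> x \<in> K \<Longrightarrow> \<exists>i. x $ i \<notin> E"
  shows "(\<lambda>m. \<integral>x. \<eta> x * approx_density m x \<partial>\<nu>) \<longlonglongrightarrow> 0"
proof -
  let ?EE = "{x :: real ^ 'd ^ 'k. \<forall>i. x $ i \<in> E}"
  have nth: "continuous_on UNIV (\<lambda>x :: real ^ 'd ^ 'k. x $ i)" for i
    by (intro linear_continuous_on bounded_linear_vec_nth)
  have "closed ((\<lambda>x :: real ^ 'd ^ 'k. x $ i) -` E)" for i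
    using continuous_closed_preimage[OF nth closed_UNIV compact_imp_closed[OF E(2)], of i] by simp
  then have "closed (\<Inter>i. (\<lambda>x :: real ^ 'd ^ 'k. x $ i) -` E)" by (intro closed_INT) auto
  moreover have "(\<Inter>i. (\<lambda>x :: real ^ 'd ^ 'k. x $ i) -` E) = ?EE" by auto
  ultimately have EE: "closed ?EE" by simp
  have "(Z \<inter> K) \<inter> ?EE = {}" using Z(3) by blast
  then obtain d where d: "d > 0" "\<And>x y. x \<in> Z \<inter> K \<Longrightarrow> y \<in> ?EE \<Longrightarrow> d \<le> dist x y"
    using separate_compact_closed[OF Z(2) EE] by blast
  \<comment> \<open>If every coordinate were within \<open>d / CARD('k)\<close> of \<open>E\<close>,
    summing over the coordinates would put the point within \<open>d\<close> of the product
    set.\<close>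
  define \<rho> where "\<rho> = d / CARD('k)"
  have \<rho>: "\<rho> > 0" using d by (simp add: \<rho>_def)
  have far: "\<exists>i. \<forall>y\<in>E. norm (x $ i - y) \<ge> \<rho>" if x: "x \<in> Z \<inter> K" for x
  proof (rule ccontr)
    assume "\<not> ?thesis"
    then have "\<forall>i. \<exists>y. y \<in> E \<and> norm (x $ i - y) < \<rho>" by (meson not_le)
    then obtain y where y: "\<And>i. y i \<in> E" "\<And>i. norm (x $ i - y i) < \<rho>" by metis
    let ?y = "\<chi> i. y i"
    have "dist x ?y \<le> (\<Sum>i\<in>UNIV. norm ((x - ?y) $ i))" unfolding dist_norm by (rule norm_vec_le_sum)
    also have "\<dots> < (\<Sum>i\<in>(UNIV :: 'k set). \<rho>)" using y(2) by (intro sum_strict_mono) auto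
    also have "\<dots> = d" by (simp add: \<rho>_def)
    finally show False using d(2)[OF x, of ?y] y(1) by simp
  qed
  obtain \<kappa> where \<kappa>: "\<kappa> \<ge> 0" "\<And>m x. 1 / \<rho> < real (Suc m) \<Longrightarrow> \<exists>i. \<forall>y\<in>E. norm (x $ i - y) \<ge> \<rho> \<Longrightarrow> approx_density m x \<le> \<kappa> / real (Suc m)"
    using approx_density_off_le[OF E(1) compact_imp_closed[OF E(2)] \<rho>] by blast
  have K: "K \<in> sets \<nu>" using \<eta>(4) by (simp add: \<nu>(1) borel_compact)
  have le: "norm (\<integral>x. \<eta> x * approx_density m x \<partial>\<nu>) \<le> (\<kappa> * measure \<nu> K) * (1 / real (Suc m))"
    if m: "1 / \<rho> < real (Suc m)" for m
  proof -
    have "(\<integral>x. \<eta> x * approx_density m x \<partial>\<nu>) \<le> (\<integral>x. (\<kappa> / real (Suc m)) * indicat_real K x \<partial>\<nu>)"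
    proof (rule integral_mono_AE)
      show "integrable \<nu> (\<lambda>x. \<eta> x * approx_density m x)"
        by (rule integrable_of_compact_support[OF \<nu> _ \<eta>(4)])
           (auto intro!: continuous_on_mult \<eta>(1) continuous_on_approx_density simp: \<eta>(5))
      show "integrable \<nu> (\<lambda>x. (\<kappa> / real (Suc m)) * indicat_real K x)"
        using K \<nu>(2)[OF \<eta>(4)] by (intro integrable_mult_right integrable_real_indicator)
      show "AE x in \<nu>. \<eta> x * approx_density m x \<le> (\<kappa> / real (Suc m)) * indicat_real K x"
        using Z(1)
      proof eventually_elim
        fix x assume xZ: "x \<in> Z"
        show "\<eta> x * approx_density m x \<le> (\<kappa> / real (Suc m)) * indicat_real K x"
        proof (cases "x \<in> K")
          case True
          have "\<eta> x * approx_density m x \<le> 1 * approx_density m x"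
            by (intro mult_right_mono \<eta>(3) approx_density_nonneg)
          also have "\<dots> \<le> \<kappa> / real (Suc m)"
            using \<kappa>(2)[OF m far] xZ True by simp
          finally show ?thesis using True by simp
        qed (simp add: \<eta>(5))
      qed
    qed
    also have "\<dots> = (\<kappa> * measure \<nu> K) * (1 / real (Suc m))"
      using K by (simp add: sets_eq_imp_space_eq[OF \<nu>(1)])
    finally have "(\<integral>x. \<eta> x * approx_density m x \<partial>\<nu>) \<le> (\<kappa> * measure \<nu> K) * (1 / real (Suc m))" .
    moreover have "(\<integral>x. \<eta> x * approx_density m x \<partial>\<nu>) \<ge> 0"
      by (intro integral_nonneg_AE AE_I2 mult_nonneg_nonneg \<eta>(2) approx_density_nonneg)
    ultimately show ?thesis by simp
  qed
  have "(\<lambda>m. (\<kappa> * measure \<nu> K) * (1 / real (Suc m))) \<longlonglongrightarrow> (\<kappa> * measure \<nu> K) * 0"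
    by (intro tendsto_mult tendsto_const) (use LIMSEQ_inverse_real_of_nat in \<open>simp add: inverse_eq_divide\<close>)
  then have lim: "(\<lambda>m. (\<kappa> * measure \<nu> K) * (1 / real (Suc m))) \<longlonglongrightarrow> 0" by simp
  obtain M :: nat where M: "1 / \<rho> < real M" using reals_Archimedean2 by blast
  have "\<forall>\<^sub>F m in sequentially. norm (\<integral>x. \<eta> x * approx_density m x \<partial>\<nu>) \<le> (\<kappa> * measure \<nu> K) * (1 / real (Suc m))"
    unfolding eventually_sequentially
  proof (intro exI[of _ M] allI impI le)
    fix m assume "M \<le> m" then show "1 / \<rho> < real (Suc m)" using M by linarith
  qed
  then show ?thesis by (rule Lim_null_comparison[OF _ lim])
qed

end

section \<open>Nonempty interior\<close>

theorem theorem2p5: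
  fixes \<A> :: "('t::{t2_space,second_countable_topology}, 'p::finite) chart set"
    and \<Phi> :: "real ^ 'd::finite ^ 'k::finite \<Rightarrow> 't"
    and E :: "(real ^ 'd) set"
    and K :: "'t set"
    and \<beta> :: real
    and \<Sigma> :: "'k set set"
  assumes "CARD('k) \<ge> 2"
    and "smooth_atlas \<A>"
    and "submersion_into \<A> \<Phi>"
    and "compact E"
    and "compact K"
    and "configuration_set \<Phi> E \<subseteq> K"
    and "\<beta> \<ge> 0"
    and "\<Sigma> \<subseteq> partitions"
    and "\<forall>t0\<in>K. \<forall>x\<in>\<Phi> -` {t0}. \<exists>U V. \<exists>L\<in>\<Sigma>. \<exists>D \<phi> \<mu>.
           open U \<and> x \<in> U \<and> open V \<and> t0 \<in> V \<and>
           (D, \<phi>) \<in> \<A> \<and> V \<subseteq> D \<and> level_density (D, \<phi>) \<Phi> \<mu> \<and>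
           (\<forall>t\<in>V. double_fibration \<A> \<Phi> L U t) \<and>
           sobolev_estimates \<mu> CARD('p) \<beta> L U V"
    and "hausdorff_dim E >
           ereal ((real (Max ((\<lambda>L. max (CARD('d) * card L) (CARD('d) * card (- L))) ` \<Sigma>))
                   + real CARD('p) + 2 * \<beta>) / real CARD('k))"
  shows "interior (configuration_set \<Phi> E) \<noteq> {}"
proof (rule ccontr)
  assume int: "\<not> interior (configuration_set \<Phi> E) \<noteq> {}"
  note sub = \<open>submersion_into \<A> \<Phi>\<close> and E = \<open>compact E\<close>
  let ?\<Delta> = "configuration_set \<Phi> E"
  let ?d = "CARD('d)" and ?p = "CARD('p)" and ?k = "CARD('k)"
  define mx where "mx = (\<lambda>L :: 'k set. max (?d * card L) (?d * card (- L)))"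
  define b where "b = (real (Max (mx ` \<Sigma>)) + real ?p + 2 * \<beta>) / real ?k"
  have b: "b \<ge> 0" using \<open>\<beta> \<ge> 0\<close> by (simp add: b_def)
  have "ereal b < hausdorff_dim E" using assms(10) unfolding b_def mx_def by simp
  then obtain s where s: "b < s" "hausdorff_measure s E \<noteq> 0"
    using b by (rule less_hausdorff_dimE)
  have s0: "s > 0" using b s(1) by linarith
  obtain \<mu> C where \<mu>0: "prob_space \<mu>" "sets \<mu> = sets borel" "emeasure \<mu> (- E) = 0" "C > 0"
    and ball: "\<And>x r. 0 < r \<Longrightarrow> measure \<mu> (ball x r) \<le> C * r powr s"
    using frostman[OF E s0 s(2)] by metis
  have \<mu>: "borel_prob \<mu>"
    using \<mu>0(1,2) by (intro borel_prob.intro borel_prob_axioms.intro)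
  interpret \<mu>: borel_prob \<mu> by (rule \<mu>)
  \<comment> \<open>Needed to conclude \<open>a > 0\<close> below, which the finiteness of the
    energy requires.\<close>
  have sd: "s \<le> ?d"
    using \<mu>.frostman_exponent_le_DIM[OF \<mu>0(4) s0 ball] by simp
  obtain x0 where x0: "x0 \<in> E" and mass: "\<forall>r>0. measure \<mu> (ball x0 r) > 0"
    using \<mu>.exists_point_of_positive_mass[OF \<mu>0(3) E] by blast
  define X0 :: "real ^ 'd ^ 'k" where "X0 = (\<chi> i. x0)"
  have "\<forall>i. X0 $ i \<in> E" using x0 by (simp add: X0_def)
  then have "\<Phi> X0 \<in> ?\<Delta>" unfolding configuration_set_def by blast
  then have "\<Phi> X0 \<in> K" using assms(6) by blast
  then obtain U V L D \<phi> \<nu> where L: "L \<in> \<Sigma>"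
    and UV: "open U" "X0 \<in> U" "open V" "\<Phi> X0 \<in> V" "(D, \<phi>) \<in> \<A>" "V \<subseteq> D"
    and dens: "level_density (D, \<phi>) \<Phi> \<nu>"
    and est: "sobolev_estimates \<nu> ?p \<beta> L U V"
    using assms(9) by (metis vimage_singleton_eq)

  \<comment> \<open>Choice of the Sobolev order\<close>
  define dL dR where "dL = ?d * card L" and "dR = ?d * card (- L)"
  have dLR: "dL + dR = ?d * ?k"
    using card_Un_disjoint[of L "- L"] by (simp add: dL_def dR_def flip: distrib_left)
  define b' where "b' = (real (max dL dR) + ?p + 2 * \<beta>) / ?k"
  \<comment> \<open>From \<open>b' \<le> b < s \<le> d\<close> it follows that \<open>a\<close>
    exceeds both 0 and the energy threshold \<open>(d - s) / 2\<close>.\<close>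
  define a where "a = (?d - b') / 2"
  have "max dL dR \<le> Max (mx ` \<Sigma>)"
    using L by (intro Max_ge) (auto simp: mx_def dL_def dR_def)
  then have "b' \<le> b"
    unfolding b_def b'_def by (intro divide_right_mono) auto
  then have a: "a > 0" "a > (?d - s) / 2" using s(1) sd by (simp_all add: a_def)
  \<comment> \<open>This choice of \<open>a\<close> makes the order of the image space exactly dual to that of \<open>\<mu>\<close> on the left block.\<close>
  have exponent: "- (a * card (- L)) - m_eff ?p dL dR - \<beta> = a * card L"
  proof -
    have k: "real ?k = card L + card (- L)" using card_Un_disjoint[of L "- L"] by simp
    have k0: "real ?k > 0" by simp
    have "a * ?k = (?d * ?k - (real (max dL dR) + ?p + 2 * \<beta>)) / 2"
      using k0 by (simp add: a_def b'_def field_simps)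
    also have "real (?d * ?k) = real (max dL dR) + real (min dL dR)"
      unfolding dLR[symmetric] by (simp add: max_def min_def)
    finally have "a * ?k = (real (min dL dR) - ?p - 2 * \<beta>) / 2" by simp
    then show ?thesis unfolding k m_eff_def by (simp add: field_simps)
  qed

  \<comment> \<open>Localization near the diagonal point\<close>
  have op: "open (\<Phi> -` D)" and sm: "smooth_on (\<Phi> -` D) (\<phi> \<circ> \<Phi>)"
    using sub UV(5) unfolding submersion_into_def smooth_map_into_def by auto
  have chart: "open D" "homeomorphism D (\<phi> ` D) \<phi> (inv_into D \<phi>)"
    using assms(2) UV(5) unfolding smooth_atlas_def by auto
  have \<phi>\<Phi>: "continuous_on (\<Phi> -` D) (\<phi> \<circ> \<Phi>)"
    using sm unfolding smooth_on_def by (metis Ck_on.simps(1))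
  \<comment> \<open>Smoothness is only given in charts; continuity of \<open>\<Phi>\<close> itself
    is recovered by composing with the continuous inverse of the chart.\<close>
  have \<Phi>: "continuous_on (\<Phi> -` D) \<Phi>"
  proof -
    have "continuous_on (\<Phi> -` D) (inv_into D \<phi> \<circ> (\<phi> \<circ> \<Phi>))"
      by (intro continuous_on_compose \<phi>\<Phi> continuous_on_subset[OF homeomorphism_cont2[OF chart(2)]]) auto
    moreover have "(inv_into D \<phi> \<circ> (\<phi> \<circ> \<Phi>)) x = \<Phi> x" if "x \<in> \<Phi> -` D" for x
      using homeomorphism_apply1[OF chart(2), of "\<Phi> x"] that by simp
    ultimately show ?thesis by (rule continuous_on_eq)
  qed
  have \<phi>_inj: "x = y" if "\<phi> x = \<phi> y" "x \<in> D" "y \<in> D" for x y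
    using homeomorphism_apply1[OF chart(2)] that by metis
  have "open (\<Phi> -` D \<inter> \<Phi> -` V)"
    using continuous_open_preimage[OF \<Phi> op UV(3)] .
  then have "open (U \<inter> (\<Phi> -` D \<inter> \<Phi> -` V))" using UV(1) by auto
  moreover have "X0 \<in> U \<inter> (\<Phi> -` D \<inter> \<Phi> -` V)" using UV by auto
  ultimately obtain \<epsilon> where \<epsilon>: "\<epsilon> > 0" "cball X0 \<epsilon> \<subseteq> U \<inter> (\<Phi> -` D \<inter> \<Phi> -` V)"
    by (meson open_contains_cball)
  define n where "n = 1 / \<epsilon>"
  have n: "n > 0" "1 / n = \<epsilon>" using \<epsilon>(1) by (simp_all add: n_def)
  define Q where "Q = cball X0 \<epsilon>"
  have Q: "compact Q" "Q \<subseteq> U" "Q \<subseteq> \<Phi> -` D" "Q \<subseteq> \<Phi> -` V" using \<epsilon>(2) by (auto simp: Q_def)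
  define \<eta> where "\<eta> = (\<lambda>x. bump n (x - X0))"
  have \<eta>c: "continuous_on UNIV \<eta>"
    unfolding \<eta>_def using Ck_on_translate[OF Ck_on_bump, of 0 n X0] by simp
  have \<eta>: "\<eta> x \<ge> 0" "\<eta> x \<le> 1" for x unfolding \<eta>_def by (rule bump_nonneg bump_le_1)+
  have \<eta>0: "\<eta> x = 0" if "x \<notin> Q" for x
    unfolding \<eta>_def using that n by (intro bump_eq_0) (auto simp: Q_def dist_norm norm_minus_commute)
  let ?\<eta> = "\<lambda>x. complex_of_real (\<eta> x)"
  have "?\<eta> \<in> Cc_infinity U"
    unfolding \<eta>_def using n Q(2) by (intro bump_in_Cc_infinity) (auto simp: Q_def)
  then obtain C' where "\<forall>t\<in>V. sobolev_bounded (- L) L (- (a * card (- L)))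
      (- (a * card (- L)) - m_eff ?p dL dR - \<beta>) C' (radon L ?\<eta> (\<nu> t))"
    using est unfolding sobolev_estimates_def dL_def dR_def by blast
  then have bd: "sobolev_bounded (- L) L (- (a * card (- L))) (a * card L) C' (radon L ?\<eta> (\<nu> t))" if "t \<in> V" for t
    using that unfolding exponent by blast

  \<comment> \<open>The localized integrals over level sets\<close>
  have \<nu>: "sets (\<nu> t) = sets borel" "emeasure (\<nu> t) (- (\<Phi> -` {t})) = 0" "\<And>C. compact C \<Longrightarrow> emeasure (\<nu> t) C < \<infinity>"
    if "t \<in> D" for t
    using dens that unfolding level_density_def by auto
  define H where "H = (\<lambda>m x. \<eta> x * approx_density \<mu> L m x)"
  have Hc: "continuous_on UNIV (H m)" for m
    unfolding H_def by (intro continuous_on_mult \<eta>c continuous_on_approx_density[OF \<mu>])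
  have H_nn: "H m x \<ge> 0" for m x
    unfolding H_def by (intro mult_nonneg_nonneg \<eta> approx_density_nonneg[OF \<mu>])
  have H0: "H m x = 0" if "x \<notin> Q" for m x using \<eta>0[OF that] by (simp add: H_def)
  have Hsupp: "closure {x. H m x \<noteq> 0} \<subseteq> Q" for m
    by (rule closure_minimal) (use H0 Q(1) in \<open>auto intro: compact_imp_closed\<close>)
  have Hcomp: "compact (closure {x. H m x \<noteq> 0})" for m
    by (simp add: compact_eq_bounded_closed bounded_subset[OF compact_imp_bounded[OF Q(1)] Hsupp])
  define I where "I = (\<lambda>m t. \<integral>x. H m x \<partial>\<nu> t)"
  have Ic: "continuous_on D (I m)"
    and disint: "(\<integral>x. H m x \<partial>lborel) = (LINT s:\<phi> ` D|lborel. I m (inv_into D \<phi> s))" for m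
  proof -
    have "\<forall>f :: real ^ 'd ^ 'k \<Rightarrow> real.
     continuous_on UNIV f \<and> compact (closure {x. f x \<noteq> 0}) \<and> closure {x. f x \<noteq> 0} \<subseteq> \<Phi> -` D \<longrightarrow>
          continuous_on D (\<lambda>t. \<integral>x. f x \<partial>\<nu> t) \<and>
          (\<integral>x. f x \<partial>lborel) = (LINT s:\<phi> ` D|lborel. (\<integral>x. f x \<partial>\<nu> (inv_into D \<phi> s)))"
      using dens unfolding level_density_def prod.case by (rule conjunct2)
    from this[rule_format, of "H m", OF conjI[OF Hc conjI[OF Hcomp order_trans[OF Hsupp Q(3)]]]]
    show "continuous_on D (I m)" "(\<integral>x. H m x \<partial>lborel) = (LINT s:\<phi> ` D|lborel. I m (inv_into D \<phi> s))"
      unfolding I_def by simp_all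
  qed
  have I_nn: "I m t \<ge> 0" for m t unfolding I_def by (intro integral_nonneg_AE AE_I2 H_nn)
  \<comment> \<open>The pairing at mollified inputs is an honest integral of the cut-off product
    density, which links the operator estimates to disintegration.\<close>
  have radon_I: "radon L ?\<eta> (\<nu> t) (tensor (- L) (\<mu>.smooth_approx m)) (tensor L (\<mu>.heat_approx m)) = of_real (I m t)" for m t
    unfolding radon_def I_def H_def mult.assoc of_real_approx_density[OF \<mu>, symmetric]
    by (simp flip: of_real_mult)
  have Cauchy: "\<exists>M. \<forall>m\<ge>M. \<forall>n\<ge>M. \<forall>t\<in>V. \<bar>I m t - I n t\<bar> \<le> e" if e: "e > 0" for e
  proof -
    have fin: "(\<integral>\<^sup>+x. ennreal ((1 + (norm x)\<^sup>2) powr (- a) * (norm (char_fun \<mu> x))\<^sup>2) \<partial>lborel) < \<infinity>"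
      by (rule \<mu>.energy_finite[OF \<mu>0(4) s0 ball]) (use a in auto)
    have \<eta>c': "continuous_on UNIV ?\<eta>" by (intro continuous_intros \<eta>c)
    have V: "sets (\<nu> t) = sets borel" "\<And>C. compact C \<Longrightarrow> emeasure (\<nu> t) C < \<infinity>" if "t \<in> V" for t
      using \<nu>[of t] that UV(6) by auto
    have "\<exists>M. \<forall>m\<ge>M. \<forall>n\<ge>M. \<forall>t\<in>V. norm (complex_of_real (I m t) - complex_of_real (I n t)) \<le> e"
      using radon_approx_Cauchy[OF \<mu> \<mu>0(3) E less_imp_le[OF a(1)] fin V \<eta>c' Q(1) _ bd e] \<eta>0
      unfolding radon_I by simp
    then show ?thesis by (simp only: of_real_diff[symmetric] norm_of_real)
  qed

  \<comment> \<open>Uniform smallness from points outside the configuration set\<close>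
  have level_borel: "\<Phi> -` {t} \<in> sets borel" if "t \<in> D" for t
  proof -
    have "closedin (top_of_set (\<Phi> -` D)) (\<Phi> -` D \<inter> (\<phi> \<circ> \<Phi>) -` {\<phi> t})"
      by (rule continuous_closedin_preimage[OF \<phi>\<Phi>]) simp
    moreover have "\<Phi> -` D \<inter> (\<phi> \<circ> \<Phi>) -` {\<phi> t} = \<Phi> -` {t}" using that \<phi>_inj by auto
    ultimately obtain T where "closed T" "\<Phi> -` {t} = \<Phi> -` D \<inter> T"
      by (auto simp: closedin_closed)
    then show ?thesis using op by auto
  qed
  have level_AE: "AE x in \<nu> t. x \<in> \<Phi> -` {t}" if "t \<in> D" for t
  proof (rule AE_I)
    show "emeasure (\<nu> t) (- (\<Phi> -` {t})) = 0" by (rule \<nu>(2)[OF that])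
    show "- (\<Phi> -` {t}) \<in> sets (\<nu> t)" using level_borel[OF that] by (simp add: \<nu>(1)[OF that])
  qed auto

  have lim0: "(\<lambda>m. I m t) \<longlonglongrightarrow> 0" if t: "t \<in> V" "t \<notin> ?\<Delta>" for t
  proof -
    have tD: "t \<in> D" using t UV(6) by auto
    have "closedin (top_of_set Q) (Q \<inter> (\<phi> \<circ> \<Phi>) -` {\<phi> t})"
      by (rule continuous_closedin_preimage[OF continuous_on_subset[OF \<phi>\<Phi> Q(3)]]) simp
    moreover have "Q \<inter> (\<phi> \<circ> \<Phi>) -` {\<phi> t} = \<Phi> -` {t} \<inter> Q" using Q(3) tD \<phi>_inj by auto
    ultimately have cpt: "compact (\<Phi> -` {t} \<inter> Q)" using closedin_compact[OF Q(1)] by simp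
    have "\<exists>i. x $ i \<notin> E" if "x \<in> \<Phi> -` {t}" for x
      using t(2) that by (auto simp: configuration_set_def)
    then show ?thesis
      unfolding I_def H_def
      by (intro integral_approx_density_tendsto_0[where Z = "\<Phi> -` {t}" and K = Q and E = E]
          \<mu> \<mu>0(3) E \<nu>(1)[OF tD] \<nu>(3)[OF tD] \<eta>c \<eta> Q(1) \<eta>0 level_AE[OF tD] cpt)
  qed

  have small: "\<exists>M. \<forall>m\<ge>M. \<forall>t\<in>V. I m t \<le> e" if e: "e > 0" for e
  proof -
    obtain M where M: "\<forall>m\<ge>M. \<forall>n\<ge>M. \<forall>t\<in>V. \<bar>I m t - I n t\<bar> \<le> e" using Cauchy[OF e] by blast
    have "I m t \<le> e" if m: "m \<ge> M" and t: "t \<in> V" for m t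
    proof (rule ccontr)
      assume "\<not> I m t \<le> e"
      then have tO: "t \<in> V \<inter> I m -` {e<..}" using t by simp
      \<comment> \<open>By continuity of \<open>I m\<close> a value above \<open>e\<close> persists
        on a nonempty open set, which cannot lie in a configuration set with empty interior. At a
        point \<open>t'\<close> outside, the Cauchy bound and the limit 0 together force
        \<open>I m t' \<le> e\<close>.\<close>
      have "open (V \<inter> I m -` {e<..})"
        by (rule continuous_open_preimage[OF continuous_on_subset[OF Ic UV(6)] UV(3)]) simp
      then have "\<not> V \<inter> I m -` {e<..} \<subseteq> ?\<Delta>" using tO int interior_maximal by blast
      then obtain t' where t': "t' \<in> V" "e < I m t'" "t' \<notin> ?\<Delta>" by blast
      have "(\<lambda>n. I m t' - I n t') \<longlonglongrightarrow> I m t' - 0" by (intro tendsto_diff tendsto_const lim0 t')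
      moreover have "\<forall>n\<ge>M. I m t' - I n t' \<le> e" using M m t'(1) by (meson abs_le_D1)
      ultimately have "I m t' - 0 \<le> e" by (intro Lim_bounded) auto
      then show False using t'(2) by simp
    qed
    then show ?thesis by blast
  qed

  \<comment> \<open>Upper bound for the total mass by disintegration\<close>
  define T where "T = (\<phi> \<circ> \<Phi>) ` Q"
  have T: "compact T" unfolding T_def by (intro compact_continuous_image continuous_on_subset[OF \<phi>\<Phi> Q(3)] Q(1))
  have I0: "I m (inv_into D \<phi> s) = 0" if s: "s \<in> \<phi> ` D" "s \<notin> T" for m s
  proof -
    let ?t = "inv_into D \<phi> s"
    have t: "?t \<in> D" "\<phi> ?t = s" using s(1) by (auto simp: inv_into_into f_inv_into_f)
    have "AE x in \<nu> ?t. H m x = 0"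
      using level_AE[OF t(1)]
    proof eventually_elim
      fix x assume "x \<in> \<Phi> -` {?t}"
      then have "(\<phi> \<circ> \<Phi>) x = s" using t(2) by simp
      then have "x \<notin> Q" using s(2) by (auto simp: T_def)
      then show "H m x = 0" by (rule H0)
    qed
    then show ?thesis unfolding I_def by (rule integral_eq_zero_AE)
  qed
  \<comment> \<open>Parameters in \<open>T\<close> belong to levels that meet \<open>Q\<close>, and
    \<open>Q\<close> was chosen over \<open>V\<close>; so the bound on \<open>V\<close> suffices,
    and the rest of the chart contributes 0 by \<open>I0\<close>.\<close>
  have IV: "inv_into D \<phi> s \<in> V" if s: "s \<in> \<phi> ` D" "s \<in> T" for s
  proof -
    obtain x where x: "x \<in> Q" "s = \<phi> (\<Phi> x)" using s(2) by (auto simp: T_def)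
    then have "inv_into D \<phi> s = \<Phi> x" using homeomorphism_apply1[OF chart(2), of "\<Phi> x"] Q(3) by auto
    then show ?thesis using x(1) Q(4) by auto
  qed
  have upper: "(\<integral>x. H m x \<partial>lborel) \<le> e * measure lborel T" if e: "e \<ge> 0" and le: "\<forall>t\<in>V. I m t \<le> e" for m e
  proof -
    let ?J = "\<lambda>s. indicator (\<phi> ` D) s *\<^sub>R I m (inv_into D \<phi> s)"
    have Tm: "T \<in> sets borel" "emeasure lborel T < \<infinity>" using emeasure_compact_finite[OF T] T by (simp_all add: borel_compact)
    have J: "?J s \<le> e * indicat_real T s" for s
      using IV[of s] I0[of s m] le e by (cases "s \<in> \<phi> ` D"; cases "s \<in> T") auto
    have iT: "integrable lborel (\<lambda>s. e * indicat_real T s)" using Tm by auto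
    have "(\<integral>s. ?J s \<partial>lborel) \<le> (\<integral>s. e * indicat_real T s \<partial>lborel)"
    proof (cases "integrable lborel ?J")
      case True
      then show ?thesis using iT J by (intro integral_mono)
    next
      \<comment> \<open>Without integrability the integral has the default value 0, which the
        nonnegative right-hand side still bounds.\<close>
      case False
      have "0 \<le> (\<integral>s. e * indicat_real T s \<partial>lborel)" using e by (intro integral_nonneg_AE AE_I2) simp
      then show ?thesis using False by (simp add: not_integrable_integral_eq)
    qed
    then show ?thesis unfolding disint set_lebesgue_integral_def using Tm by simp
  qed

  \<comment> \<open>Lower bound for the total mass and contradiction\<close>
  define \<rho> where "\<rho> = \<epsilon> / (4 * ?k)"
  have \<rho>: "\<rho> > 0" using \<epsilon>(1) by (simp add: \<rho>_def)
  obtain c M0 where c: "c > 0" and M0: "\<forall>m\<ge>M0. ennreal c \<le>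
    (\<integral>\<^sup>+x. ennreal (approx_density \<mu> L m x) * indicator {x. \<forall>i. x $ i \<in> ball x0 (2 * \<rho>)} x \<partial>lborel)"
    using approx_density_mass[OF \<mu>, of x0 \<rho> L] mass \<rho> by blast
  have lower: "exp (- (4 / 3)) * c \<le> (\<integral>x. H m x \<partial>lborel)" if m: "m \<ge> M0" for m
  proof -
    have near: "\<eta> x \<ge> exp (- (4 / 3))" if "\<forall>i. x $ i \<in> ball x0 (2 * \<rho>)" for x
    proof -
      have "norm (x - X0) \<le> (\<Sum>i\<in>UNIV. norm ((x - X0) $ i))" by (rule norm_vec_le_sum)
      also have "\<dots> \<le> (\<Sum>i\<in>(UNIV :: 'k set). 2 * \<rho>)"
        using that by (intro sum_mono) (auto simp: X0_def dist_norm norm_minus_commute less_imp_le)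
      \<comment> \<open>The denominator \<open>4 * ?k\<close> in \<open>\<rho>\<close> makes the
        \<open>?k\<close> contributions of \<open>2 * \<rho>\<close> add up to half the radius of
        the cutoff, where \<open>bump_ge\<close> applies.\<close>
      also have "\<dots> = 1 / (2 * n)" by (simp add: \<rho>_def n_def)
      finally show ?thesis unfolding \<eta>_def by (intro bump_ge n)
    qed
    have "ennreal (exp (- (4 / 3)) * c) \<le> ennreal (exp (- (4 / 3))) *
        (\<integral>\<^sup>+x. ennreal (approx_density \<mu> L m x) * indicator {x. \<forall>i. x $ i \<in> ball x0 (2 * \<rho>)} x \<partial>lborel)"
      using M0 m c by (subst ennreal_mult') (auto intro: mult_left_mono)
    also have "\<dots> \<le> (\<integral>\<^sup>+x. ennreal (exp (- (4 / 3))) * (ennreal (approx_density \<mu> L m x) * indicator {x. \<forall>i. x $ i \<in> ball x0 (2 * \<rho>)} x) \<partial>lborel)"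
    proof (rule eq_refl, rule nn_integral_cmult[symmetric])
      have "open {x :: real ^ 'd ^ 'k. \<forall>i. x $ i \<in> ball x0 (2 * \<rho>)}"
      proof -
        have "open ((\<lambda>x :: real ^ 'd ^ 'k. x $ i) -` ball x0 (2 * \<rho>))" for i
          by (intro open_vimage) (auto intro: linear_continuous_on bounded_linear_vec_nth)
        then have "open (\<Inter>i. (\<lambda>x :: real ^ 'd ^ 'k. x $ i) -` ball x0 (2 * \<rho>))" by (intro open_INT) auto
        moreover have "(\<Inter>i. (\<lambda>x :: real ^ 'd ^ 'k. x $ i) -` ball x0 (2 * \<rho>)) = {x. \<forall>i. x $ i \<in> ball x0 (2 * \<rho>)}" by auto
        ultimately show ?thesis by simp
      qed
      then have "indicator {x :: real ^ 'd ^ 'k. \<forall>i. x $ i \<in> ball x0 (2 * \<rho>)} \<in> borel_measurable (lborel :: (real ^ 'd ^ 'k) measure)"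
        by (intro borel_measurable_indicator) auto
      moreover have "approx_density \<mu> L m \<in> borel_measurable lborel"
        using borel_measurable_continuous_onI[OF continuous_on_approx_density[OF \<mu>]] by simp
      ultimately show "(\<lambda>x. ennreal (approx_density \<mu> L m x) * indicator {x. \<forall>i. x $ i \<in> ball x0 (2 * \<rho>)} x) \<in> borel_measurable lborel"
        by (intro borel_measurable_times_ennreal) auto
    qed
    also have "\<dots> \<le> (\<integral>\<^sup>+x. ennreal (H m x) \<partial>lborel)"
    proof (rule nn_integral_mono)
      fix x
      show "ennreal (exp (- (4 / 3))) * (ennreal (approx_density \<mu> L m x) * indicator {x. \<forall>i. x $ i \<in> ball x0 (2 * \<rho>)} x) \<le> ennreal (H m x)"
      proof (cases "\<forall>i. x $ i \<in> ball x0 (2 * \<rho>)")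
        case True
        have "exp (- (4 / 3)) * approx_density \<mu> L m x \<le> H m x"
          unfolding H_def by (intro mult_right_mono near[OF True] approx_density_nonneg[OF \<mu>])
        then show ?thesis using True by (simp add: ennreal_mult'[symmetric] ennreal_leI)
      qed simp
    qed
    also have "\<dots> = ennreal (\<integral>x. H m x \<partial>lborel)"
    proof (rule nn_integral_eq_integral)
      show "integrable lborel (H m)"
        by (rule integrable_of_compact_support[OF _ _ Hc Q(1) H0]) (use emeasure_compact_finite in auto)
    qed (simp add: H_nn)
    finally show ?thesis
      by (subst (asm) ennreal_le_iff) (auto intro: integral_nonneg_AE H_nn)
  qed

  define w where "w = measure lborel T + 1"
  have w: "w > 0" by (simp add: w_def add_nonneg_pos)
  \<comment> \<open>Chosen so that \<open>e * w\<close> is half of the lower bound; the added 1 in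
    \<open>w\<close> covers the case that \<open>T\<close> is a null set.\<close>
  define e where "e = exp (- (4 / 3)) * c / (2 * w)"
  have e: "e > 0" using c w by (simp add: e_def)
  obtain M where M: "\<forall>m\<ge>M. \<forall>t\<in>V. I m t \<le> e" using small[OF e] by blast
  have "exp (- (4 / 3)) * c \<le> (\<integral>x. H (max M M0) x \<partial>lborel)" by (rule lower) simp
  also have "\<dots> \<le> e * measure lborel T" by (rule upper[OF less_imp_le[OF e]]) (use M in simp)
  also have "\<dots> \<le> e * w" using e by (intro mult_left_mono) (auto simp: w_def)
  also have "\<dots> = exp (- (4 / 3)) * c / 2" using w by (simp add: e_def)
  finally show False using c by simp
qed

end
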